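(* Let $\Lambda$ be a row-finite $k$-graph with no sources, let $\mathfrak{T}$ be the set of regular paths in $\Lambda^\infty$, let $\Upsilon$ be the twisted aperiodic representation of $C^*(\Lambda)$, and let $\mathcal{X}=\{e_{z,x} : (z,x)\in\mathbb{T}^k\times\mathfrak{T}\}$, a collection of pure states on $\Upsilon(\mathscr{M})$. Then every state in $\mathcal{X}$ extends uniquely to a state on $\Upsilon(C^*(\Lambda))$. Specifically, if $\rho\in\mathcal{X}$ is presented as $\rho=e_{z,x}$ for some pair $(z,x)\in\mathbb{T}^k\times\mathfrak{T}$ (such a presentation need not be unique), then its unique extension is $\psi_{z,x}$.
   Context: Here $\mathbb{N}=\{0,1,2,\dots\}$ and $k\ge 1$. A $k$-graph $\Lambda$ is a countable category (identified with its set of morphisms, called paths; objects are identified with identity morphisms) with range and source maps $r,s$, together with a degree map $d:\Lambda\to\mathbb{N}^k$ such that $d(\mu\nu)=d(\mu)+d(\nu)$ whenever $s(\mu)=r(\nu)$, and such that whenever $d(\lambda)=m+n$ there are unique $\mu,\nu\in\Lambda$ with $\lambda=\mu\nu$, $d(\mu)=m$, $d(\nu)=n$. $\Lambda^n=d^{-1}(n)$; $\Lambda^0$ is the set of objects (vertices); $v\Lambda=\{\lambda: r(\lambda)=v\}$, $v\Lambda^n=v\Lambda\cap\Lambda^n$. $\Lambda$ has no sources if $v\Lambda^n\ne\emptyset$ for all $v\in\Lambda^0,n\in\mathbb{N}^k$, and is row-finite if every $v\Lambda^n$ is finite. Infinite paths: $\Lambda^\infty$ is the set of families $x=(x(m,n))_{m\le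 n\in\mathbb{N}^k}$ (coordinatewise order) with $x(m,n)\in\Lambda^{n-m}$ and $x(m,n)x(n,p)=x(m,p)$ for $m\le n\le p$; $r(x)=x(0,0)$ and $v\Lambda^\infty=\{x: r(x)=v\}$. The sets $Z(\mu)=\{x\in\Lambda^\infty: x(0,d(\mu))=\mu\}$ are a basis of the topology on $\Lambda^\infty$. For $x\in s(\alpha)\Lambda^\infty$, $\alpha x$ is the unique infinite path with $(\alpha x)(0,n)=\alpha\, x(0,n-d(\alpha))$ for $n\ge d(\alpha)$. For $p\in\mathbb{N}^k$, $\sigma^p(x)(m,n)=x(m+p,n+p)$. A Cuntz-Krieger $\Lambda$-family in a $C^*$-algebra is a functor $\lambda\mapsto T_\lambda$ from $\Lambda$ into its partial isometries (so $T_{\mu\nu}=T_\mu T_\nu$ when $s(\mu)=r(\nu)$) with (CK1) $T_\mu^*T_\nu=\delta_{\mu,\nu}T_{s(\mu)}T_{s(\mu)}^*$ for $n\in\mathbb{N}^k$, $\mu,\nu\in\Lambda^n$, and (CK2) $T_v^*T_v=\sum_{\lambda\in v\Lambda^n}T_\lambda T_\lambda^*$ for $n\in\mathbb{N}^k$, $v\in\Lambda^0$. $C^*(\Lambda)$ is generated by a universal Cuntz-Krieger $\Lambda$-family $\{S_\lambda\}$; $P_\lambda=S_\lambda S_\lambda^*$. A pair $(\alpha,\beta)\in\Lambda\times\Lambda$ with $s(\alpha)=s(\beta)$ is cycline if $P_{\alpha\gamma}=P_{\beta\gamma}$ for all $\gamma\in s(\alpha)\Lambda$ (equivalently, $\alpha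 y=\beta y$ for all $y\in s(\alpha)\Lambda^\infty$). $\mathscr{M}=C^*(\{S_\alpha S_\beta^*:(\alpha,\beta)\text{ cycline}\})\subset C^*(\Lambda)$, an abelian $C^*$-subalgebra. Regular paths: $\Sigma=\{(\alpha,\beta)\in\Lambda\times\Lambda: s(\alpha)=s(\beta),\ \alpha\ne\beta\}$; for $(\alpha,\beta)\in\Sigma$, $F_{\alpha,\beta}=\{x\in\Lambda^\infty: x(0,d(\alpha))=\alpha,\ x(0,d(\beta))=\beta,\ \sigma^{d(\alpha)}(x)=\sigma^{d(\beta)}(x)\}$; and $\mathfrak{T}=\Lambda^\infty\setminus\bigcup_{(\alpha,\beta)\in\Sigma}\partial F_{\alpha,\beta}$, where $\partial$ denotes topological boundary. One has $\alpha x\in\mathfrak{T}$ whenever $x\in\mathfrak{T}$, $r(x)=s(\alpha)$. Let $T_\alpha\in B(\ell^2(\mathfrak{T}))$ be given on the canonical basis by $T_\alpha\delta_x=\delta_{\alpha x}$ if $x\in s(\alpha)\Lambda^\infty$ and $T_\alpha\delta_x=0$ otherwise; $\{T_\alpha\}$ is a Cuntz-Krieger $\Lambda$-family. The aperiodic representation $\upsilon:C^*(\Lambda)\to B(\ell^2(\mathfrak{T}))$ is the $*$-homomorphism with $\upsilon(S_\alpha)=T_\alpha$. Put $A=\upsilon(C^*(\Lambda))$. For $x\in\mathfrak{T}$ let $\phi_x$ be the state on $A$ given by $\phi_x(T)=\langle T\delta_x|\delta_x\rangle$ (a pure state). For $n\in\mathbb{Z}^k$ let $h_n\in C(\mathbb{T}^k)$,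 $h_n(z)=z_1^{n_1}\cdots z_k^{n_k}$. The twisted aperiodic representation is the (injective) $*$-homomorphism $\Upsilon:C^*(\Lambda)\to C(\mathbb{T}^k)\otimes B(\ell^2(\mathfrak{T}))$ with $\Upsilon(S_\alpha)=h_{d(\alpha)}\otimes T_\alpha$; its range lies in $C(\mathbb{T}^k)\otimes A$. For $(z,x)\in\mathbb{T}^k\times\mathfrak{T}$, with $\mathrm{ev}_z$ evaluation at $z$, define the states $\psi_{z,x}=(\mathrm{ev}_z\otimes\phi_x)|_{\Upsilon(C^*(\Lambda))}$ on $\Upsilon(C^*(\Lambda))$ and $e_{z,x}=\psi_{z,x}|_{\Upsilon(\mathscr{M})}$ on $\Upsilon(\mathscr{M})$. *)

theory Defs
  imports "HOL-Analysis.Analysis" "HOL-Algebra.Module"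
begin

section \<open>\<open>C\<^sup>*\<close>-algebras\<close>

text \<open>
  Algebras are carrier-based, so that subalgebras and images of homomorphisms are again algebras
  and one can quantify over algebras inside a formula.  A \<open>C\<^sup>*\<close>-algebra need not be
  unital: the field \<^const>\<open>one\<close> inherited from \<open>ring\<close> carries no meaning here.
\<close>

record 'a star_alg = "(complex, 'a) module" +
  star :: "'a \<Rightarrow> 'a"
  cnorm :: "'a \<Rightarrow> real"

definition complex_ring :: "complex ring" where
  "complex_ring = \<lparr>carrier = UNIV, mult = (*), one = 1, zero = 0, add = (+)\<rparr>"

text \<open>The case distinction is there because \<^locale>\<open>Metric_space\<close> requires symmetry and
  nonnegativity also off the carrier.\<close>

definition cdist :: "'a star_alg \<Rightarrow> 'a \<Rightarrow> 'a \<Rightarrow> real" where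
  "cdist A a b = (if a \<in> carrier A \<and> b \<in> carrier A then cnorm A (a \<ominus>\<^bsub>A\<^esub> b) else 0)"

definition norm_topology :: "'a star_alg \<Rightarrow> 'a topology" where
  "norm_topology A = Metric_space.mtopology (carrier A) (cdist A)"

locale cstar_algebra = module complex_ring A for A :: "'a star_alg" +
  assumes mult_closed: "\<lbrakk>a \<in> carrier A; b \<in> carrier A\<rbrakk> \<Longrightarrow> a \<otimes>\<^bsub>A\<^esub> b \<in> carrier A"
    and mult_assoc: "\<lbrakk>a \<in> carrier A; b \<in> carrier A; c \<in> carrier A\<rbrakk> \<Longrightarrow>
      (a \<otimes>\<^bsub>A\<^esub> b) \<otimes>\<^bsub>A\<^esub> c = a \<otimes>\<^bsub>A\<^esub> (b \<otimes>\<^bsub>A\<^esub> c)"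
    and mult_l_distr: "\<lbrakk>a \<in> carrier A; b \<in> carrier A; c \<in> carrier A\<rbrakk> \<Longrightarrow>
      (a \<oplus>\<^bsub>A\<^esub> b) \<otimes>\<^bsub>A\<^esub> c = a \<otimes>\<^bsub>A\<^esub> c \<oplus>\<^bsub>A\<^esub> b \<otimes>\<^bsub>A\<^esub> c"
    and mult_r_distr: "\<lbrakk>a \<in> carrier A; b \<in> carrier A; c \<in> carrier A\<rbrakk> \<Longrightarrow>
      a \<otimes>\<^bsub>A\<^esub> (b \<oplus>\<^bsub>A\<^esub> c) = a \<otimes>\<^bsub>A\<^esub> b \<oplus>\<^bsub>A\<^esub> a \<otimes>\<^bsub>A\<^esub> c"
    and smult_mult_l: "\<lbrakk>a \<in> carrier A; b \<in> carrier A\<rbrakk> \<Longrightarrow>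
      (k \<odot>\<^bsub>A\<^esub> a) \<otimes>\<^bsub>A\<^esub> b = k \<odot>\<^bsub>A\<^esub> (a \<otimes>\<^bsub>A\<^esub> b)"
    and smult_mult_r: "\<lbrakk>a \<in> carrier A; b \<in> carrier A\<rbrakk> \<Longrightarrow>
      a \<otimes>\<^bsub>A\<^esub> (k \<odot>\<^bsub>A\<^esub> b) = k \<odot>\<^bsub>A\<^esub> (a \<otimes>\<^bsub>A\<^esub> b)"
    and star_closed: "a \<in> carrier A \<Longrightarrow> star A a \<in> carrier A"
    and star_star: "a \<in> carrier A \<Longrightarrow> star A (star A a) = a"
    and star_add: "\<lbrakk>a \<in> carrier A; b \<in> carrier A\<rbrakk> \<Longrightarrow>
      star A (a \<oplus>\<^bsub>A\<^esub> b) = star A a \<oplus>\<^bsub>A\<^esub> star A b"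
    and star_smult: "a \<in> carrier A \<Longrightarrow> star A (k \<odot>\<^bsub>A\<^esub> a) = cnj k \<odot>\<^bsub>A\<^esub> star A a"
    and star_mult: "\<lbrakk>a \<in> carrier A; b \<in> carrier A\<rbrakk> \<Longrightarrow>
      star A (a \<otimes>\<^bsub>A\<^esub> b) = star A b \<otimes>\<^bsub>A\<^esub> star A a"
    and norm_nonneg: "a \<in> carrier A \<Longrightarrow> 0 \<le> cnorm A a"
    and norm_eq_0: "a \<in> carrier A \<Longrightarrow> cnorm A a = 0 \<longleftrightarrow> a = \<zero>\<^bsub>A\<^esub>"
    and norm_triangle: "\<lbrakk>a \<in> carrier A; b \<in> carrier A\<rbrakk> \<Longrightarrow>
      cnorm A (a \<oplus>\<^bsub>A\<^esub> b) \<le> cnorm A a + cnorm A b"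
    and norm_smult: "a \<in> carrier A \<Longrightarrow> cnorm A (k \<odot>\<^bsub>A\<^esub> a) = cmod k * cnorm A a"
    and norm_mult_le: "\<lbrakk>a \<in> carrier A; b \<in> carrier A\<rbrakk> \<Longrightarrow>
      cnorm A (a \<otimes>\<^bsub>A\<^esub> b) \<le> cnorm A a * cnorm A b"
    and cstar_identity: "a \<in> carrier A \<Longrightarrow> cnorm A (star A a \<otimes>\<^bsub>A\<^esub> a) = (cnorm A a)\<^sup>2"
    and complete: "Metric_space.mcomplete (carrier A) (cdist A)"

context cstar_algebra begin
lemma cnorm_minus_commute:
  assumes "a \<in> carrier A" "b \<in> carrier A"
  shows "cnorm A (a \<ominus>\<^bsub>A\<^esub> b) = cnorm A (b \<ominus>\<^bsub>A\<^esub> a)"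
proof -
  have m: "\<ominus>\<^bsub>complex_ring\<^esub> \<one>\<^bsub>complex_ring\<^esub> = (-1::complex)"
    by (rule R.minus_equality[symmetric, THEN sym]) (auto simp: complex_ring_def)
  have "a \<ominus>\<^bsub>A\<^esub> b = \<ominus>\<^bsub>A\<^esub> (b \<ominus>\<^bsub>A\<^esub> a)"
    using assms by (simp add: M.minus_eq M.minus_add M.a_comm)
  also have "\<dots> = (-1) \<odot>\<^bsub>A\<^esub> (b \<ominus>\<^bsub>A\<^esub> a)"
    using assms smult_l_minus[of "\<one>\<^bsub>complex_ring\<^esub>" "b \<ominus>\<^bsub>A\<^esub> a"] m by simp
  finally show ?thesis
    using assms norm_smult[of "b \<ominus>\<^bsub>A\<^esub> a" "-1"] by simp
qed

lemma Metric_space_cdist: "Metric_space (carrier A) (cdist A)"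
proof
  show "0 \<le> cdist A x y" for x y by (simp add: cdist_def norm_nonneg)
  show "cdist A x y = cdist A y x" for x y by (simp add: cdist_def cnorm_minus_commute)
  show "cdist A x y = 0 \<longleftrightarrow> x = y" if "x \<in> carrier A" "y \<in> carrier A" for x y
  proof -
    have "x \<ominus>\<^bsub>A\<^esub> y = \<zero>\<^bsub>A\<^esub> \<longleftrightarrow> x = y"
      using that M.minus_equality[of x "\<ominus>\<^bsub>A\<^esub> y"] by (auto simp: M.minus_eq M.r_neg)
    then show ?thesis using that by (simp add: cdist_def norm_eq_0)
  qed
  show "cdist A x z \<le> cdist A x y + cdist A y z"
    if "x \<in> carrier A" "y \<in> carrier A" "z \<in> carrier A" for x y z
  proof -
    have "x \<ominus>\<^bsub>A\<^esub> z = (x \<ominus>\<^bsub>A\<^esub> y) \<oplus>\<^bsub>A\<^esub> (y \<ominus>\<^bsub>A\<^esub> z)"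
      using that by (simp add: M.minus_eq M.a_assoc M.r_neg1 M.r_neg2)
    then show ?thesis using that norm_triangle[of "x \<ominus>\<^bsub>A\<^esub> y" "y \<ominus>\<^bsub>A\<^esub> z"] by (simp add: cdist_def)
  qed
qed
end

definition star_hom :: "'a star_alg \<Rightarrow> 'b star_alg \<Rightarrow> ('a \<Rightarrow> 'b) \<Rightarrow> bool" where
  "star_hom A B \<pi> \<longleftrightarrow>
     \<pi> \<in> carrier A \<rightarrow> carrier B \<and>
     (\<forall>a\<in>carrier A. \<forall>b\<in>carrier A. \<pi> (a \<oplus>\<^bsub>A\<^esub> b) = \<pi> a \<oplus>\<^bsub>B\<^esub> \<pi> b) \<and>
     (\<forall>k. \<forall>a\<in>carrier A. \<pi> (k \<odot>\<^bsub>A\<^esub> a) = k \<odot>\<^bsub>B\<^esub> \<pi> a) \<and>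
     (\<forall>a\<in>carrier A. \<forall>b\<in>carrier A. \<pi> (a \<otimes>\<^bsub>A\<^esub> b) = \<pi> a \<otimes>\<^bsub>B\<^esub> \<pi> b) \<and>
     (\<forall>a\<in>carrier A. \<pi> (star A a) = star B (\<pi> a))"

definition cstar_subalgebra :: "'a star_alg \<Rightarrow> 'a set \<Rightarrow> bool" where
  "cstar_subalgebra A B \<longleftrightarrow>
     B \<subseteq> carrier A \<and> \<zero>\<^bsub>A\<^esub> \<in> B \<and>
     (\<forall>a\<in>B. \<forall>b\<in>B. a \<oplus>\<^bsub>A\<^esub> b \<in> B) \<and>
     (\<forall>k. \<forall>a\<in>B. k \<odot>\<^bsub>A\<^esub> a \<in> B) \<and>
     (\<forall>a\<in>B. \<forall>b\<in>B. a \<otimes>\<^bsub>A\<^esub> b \<in> B) \<and>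
     (\<forall>a\<in>B. star A a \<in> B) \<and>
     closedin (norm_topology A) B"

definition cstar_generated :: "'a star_alg \<Rightarrow> 'a set \<Rightarrow> 'a set" where
  "cstar_generated A G = \<Inter>{B. cstar_subalgebra A B \<and> G \<subseteq> B}"

text \<open>States are taken to be undefined off the carrier, so that equality of states as HOL functions
  is equality on the algebra.\<close>

definition state :: "'a star_alg \<Rightarrow> ('a \<Rightarrow> complex) \<Rightarrow> bool" where
  "state B f \<longleftrightarrow>
     f \<in> extensional (carrier B) \<and>
     (\<forall>a\<in>carrier B. \<forall>b\<in>carrier B. f (a \<oplus>\<^bsub>B\<^esub> b) = f a + f b) \<and>
     (\<forall>k. \<forall>a\<in>carrier B. f (k \<odot>\<^bsub>B\<^esub> a) = k * f a) \<and>
     (\<forall>a\<in>carrier B. f (star B a \<otimes>\<^bsub>B\<^esub> a) \<in> \<real>\<^sub>\<ge>\<^sub>0) \<and>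
     bdd_above ((\<lambda>a. cmod (f a)) ` {a \<in> carrier B. cnorm B a \<le> 1}) \<and>
     (SUP a\<in>{a \<in> carrier B. cnorm B a \<le> 1}. cmod (f a)) = 1"

definition pure_state :: "'a star_alg \<Rightarrow> ('a \<Rightarrow> complex) \<Rightarrow> bool" where
  "pure_state B f \<longleftrightarrow>
     state B f \<and>
     (\<forall>g h. \<forall>t::real. state B g \<and> state B h \<and> 0 < t \<and> t < 1 \<and>
        (\<forall>a\<in>carrier B. f a = of_real t * g a + of_real (1 - t) * h a) \<longrightarrow> g = f \<and> h = f)"

subsection \<open>Bounded operators on \<open>\<ell>\<^sup>2(X)\<close>\<close>

definition ell2 :: "'x set \<Rightarrow> ('x \<Rightarrow> complex) set" where
  "ell2 X = {f. (\<forall>x. x \<notin> X \<longrightarrow> f x = 0) \<and> (\<lambda>x. (cmod (f x))\<^sup>2) summable_on X}"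

definition ell2_inner :: "'x set \<Rightarrow> ('x \<Rightarrow> complex) \<Rightarrow> ('x \<Rightarrow> complex) \<Rightarrow> complex" where
  "ell2_inner X f g = (\<Sum>\<^sub>\<infinity>x\<in>X. f x * cnj (g x))"

definition ell2_norm :: "'x set \<Rightarrow> ('x \<Rightarrow> complex) \<Rightarrow> real" where
  "ell2_norm X f = sqrt (\<Sum>\<^sub>\<infinity>x\<in>X. (cmod (f x))\<^sup>2)"

definition delta :: "'x \<Rightarrow> 'x \<Rightarrow> complex" where
  "delta x = (\<lambda>y. if y = x then 1 else 0)"

type_synonym 'x oper = "('x \<Rightarrow> complex) \<Rightarrow> ('x \<Rightarrow> complex)"

definition bounded_ops :: "'x set \<Rightarrow> 'x oper set" where
  "bounded_ops X = {T \<in> ell2 X \<rightarrow>\<^sub>E ell2 X.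
     (\<forall>f\<in>ell2 X. \<forall>g\<in>ell2 X. T (\<lambda>x. f x + g x) = (\<lambda>x. T f x + T g x)) \<and>
     (\<forall>k. \<forall>f\<in>ell2 X. T (\<lambda>x. k * f x) = (\<lambda>x. k * T f x)) \<and>
     (\<exists>c. \<forall>f\<in>ell2 X. ell2_norm X (T f) \<le> c * ell2_norm X f)}"

definition hilbert_adjoint :: "'x set \<Rightarrow> 'x oper \<Rightarrow> 'x oper" where
  "hilbert_adjoint X T = (THE S. S \<in> bounded_ops X \<and>
     (\<forall>f\<in>ell2 X. \<forall>g\<in>ell2 X. ell2_inner X (T f) g = ell2_inner X f (S g)))"

definition B_ell2 :: "'x set \<Rightarrow> 'x oper star_alg" where
  "B_ell2 X = \<lparr>
     carrier = bounded_ops X,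
     mult = (\<lambda>S T. restrict (\<lambda>f. S (T f)) (ell2 X)),
     one = restrict (\<lambda>f. f) (ell2 X),
     zero = restrict (\<lambda>f x. 0) (ell2 X),
     add = (\<lambda>S T. restrict (\<lambda>f x. S f x + T f x) (ell2 X)),
     smult = (\<lambda>k T. restrict (\<lambda>f x. k * T f x) (ell2 X)),
     star = hilbert_adjoint X,
     cnorm = (\<lambda>T. SUP f\<in>{f \<in> ell2 X. ell2_norm X f \<le> 1}. ell2_norm X (T f))\<rparr>"

subsection \<open>The tensor product \<open>C(K) \<otimes> B\<close>\<close>

text \<open>
  For compact \<open>K\<close> the \<open>C\<^sup>*\<close>-algebra \<open>C(K) \<otimes> B\<close> is realised in the standard way as the
  algebra of norm-continuous functions from \<open>K\<close> to \<open>B\<close>; the elementary tensor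
  \<open>h \<otimes> b\<close> is the function \<open>z \<mapsto> h(z) b\<close>, and \<open>ev\<^sub>z \<otimes> \<phi>\<close> is \<open>F \<mapsto> \<phi>(F(z))\<close>.
\<close>

definition C_tensor :: "'z::topological_space set \<Rightarrow> 'b star_alg \<Rightarrow> ('z \<Rightarrow> 'b) star_alg" where
  "C_tensor K B = \<lparr>
     carrier = {F \<in> K \<rightarrow>\<^sub>E carrier B. continuous_map (top_of_set K) (norm_topology B) F},
     mult = (\<lambda>F G. \<lambda>z\<in>K. F z \<otimes>\<^bsub>B\<^esub> G z),
     one = (\<lambda>z\<in>K. \<one>\<^bsub>B\<^esub>),
     zero = (\<lambda>z\<in>K. \<zero>\<^bsub>B\<^esub>),
     add = (\<lambda>F G. \<lambda>z\<in>K. F z \<oplus>\<^bsub>B\<^esub> G z),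
     smult = (\<lambda>k F. \<lambda>z\<in>K. k \<odot>\<^bsub>B\<^esub> F z),
     star = (\<lambda>F. \<lambda>z\<in>K. star B (F z)),
     cnorm = (\<lambda>F. SUP z\<in>K. cnorm B (F z))\<rparr>"

definition elem_tensor :: "'z set \<Rightarrow> 'b star_alg \<Rightarrow> ('z \<Rightarrow> complex) \<Rightarrow> 'b \<Rightarrow> 'z \<Rightarrow> 'b" where
  "elem_tensor K B h b = (\<lambda>z\<in>K. h z \<odot>\<^bsub>B\<^esub> b)"

definition torus :: "(complex ^ 'k) set" where
  "torus = {z. \<forall>i. cmod (z $ i) = 1}"

definition torus_char :: "int ^ 'k \<Rightarrow> complex ^ 'k \<Rightarrow> complex" where
  "torus_char n z = (\<Prod>i\<in>UNIV. (z $ i) powi (n $ i))"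

section \<open>Higher-rank graphs\<close>

text \<open>A small category given by its morphisms; objects are identified with identity morphisms, so
  \<open>rng\<close> and \<open>src\<close> take values in the morphisms.  \<open>pcomp \<Lambda> \<mu> \<nu>\<close> is the path \<open>\<mu>\<nu>\<close>, meaningful when
  \<open>src \<Lambda> \<mu> = rng \<Lambda> \<nu>\<close>.\<close>

record ('p, 'k) kgraph =
  paths :: "'p set"
  rng :: "'p \<Rightarrow> 'p"
  src :: "'p \<Rightarrow> 'p"
  pcomp :: "'p \<Rightarrow> 'p \<Rightarrow> 'p"
  deg :: "'p \<Rightarrow> nat ^ 'k"

definition small_category :: "('p, 'k::finite) kgraph \<Rightarrow> bool" where
  "small_category \<Lambda> \<longleftrightarrow>
     (\<forall>\<mu>\<in>paths \<Lambda>. rng \<Lambda> \<mu> \<in> paths \<Lambda> \<and> src \<Lambda> \<mu> \<in> paths \<Lambda> \<and>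
        rng \<Lambda> (rng \<Lambda> \<mu>) = rng \<Lambda> \<mu> \<and> src \<Lambda> (rng \<Lambda> \<mu>) = rng \<Lambda> \<mu> \<and>
        rng \<Lambda> (src \<Lambda> \<mu>) = src \<Lambda> \<mu> \<and> src \<Lambda> (src \<Lambda> \<mu>) = src \<Lambda> \<mu> \<and>
        pcomp \<Lambda> (rng \<Lambda> \<mu>) \<mu> = \<mu> \<and> pcomp \<Lambda> \<mu> (src \<Lambda> \<mu>) = \<mu>) \<and>
     (\<forall>\<mu>\<in>paths \<Lambda>. \<forall>\<nu>\<in>paths \<Lambda>. src \<Lambda> \<mu> = rng \<Lambda> \<nu> \<longrightarrow>
        pcomp \<Lambda> \<mu> \<nu> \<in> paths \<Lambda> \<and> rng \<Lambda> (pcomp \<Lambda> \<mu> \<nu>) = rng \<Lambda> \<mu> \<and>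
        src \<Lambda> (pcomp \<Lambda> \<mu> \<nu>) = src \<Lambda> \<nu>) \<and>
     (\<forall>\<kappa>\<in>paths \<Lambda>. \<forall>\<mu>\<in>paths \<Lambda>. \<forall>\<nu>\<in>paths \<Lambda>. src \<Lambda> \<kappa> = rng \<Lambda> \<mu> \<and> src \<Lambda> \<mu> = rng \<Lambda> \<nu> \<longrightarrow>
        pcomp \<Lambda> (pcomp \<Lambda> \<kappa> \<mu>) \<nu> = pcomp \<Lambda> \<kappa> (pcomp \<Lambda> \<mu> \<nu>))"

definition k_graph :: "('p, 'k::finite) kgraph \<Rightarrow> bool" where
  "k_graph \<Lambda> \<longleftrightarrow>
     small_category \<Lambda> \<and> countable (paths \<Lambda>) \<and>
     (\<forall>\<mu>\<in>paths \<Lambda>. \<forall>\<nu>\<in>paths \<Lambda>. src \<Lambda> \<mu> = rng \<Lambda> \<nu> \<longrightarrow>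
        deg \<Lambda> (pcomp \<Lambda> \<mu> \<nu>) = deg \<Lambda> \<mu> + deg \<Lambda> \<nu>) \<and>
     (\<forall>\<kappa>\<in>paths \<Lambda>. \<forall>m n. deg \<Lambda> \<kappa> = m + n \<longrightarrow>
        (\<exists>!(\<mu>, \<nu>). \<mu> \<in> paths \<Lambda> \<and> \<nu> \<in> paths \<Lambda> \<and> src \<Lambda> \<mu> = rng \<Lambda> \<nu> \<and>
           \<kappa> = pcomp \<Lambda> \<mu> \<nu> \<and> deg \<Lambda> \<mu> = m \<and> deg \<Lambda> \<nu> = n))"

definition paths_deg :: "('p, 'k::finite) kgraph \<Rightarrow> nat ^ 'k \<Rightarrow> 'p set" where
  "paths_deg \<Lambda> n = {\<kappa> \<in> paths \<Lambda>. deg \<Lambda> \<kappa> = n}"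

abbreviation vertices :: "('p, 'k::finite) kgraph \<Rightarrow> 'p set" where
  "vertices \<Lambda> \<equiv> paths_deg \<Lambda> 0"

definition paths_from :: "('p, 'k::finite) kgraph \<Rightarrow> 'p \<Rightarrow> 'p set" where
  "paths_from \<Lambda> v = {\<kappa> \<in> paths \<Lambda>. rng \<Lambda> \<kappa> = v}"

definition no_sources :: "('p, 'k::finite) kgraph \<Rightarrow> bool" where
  "no_sources \<Lambda> \<longleftrightarrow> (\<forall>v\<in>vertices \<Lambda>. \<forall>n. paths_from \<Lambda> v \<inter> paths_deg \<Lambda> n \<noteq> {})"

definition row_finite :: "('p, 'k::finite) kgraph \<Rightarrow> bool" where
  "row_finite \<Lambda> \<longleftrightarrow> (\<forall>v\<in>vertices \<Lambda>. \<forall>n. finite (paths_from \<Lambda> v \<inter> paths_deg \<Lambda> n))"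

subsection \<open>Infinite paths\<close>

type_synonym ('p, 'k) ipath = "nat ^ 'k \<Rightarrow> nat ^ 'k \<Rightarrow> 'p"

definition inf_paths :: "('p, 'k::finite) kgraph \<Rightarrow> ('p, 'k) ipath set" where
  "inf_paths \<Lambda> = {x.
     (\<forall>m n. m \<le> n \<longrightarrow> x m n \<in> paths_deg \<Lambda> (n - m)) \<and>
     (\<forall>m n p. m \<le> n \<and> n \<le> p \<longrightarrow>
        src \<Lambda> (x m n) = rng \<Lambda> (x n p) \<and> pcomp \<Lambda> (x m n) (x n p) = x m p) \<and>
     (\<forall>m n. \<not> m \<le> n \<longrightarrow> x m n = undefined)}"

definition inf_paths_from :: "('p, 'k::finite) kgraph \<Rightarrow> 'p \<Rightarrow> ('p, 'k) ipath set" where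
  "inf_paths_from \<Lambda> v = {x \<in> inf_paths \<Lambda>. x 0 0 = v}"

definition cylinder :: "('p, 'k::finite) kgraph \<Rightarrow> 'p \<Rightarrow> ('p, 'k) ipath set" where
  "cylinder \<Lambda> \<mu> = {x \<in> inf_paths \<Lambda>. x 0 (deg \<Lambda> \<mu>) = \<mu>}"

definition path_topology :: "('p, 'k::finite) kgraph \<Rightarrow> ('p, 'k) ipath topology" where
  "path_topology \<Lambda> = topology_generated_by (cylinder \<Lambda> ` paths \<Lambda>)"

definition prepend :: "('p, 'k::finite) kgraph \<Rightarrow> 'p \<Rightarrow> ('p, 'k) ipath \<Rightarrow> ('p, 'k) ipath" where
  "prepend \<Lambda> \<alpha> x = (THE y. y \<in> inf_paths \<Lambda> \<and>
     (\<forall>n. deg \<Lambda> \<alpha> \<le> n \<longrightarrow> y 0 n = pcomp \<Lambda> \<alpha> (x 0 (n - deg \<Lambda> \<alpha>))))"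

definition shift :: "nat ^ 'k::finite \<Rightarrow> ('p, 'k) ipath \<Rightarrow> ('p, 'k) ipath" where
  "shift p x = (\<lambda>m n. x (m + p) (n + p))"

definition Sigma_pairs :: "('p, 'k::finite) kgraph \<Rightarrow> ('p \<times> 'p) set" where
  "Sigma_pairs \<Lambda> =
     {(\<alpha>, \<beta>). \<alpha> \<in> paths \<Lambda> \<and> \<beta> \<in> paths \<Lambda> \<and> src \<Lambda> \<alpha> = src \<Lambda> \<beta> \<and> \<alpha> \<noteq> \<beta>}"

definition F_set :: "('p, 'k::finite) kgraph \<Rightarrow> 'p \<Rightarrow> 'p \<Rightarrow> ('p, 'k) ipath set" where
  "F_set \<Lambda> \<alpha> \<beta> = {x \<in> inf_paths \<Lambda>. x 0 (deg \<Lambda> \<alpha>) = \<alpha> \<and> x 0 (deg \<Lambda> \<beta>) = \<beta> \<and>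
     shift (deg \<Lambda> \<alpha>) x = shift (deg \<Lambda> \<beta>) x}"

definition regular_paths :: "('p, 'k::finite) kgraph \<Rightarrow> ('p, 'k) ipath set" where
  "regular_paths \<Lambda> = inf_paths \<Lambda> -
     (\<Union>(\<alpha>, \<beta>)\<in>Sigma_pairs \<Lambda>. path_topology \<Lambda> frontier_of F_set \<Lambda> \<alpha> \<beta>)"

section \<open>Cuntz--Krieger families and \<open>C\<^sup>*(\<Lambda>)\<close>\<close>

text \<open>For row-finite \<open>\<Lambda>\<close> the sum below is finite (\<^const>\<open>finsum\<close> over an infinite set is zero
  by convention, so the definition is only meant for row-finite \<open>\<Lambda>\<close>).\<close>

definition CK_family :: "('p, 'k::finite) kgraph \<Rightarrow> 'a star_alg \<Rightarrow> ('p \<Rightarrow> 'a) \<Rightarrow> bool" where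
  "CK_family \<Lambda> B T \<longleftrightarrow>
     (\<forall>\<kappa>\<in>paths \<Lambda>. T \<kappa> \<in> carrier B \<and> T \<kappa> \<otimes>\<^bsub>B\<^esub> star B (T \<kappa>) \<otimes>\<^bsub>B\<^esub> T \<kappa> = T \<kappa>) \<and>
     (\<forall>\<mu>\<in>paths \<Lambda>. \<forall>\<nu>\<in>paths \<Lambda>. src \<Lambda> \<mu> = rng \<Lambda> \<nu> \<longrightarrow>
        T (pcomp \<Lambda> \<mu> \<nu>) = T \<mu> \<otimes>\<^bsub>B\<^esub> T \<nu>) \<and>
     (\<forall>n. \<forall>\<mu>\<in>paths_deg \<Lambda> n. \<forall>\<nu>\<in>paths_deg \<Lambda> n.
        star B (T \<mu>) \<otimes>\<^bsub>B\<^esub> T \<nu> =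
          (if \<mu> = \<nu> then T (src \<Lambda> \<mu>) \<otimes>\<^bsub>B\<^esub> star B (T (src \<Lambda> \<mu>)) else \<zero>\<^bsub>B\<^esub>)) \<and>
     (\<forall>n. \<forall>v\<in>vertices \<Lambda>.
        star B (T v) \<otimes>\<^bsub>B\<^esub> T v =
          (\<Oplus>\<^bsub>B\<^esub>\<kappa>\<in>paths_from \<Lambda> v \<inter> paths_deg \<Lambda> n. T \<kappa> \<otimes>\<^bsub>B\<^esub> star B (T \<kappa>)))"

text \<open>
  \<open>(A, S)\<close> is (a copy of) \<open>C\<^sup>*(\<Lambda>)\<close> with its universal family.  The universal property has to
  quantify over algebras carried by subsets of a fixed type, for which \<^typ>\<open>real\<close> is large
  enough: a family in any \<open>C\<^sup>*\<close>-algebra lies in the \<open>C\<^sup>*\<close>-subalgebra it generates, which is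
  separable because \<open>\<Lambda>\<close> is countable, so has at most continuum many elements and is isomorphic
  to a \<open>C\<^sup>*\<close>-algebra carried by a set of reals.  Uniqueness of \<open>\<pi>\<close> on \<open>A\<close> follows
  from generation.
\<close>

definition universal_CK_family :: "('p, 'k::finite) kgraph \<Rightarrow> 'a star_alg \<Rightarrow> ('p \<Rightarrow> 'a) \<Rightarrow> bool" where
  "universal_CK_family \<Lambda> A S \<longleftrightarrow>
     cstar_algebra A \<and> CK_family \<Lambda> A S \<and> cstar_generated A (S ` paths \<Lambda>) = carrier A \<and>
     (\<forall>(B :: real star_alg) T. cstar_algebra B \<and> CK_family \<Lambda> B T \<longrightarrow>
        (\<exists>\<pi>. star_hom A B \<pi> \<and> (\<forall>\<kappa>\<in>paths \<Lambda>. \<pi> (S \<kappa>) = T \<kappa>)))"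

definition range_proj :: "'a star_alg \<Rightarrow> ('p \<Rightarrow> 'a) \<Rightarrow> 'p \<Rightarrow> 'a" where
  "range_proj A S \<kappa> = S \<kappa> \<otimes>\<^bsub>A\<^esub> star A (S \<kappa>)"

definition cycline :: "('p, 'k::finite) kgraph \<Rightarrow> 'a star_alg \<Rightarrow> ('p \<Rightarrow> 'a) \<Rightarrow> ('p \<times> 'p) set" where
  "cycline \<Lambda> A S = {(\<alpha>, \<beta>). \<alpha> \<in> paths \<Lambda> \<and> \<beta> \<in> paths \<Lambda> \<and> src \<Lambda> \<alpha> = src \<Lambda> \<beta> \<and>
     (\<forall>\<gamma>\<in>paths_from \<Lambda> (src \<Lambda> \<alpha>).
        range_proj A S (pcomp \<Lambda> \<alpha> \<gamma>) = range_proj A S (pcomp \<Lambda> \<beta> \<gamma>))}"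

definition cycline_subalgebra ::
    "('p, 'k::finite) kgraph \<Rightarrow> 'a star_alg \<Rightarrow> ('p \<Rightarrow> 'a) \<Rightarrow> 'a set" where
  "cycline_subalgebra \<Lambda> A S =
     cstar_generated A {S \<alpha> \<otimes>\<^bsub>A\<^esub> star A (S \<beta>) |\<alpha> \<beta>. (\<alpha>, \<beta>) \<in> cycline \<Lambda> A S}"

subsection \<open>The twisted aperiodic representation\<close>

definition path_op :: "('p, 'k::finite) kgraph \<Rightarrow> 'p \<Rightarrow> ('p, 'k) ipath oper" where
  "path_op \<Lambda> \<alpha> = (THE T. T \<in> bounded_ops (regular_paths \<Lambda>) \<and>
     (\<forall>x\<in>regular_paths \<Lambda>. T (delta x) =
        (if x \<in> inf_paths_from \<Lambda> (src \<Lambda> \<alpha>) then delta (prepend \<Lambda> \<alpha> x) else (\<lambda>_. 0))))"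

abbreviation twisted_codomain ::
    "('p, 'k::finite) kgraph \<Rightarrow> (complex ^ 'k \<Rightarrow> ('p, 'k) ipath oper) star_alg" where
  "twisted_codomain \<Lambda> \<equiv> C_tensor torus (B_ell2 (regular_paths \<Lambda>))"

definition twisted_aperiodic_rep :: "('p, 'k::finite) kgraph \<Rightarrow> 'a star_alg \<Rightarrow> ('p \<Rightarrow> 'a) \<Rightarrow>
    ('a \<Rightarrow> complex ^ 'k \<Rightarrow> ('p, 'k) ipath oper) \<Rightarrow> bool" where
  "twisted_aperiodic_rep \<Lambda> A S \<Upsilon> \<longleftrightarrow>
     star_hom A (twisted_codomain \<Lambda>) \<Upsilon> \<and>
     (\<forall>\<alpha>\<in>paths \<Lambda>. \<Upsilon> (S \<alpha>) =
        elem_tensor torus (B_ell2 (regular_paths \<Lambda>))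
          (torus_char (\<chi> i. int (deg \<Lambda> \<alpha> $ i))) (path_op \<Lambda> \<alpha>))"

definition twisted_image :: "('p, 'k::finite) kgraph \<Rightarrow>
    ('a \<Rightarrow> complex ^ 'k \<Rightarrow> ('p, 'k) ipath oper) \<Rightarrow> 'a set \<Rightarrow>
    (complex ^ 'k \<Rightarrow> ('p, 'k) ipath oper) star_alg" where
  "twisted_image \<Lambda> \<Upsilon> B = twisted_codomain \<Lambda>\<lparr>carrier := \<Upsilon> ` B\<rparr>"

definition vector_state :: "'x set \<Rightarrow> 'x \<Rightarrow> 'x oper \<Rightarrow> complex" where
  "vector_state X x T = ell2_inner X (T (delta x)) (delta x)"

definition psi_state :: "('p, 'k::finite) kgraph \<Rightarrow> 'a star_alg \<Rightarrow>
    ('a \<Rightarrow> complex ^ 'k \<Rightarrow> ('p, 'k) ipath oper) \<Rightarrow> complex ^ 'k \<Rightarrow> ('p, 'k) ipath \<Rightarrow>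
    (complex ^ 'k \<Rightarrow> ('p, 'k) ipath oper) \<Rightarrow> complex" where
  "psi_state \<Lambda> A \<Upsilon> z x =
     restrict (\<lambda>F. vector_state (regular_paths \<Lambda>) x (F z)) (\<Upsilon> ` carrier A)"

definition e_state :: "('p, 'k::finite) kgraph \<Rightarrow> 'a star_alg \<Rightarrow> ('p \<Rightarrow> 'a) \<Rightarrow>
    ('a \<Rightarrow> complex ^ 'k \<Rightarrow> ('p, 'k) ipath oper) \<Rightarrow> complex ^ 'k \<Rightarrow> ('p, 'k) ipath \<Rightarrow>
    (complex ^ 'k \<Rightarrow> ('p, 'k) ipath oper) \<Rightarrow> complex" where
  "e_state \<Lambda> A S \<Upsilon> z x = restrict (psi_state \<Lambda> A \<Upsilon> z x) (\<Upsilon> ` cycline_subalgebra \<Lambda> A S)"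

definition X_states :: "('p, 'k::finite) kgraph \<Rightarrow> 'a star_alg \<Rightarrow> ('p \<Rightarrow> 'a) \<Rightarrow>
    ('a \<Rightarrow> complex ^ 'k \<Rightarrow> ('p, 'k) ipath oper) \<Rightarrow>
    ((complex ^ 'k \<Rightarrow> ('p, 'k) ipath oper) \<Rightarrow> complex) set" where
  "X_states \<Lambda> A S \<Upsilon> = {e_state \<Lambda> A S \<Upsilon> z x |z x. z \<in> torus \<and> x \<in> regular_paths \<Lambda>}"

definition state_extension :: "'b star_alg \<Rightarrow> 'b set \<Rightarrow> ('b \<Rightarrow> complex) \<Rightarrow> ('b \<Rightarrow> complex) \<Rightarrow> bool" where
  "state_extension B C \<rho> f \<longleftrightarrow> state B f \<and> (\<forall>c\<in>C. f c = \<rho> c)"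

end

theory Submission
  imports Defs
begin

text \<open>
  Let \<open>\<phi>\<close> be a state that extends \<open>e\<^sub>z\<^sub>,\<^sub>x\<close>, pulled back to \<open>C\<^sup>*(\<Lambda>)\<close>, and let
  \<open>p\<^sub>n = P\<^bsub>x(0,n)\<^esub>\<close>, which lies in the cycline subalgebra.  Since \<open>\<phi>(p\<^sub>n) = 1\<close>, one has
  \<open>\<phi>(a) = \<phi>(p\<^sub>m a p\<^sub>n)\<close> for all \<open>m, n\<close>.  For \<open>a = S\<^sub>\<alpha> S\<^sub>\<beta>\<^sup>*\<close> and suitable \<open>m, n\<close> the
  compression \<open>p\<^sub>m a p\<^sub>n\<close> lies in the cycline subalgebra: it vanishes if
  \<open>x \<notin> F\<^sub>\<alpha>\<^sub>,\<^sub>\<beta>\<close>, and otherwise regularity puts \<open>x\<close> in the interior of \<open>F\<^sub>\<alpha>\<^sub>,\<^sub>\<beta>\<close>, so that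
  \<open>(\<alpha>\<gamma>, \<beta>\<gamma>)\<close> is cycline for a long enough segment \<open>\<gamma>\<close> of \<open>x\<close>.  The span of the
  \<open>S\<^sub>\<alpha> S\<^sub>\<beta>\<^sup>*\<close> is dense, so \<open>\<phi>\<close> is determined; contractivity of \<open>\<Upsilon>\<close> is not needed because a
  positive functional with \<open>\<phi>(a) = \<phi>(p a)\<close> is automatically continuous.  Purity holds because
  \<open>\<delta>\<^sub>x\<close> is an eigenvector of every element of the cycline subalgebra.
\<close>

section \<open>Higher-rank graphs\<close>

text \<open>A state is controlled only through the sup norm of operator-valued functions on the
  torus, and the image of \<Upsilon> is never shown to be complete; square roots and the density of
  monomials are available in \<open>A\<close>. The two sides meet in the notion of a functional
  peaked at a projection P, meaning \<phi>(P) = 1 and \<phi>(P a) = \<phi>(a). These conditions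
  mention neither a norm nor a unit (P stands in for the unit that \<open>A\<close> may lack), so
  they survive pulling back along \<Upsilon>: they are established by a Pythagoras estimate on
  vectors and exploited in \<open>A\<close>. Working over an arbitrary star-subalgebra lets the same
  lemmas serve uniqueness, over all of \<open>A\<close>, and purity, over the cycline subalgebra.
  Cycline pairs are defined by range projections, regularity by infinite paths. The link is that
  equal cylinders have equal projections; row-finiteness enters through CK2, and the absence of
  sources keeps cylinders nonempty. In the other direction, equal projections are compared through
  their action on basis vectors.\<close>

lemma vec_le_add: "m \<le> m + n" "n \<le> m + n" "0 \<le> m" for m n :: "nat ^ 'k::finite"
  by (auto simp: less_eq_vec_def)

lemma vec_add_diff:
  fixes m n p :: "nat ^ 'k::finite"
  shows "m \<le> n \<Longrightarrow> m + (n - m) = n"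
    and "m \<le> n \<Longrightarrow> (n - m) + m = n"
    and "m \<le> n \<Longrightarrow> p + m \<le> p + n"
    and "m \<le> n \<Longrightarrow> m + p \<le> n + p"
    and "(n + p) - (m + p) = n - m"
    and "n - 0 = n"
    and "m \<le> n \<Longrightarrow> m \<le> p + n"
    and "m \<le> n \<Longrightarrow> n - m \<le> n"
    and "m \<le> n \<Longrightarrow> m \<le> n + p"
  by (auto simp: less_eq_vec_def vec_eq_iff intro: trans_le_add1 trans_le_add2)

lemma vec_le_add_cancel: "m + p \<le> n + p \<longleftrightarrow> m \<le> n" for m n p :: "nat ^ 'k::finite"
  by (simp add: less_eq_vec_def)

text \<open>The diagonal vectors are cofinal in \<open>nat ^ 'k\<close>, here with an explicit
  index, so infinite paths can be built along sequences indexed by \<open>nat\<close>.\<close>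

lemma vec_le_sum: "n \<le> (\<chi> i. \<Sum>j\<in>UNIV. n $ j)" for n :: "nat ^ 'k::finite"
  by (auto simp: less_eq_vec_def intro!: member_le_sum)

section \<open>Category laws and unique factorisation\<close>

locale higher_rank_graph =
  fixes G :: "('p, 'k::finite) kgraph"
  assumes k_graph: "k_graph G"
begin

lemma small_category: "small_category G"
  using k_graph by (simp add: k_graph_def)

lemma
  assumes "\<mu> \<in> paths G"
  shows rng_in: "rng G \<mu> \<in> paths G" and src_in: "src G \<mu> \<in> paths G"
    and src_rng: "src G (rng G \<mu>) = rng G \<mu>"
    and rng_src: "rng G (src G \<mu>) = src G \<mu>" and src_src: "src G (src G \<mu>) = src G \<mu>"
    and comp_rng: "pcomp G (rng G \<mu>) \<mu> = \<mu>" and comp_src: "pcomp G \<mu> (src G \<mu>) = \<mu>"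
  using small_category[unfolded small_category_def, THEN conjunct1, THEN bspec, OF assms] by simp_all

lemma
  assumes "\<mu> \<in> paths G" "\<nu> \<in> paths G" "src G \<mu> = rng G \<nu>"
  shows comp_in: "pcomp G \<mu> \<nu> \<in> paths G" and rng_comp: "rng G (pcomp G \<mu> \<nu>) = rng G \<mu>"
    and src_comp: "src G (pcomp G \<mu> \<nu>) = src G \<nu>"
    and deg_comp: "deg G (pcomp G \<mu> \<nu>) = deg G \<mu> + deg G \<nu>"
  using small_category[unfolded small_category_def, THEN conjunct2, THEN conjunct1, rule_format, OF assms]
    k_graph[unfolded k_graph_def, THEN conjunct2, THEN conjunct2, THEN conjunct1, rule_format, OF assms]
  by simp_all

lemma comp_assoc:
  assumes "\<kappa> \<in> paths G" "\<mu> \<in> paths G" "\<nu> \<in> paths G" "src G \<kappa> = rng G \<mu>" "src G \<mu> = rng G \<nu>"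
  shows "pcomp G (pcomp G \<kappa> \<mu>) \<nu> = pcomp G \<kappa> (pcomp G \<mu> \<nu>)"
  using small_category[unfolded small_category_def, THEN conjunct2, THEN conjunct2, rule_format] assms
  by simp

lemma factor_ex1:
  assumes "\<kappa> \<in> paths G" "deg G \<kappa> = m + n"
  shows "\<exists>!(\<mu>, \<nu>). \<mu> \<in> paths G \<and> \<nu> \<in> paths G \<and> src G \<mu> = rng G \<nu> \<and>
           \<kappa> = pcomp G \<mu> \<nu> \<and> deg G \<mu> = m \<and> deg G \<nu> = n"
  using k_graph[unfolded k_graph_def, THEN conjunct2, THEN conjunct2, THEN conjunct2] assms by simp

lemma factor:
  assumes "\<kappa> \<in> paths G" "deg G \<kappa> = m + n"
  obtains \<mu> \<nu> where "\<mu> \<in> paths G" "\<nu> \<in> paths G" "src G \<mu> = rng G \<nu>" "\<kappa> = pcomp G \<mu> \<nu>"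
    "deg G \<mu> = m" "deg G \<nu> = n"
  using ex1_implies_ex[OF factor_ex1[OF assms]] by auto

text \<open>The degrees of the second factors agree by cancellation in \<open>nat ^ 'k\<close>, so
  both pairs solve the same factorisation problem.\<close>

lemma comp_cancel:
  assumes "\<mu> \<in> paths G" "\<nu> \<in> paths G" "src G \<mu> = rng G \<nu>"
    and "\<mu>' \<in> paths G" "\<nu>' \<in> paths G" "src G \<mu>' = rng G \<nu>'"
    and eq: "pcomp G \<mu> \<nu> = pcomp G \<mu>' \<nu>'" and d: "deg G \<mu> = deg G \<mu>'"
  shows "\<mu> = \<mu>'" "\<nu> = \<nu>'"
proof -
  have d': "deg G \<nu> = deg G \<nu>'"
    using deg_comp[OF assms(1-3)] deg_comp[OF assms(4-6)] eq d by simp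
  note ex1 = factor_ex1[OF comp_in[OF assms(1-3)] deg_comp[OF assms(1-3)]]
  have "(\<mu>, \<nu>) = (\<mu>', \<nu>')"
    by (rule trans[OF the1_equality[OF ex1, symmetric] the1_equality[OF ex1]])
      (use assms d' in simp_all)
  then show "\<mu> = \<mu>'" "\<nu> = \<nu>'" by auto
qed

lemma deg_rng: "\<mu> \<in> paths G \<Longrightarrow> deg G (rng G \<mu>) = 0"
  using deg_comp[of "rng G \<mu>" \<mu>] by (simp add: rng_in src_rng comp_rng)

lemma deg_src: "\<mu> \<in> paths G \<Longrightarrow> deg G (src G \<mu>) = 0"
  using deg_rng[of "src G \<mu>"] by (simp add: src_in rng_src)

text \<open>Such a path is both \<open>rng G \<kappa>\<close> followed by \<kappa> and \<kappa>
  followed by \<open>src G \<kappa>\<close>; the first factors both have degree zero, so unique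
  factorisation identifies them.\<close>

lemma deg_0_rng: "\<kappa> \<in> paths G \<Longrightarrow> deg G \<kappa> = 0 \<Longrightarrow> rng G \<kappa> = \<kappa>"
  using comp_cancel(1)[of "rng G \<kappa>" \<kappa> \<kappa> "src G \<kappa>"]
  by (simp add: rng_in src_in src_rng rng_src comp_rng comp_src deg_rng)

lemma deg_0_src: "\<kappa> \<in> paths G \<Longrightarrow> deg G \<kappa> = 0 \<Longrightarrow> src G \<kappa> = \<kappa>"
  by (metis deg_0_rng src_rng)

lemma src_vertex: "\<mu> \<in> paths G \<Longrightarrow> src G \<mu> \<in> vertices G"
  by (simp add: paths_deg_def src_in deg_src)

section \<open>Initial segments of finite paths\<close>

definition initial_path :: "nat ^ 'k \<Rightarrow> 'p \<Rightarrow> 'p" where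
  "initial_path n \<kappa> = (THE \<mu>. \<exists>\<nu>. \<mu> \<in> paths G \<and> \<nu> \<in> paths G \<and> src G \<mu> = rng G \<nu> \<and>
     \<kappa> = pcomp G \<mu> \<nu> \<and> deg G \<mu> = n)"

lemma initial_path_comp:
  assumes "\<mu> \<in> paths G" "\<nu> \<in> paths G" "src G \<mu> = rng G \<nu>"
  shows "initial_path (deg G \<mu>) (pcomp G \<mu> \<nu>) = \<mu>"
  unfolding initial_path_def
proof (rule the_equality)
  show "\<mu>' = \<mu>" if "\<exists>\<nu>'. \<mu>' \<in> paths G \<and> \<nu>' \<in> paths G \<and> src G \<mu>' = rng G \<nu>' \<and>
     pcomp G \<mu> \<nu> = pcomp G \<mu>' \<nu>' \<and> deg G \<mu>' = deg G \<mu>" for \<mu>'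
    using that comp_cancel(1)[OF assms] by metis
qed (use assms in blast)

lemma initial_path_factor:
  assumes "\<kappa> \<in> paths G" "n \<le> deg G \<kappa>"
  obtains \<nu> where "initial_path n \<kappa> \<in> paths G" "\<nu> \<in> paths G" "src G (initial_path n \<kappa>) = rng G \<nu>"
    "\<kappa> = pcomp G (initial_path n \<kappa>) \<nu>" "deg G (initial_path n \<kappa>) = n" "deg G \<nu> = deg G \<kappa> - n"
proof -
  have "deg G \<kappa> = n + (deg G \<kappa> - n)" using assms by (simp add: vec_add_diff)
  from factor[OF assms(1) this] obtain \<mu> \<nu> where
    "\<mu> \<in> paths G" "\<nu> \<in> paths G" "src G \<mu> = rng G \<nu>" "\<kappa> = pcomp G \<mu> \<nu>"
    "deg G \<mu> = n" "deg G \<nu> = deg G \<kappa> - n" .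
  with initial_path_comp[of \<mu> \<nu>] that show thesis by auto
qed

lemma initial_path_comp_le:
  assumes "\<mu> \<in> paths G" "\<nu> \<in> paths G" "src G \<mu> = rng G \<nu>" "n \<le> deg G \<mu>"
  shows "initial_path n (pcomp G \<mu> \<nu>) = initial_path n \<mu>"
proof -
  obtain \<eta> where \<eta>: "initial_path n \<mu> \<in> paths G" "\<eta> \<in> paths G" "src G (initial_path n \<mu>) = rng G \<eta>"
    "\<mu> = pcomp G (initial_path n \<mu>) \<eta>" "deg G (initial_path n \<mu>) = n"
    using initial_path_factor[OF assms(1,4)] by metis
  have s: "src G \<eta> = rng G \<nu>" using src_comp[OF \<eta>(1-3)] \<eta>(4) assms(3) by simp
  have "pcomp G \<mu> \<nu> = pcomp G (initial_path n \<mu>) (pcomp G \<eta> \<nu>)"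
    using comp_assoc[OF \<eta>(1,2) assms(2) \<eta>(3) s] \<eta>(4) by simp
  then show ?thesis
    using initial_path_comp[of "initial_path n \<mu>" "pcomp G \<eta> \<nu>"] \<eta> s assms(2)
    by (simp add: comp_in rng_comp)
qed

lemma initial_path_all: "\<mu> \<in> paths G \<Longrightarrow> initial_path (deg G \<mu>) \<mu> = \<mu>"
  using initial_path_comp[of \<mu> "src G \<mu>"] by (simp add: src_in rng_src comp_src)

subsection \<open>Infinite paths\<close>

lemma ipathD:
  assumes "x \<in> inf_paths G" "m \<le> n"
  shows "x m n \<in> paths G" "deg G (x m n) = n - m"
  using assms by (auto simp: inf_paths_def paths_deg_def)

lemma ipath_comp:
  assumes "x \<in> inf_paths G" "m \<le> n" "n \<le> p"
  shows "src G (x m n) = rng G (x n p)" "pcomp G (x m n) (x n p) = x m p"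
  using assms by (auto simp: inf_paths_def)

lemma ipath_undefined: "x \<in> inf_paths G \<Longrightarrow> \<not> m \<le> n \<Longrightarrow> x m n = undefined"
  by (auto simp: inf_paths_def)

lemma deg_ipath_0: "x \<in> inf_paths G \<Longrightarrow> deg G (x 0 n) = n"
  by (simp add: ipathD vec_le_add vec_add_diff)

lemma ipath_0_in: "x \<in> inf_paths G \<Longrightarrow> x 0 n \<in> paths G"
  by (simp add: ipathD vec_le_add)

lemma src_ipath: "x \<in> inf_paths G \<Longrightarrow> m \<le> n \<Longrightarrow> src G (x m n) = x n n"
  using ipath_comp(1)[of x m n n] ipathD[of x n n] deg_0_rng[of "x n n"]
  by (simp add: vec_eq_iff)

lemma rng_ipath: "x \<in> inf_paths G \<Longrightarrow> m \<le> n \<Longrightarrow> rng G (x m n) = x m m"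
  using ipath_comp(1)[of x m m n] src_ipath[of x m m] by simp

lemma ipath_initial:
  assumes "x \<in> inf_paths G" "m \<le> n"
  shows "initial_path m (x 0 n) = x 0 m"
  using assms initial_path_comp[of "x 0 m" "x m n"] ipath_comp[of x 0 m n]
  by (simp add: ipathD vec_le_add vec_add_diff)

lemma ipath_eq_initial:
  assumes "x \<in> inf_paths G" "y \<in> inf_paths G" "x 0 n = y 0 n" "m \<le> n"
  shows "x 0 m = y 0 m"
  using assms by (metis ipath_initial)

lemma ipath_eq_segment:
  assumes "x \<in> inf_paths G" "y \<in> inf_paths G" "x 0 n = y 0 n" "m \<le> p" "p \<le> n"
  shows "x m p = y m p"
proof -
  have "x 0 p = y 0 p" "x 0 m = y 0 m"
    using assms ipath_eq_initial order_trans by blast+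
  then show ?thesis
    using assms(1,2,4) comp_cancel(2)[of "x 0 m" "x m p" "y 0 m" "y m p"]
      ipath_comp[of x 0 m p] ipath_comp[of y 0 m p]
    by (simp add: ipathD vec_le_add)
qed

text \<open>Prefixes determine all segments below them, and off the order both families are
  \<open>undefined\<close>; hence a cofinal set of degrees suffices.\<close>

lemma ipath_eqI:
  assumes "x \<in> inf_paths G" "y \<in> inf_paths G" "\<And>n. \<exists>N\<ge>n. x 0 N = y 0 N"
  shows "x = y"
proof (intro ext)
  fix m n
  show "x m n = y m n"
    using assms ipath_eq_segment[OF assms(1,2)] ipath_undefined by (cases "m \<le> n") metis+
qed

text \<open>The segment from m to n is what remains of \<open>p n\<close> after splitting off
  \<open>p m\<close>; left cancellation turns compatibility of the prefixes into the composition
  law.\<close>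

lemma inf_paths_from_prefixes:
  assumes p: "\<And>n. p n \<in> paths G" "\<And>n. deg G (p n) = n"
    and init: "\<And>m n. m \<le> n \<Longrightarrow> initial_path m (p n) = p m"
  obtains x where "x \<in> inf_paths G" "\<And>n. x 0 n = p n"
proof -
  have "\<exists>\<nu>. \<nu> \<in> paths G \<and> src G (p m) = rng G \<nu> \<and> p n = pcomp G (p m) \<nu> \<and> deg G \<nu> = n - m"
    if "m \<le> n" for m n
    using initial_path_factor[of "p n" m] that p init[OF that] by metis
  then obtain s where s: "\<And>m n. m \<le> n \<Longrightarrow> s m n \<in> paths G \<and> src G (p m) = rng G (s m n) \<and>
      p n = pcomp G (p m) (s m n) \<and> deg G (s m n) = n - m"
    by metis
  define x where "x m n = (if m \<le> n then s m n else undefined)" for m n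
  have "src G (x m n) = rng G (x n q) \<and> pcomp G (x m n) (x n q) = x m q" if "m \<le> n" "n \<le> q" for m n q
  proof -
    have mq: "m \<le> q" using that by (rule order_trans)
    have src: "src G (s m n) = rng G (s n q)"
      using s[OF that(1)] s[OF that(2)] src_comp[of "p m" "s m n"] p by metis
    have "pcomp G (p m) (pcomp G (s m n) (s n q)) = pcomp G (p m) (s m q)"
      using s[OF that(1)] s[OF that(2)] s[OF mq] src comp_assoc[of "p m" "s m n" "s n q"] p by metis
    then have "pcomp G (s m n) (s n q) = s m q"
      using comp_cancel(2)[of "p m" "pcomp G (s m n) (s n q)" "p m" "s m q"]
        s[OF that(1)] s[OF that(2)] s[OF mq] src p by (simp add: comp_in rng_comp)
    then show ?thesis using that mq src by (simp add: x_def)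
  qed
  then have "x \<in> inf_paths G" using s by (auto simp: inf_paths_def x_def paths_deg_def)
  moreover have "x 0 n = p n" for n
  proof -
    \<comment> \<open>\<open>p 0\<close> has degree zero, so it is an identity and disappears from
      the composition.\<close>
    have "p 0 = rng G (s 0 n)"
      using s[OF vec_le_add(3)[of n]] p deg_0_src[of "p 0"] by simp
    then show ?thesis using s[OF vec_le_add(3)[of n]] comp_rng[of "s 0 n"]
      by (simp add: x_def vec_le_add)
  qed
  ultimately show thesis using that by blast
qed

text \<open>The limit of a growing chain of finite paths: its prefix of degree n is read off from
  any member that is long enough, and later extensions do not change it.\<close>

lemma inf_path_of_seq:
  assumes l: "\<And>j. l j \<in> paths G" and h: "\<And>j. h j \<in> paths G" and src: "\<And>j. src G (l j) = rng G (h j)"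
    and step: "\<And>j. l (Suc j) = pcomp G (l j) (h j)" and large: "\<And>j. (\<chi> i. j) \<le> deg G (l j)"
  obtains x where "x \<in> inf_paths G" "\<And>j. x 0 (deg G (l j)) = l j"
proof -
  have mono: "deg G (l i) \<le> deg G (l (i + d))" for i d
  proof (induction d)
    case (Suc d)
    then show ?case using deg_comp[OF l h src, of "i + d"] step[of "i + d"]
      by (simp add: vec_add_diff)
  qed simp
  have stable: "initial_path n (l (i + d)) = initial_path n (l i)" if "n \<le> deg G (l i)" for n i d
  proof (induction d)
    case (Suc d)
    have "n \<le> deg G (l (i + d))" using that mono order_trans by blast
    then show ?case using Suc initial_path_comp_le[OF l h src, of n "i + d"] step[of "i + d"] by simp
  qed simp
  \<comment> \<open>One of the truncated differences \<open>j - i\<close> and \<open>i - j\<close>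
    is zero, so the two instances of \<open>stable\<close> cover both orders.\<close>
  have stable': "initial_path n (l i) = initial_path n (l j)"
    if "n \<le> deg G (l i)" "n \<le> deg G (l j)" for n i j
    using stable[OF that(1), of "j - i"] stable[OF that(2), of "i - j"] by (cases "i \<le> j") auto
  \<comment> \<open>The coordinate sum: the diagonal vector with this entry dominates n.\<close>
  define N where "N n = (\<Sum>j\<in>UNIV. n $ j)" for n :: "nat ^ 'k"
  have N: "n \<le> deg G (l (N n))" for n
    using vec_le_sum[of n] large[of "N n"] unfolding N_def by (rule order_trans)
  define p where "p n = initial_path n (l (N n))" for n
  have p: "p n \<in> paths G" "deg G (p n) = n" for n
    using initial_path_factor[OF l N, of n] unfolding p_def by metis+
  have init: "initial_path m (p n) = p m" if "m \<le> n" for m n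
  proof -
    obtain \<nu> where \<nu>: "\<nu> \<in> paths G" "src G (p n) = rng G \<nu>" "l (N n) = pcomp G (p n) \<nu>"
      using initial_path_factor[OF l N, of n] unfolding p_def by metis
    have "initial_path m (p n) = initial_path m (l (N n))"
      using initial_path_comp_le[of "p n" \<nu> m] \<nu> p that by simp
    also have "\<dots> = p m"
      unfolding p_def using N[of n] N[of m] that by (intro stable') auto
    finally show ?thesis .
  qed
  obtain x where x: "x \<in> inf_paths G" "\<And>n. x 0 n = p n"
    using inf_paths_from_prefixes[OF p init] by blast
  have "x 0 (deg G (l j)) = l j" for j
  proof -
    have "p (deg G (l j)) = initial_path (deg G (l j)) (l j)"
      unfolding p_def by (rule stable') (use N in auto)
    then show ?thesis using initial_path_all[OF l] x by simp
  qed
  then show thesis using that x by blast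
qed

section \<open>Shifts, cylinders and prepending\<close>

lemma shift_in: "x \<in> inf_paths G \<Longrightarrow> shift p x \<in> inf_paths G"
  unfolding inf_paths_def shift_def mem_Collect_eq
proof (intro conjI allI impI, goal_cases)
  case (1 m n)
  then show ?case
    using 1(1)[THEN conjunct1, rule_format, of "m + p" "n + p"] by (simp add: vec_le_add_cancel)
qed (simp_all add: vec_le_add_cancel)

lemma shift_shift: "shift p (shift q x) = shift (p + q) x"
  by (simp add: shift_def add.assoc)

lemma shift_eqI:
  assumes x: "x \<in> inf_paths G" "y \<in> inf_paths G" and eq: "\<And>n. \<exists>N\<ge>n. x p (p + N) = y q (q + N)"
  shows "shift p x = shift q y"
proof (rule ipath_eqI)
  show "\<exists>N\<ge>n. shift p x 0 N = shift q y 0 N" for n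
    using eq[of n] by (simp add: shift_def add.commute)
qed (use x shift_in in auto)

lemma cylinder_iff:
  assumes "\<mu> \<in> paths G" "\<nu> \<in> paths G" "src G \<mu> = rng G \<nu>"
  shows "x \<in> cylinder G (pcomp G \<mu> \<nu>) \<longleftrightarrow>
    x \<in> cylinder G \<mu> \<and> x (deg G \<mu>) (deg G \<mu> + deg G \<nu>) = \<nu>"
proof (cases "x \<in> inf_paths G")
  case x: True
  have le: "deg G \<mu> \<le> deg G \<mu> + deg G \<nu>" by (simp add: vec_le_add)
  have c: "pcomp G (x 0 (deg G \<mu>)) (x (deg G \<mu>) (deg G \<mu> + deg G \<nu>)) = x 0 (deg G \<mu> + deg G \<nu>)"
    "src G (x 0 (deg G \<mu>)) = rng G (x (deg G \<mu>) (deg G \<mu> + deg G \<nu>))"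
    using ipath_comp[OF x vec_le_add(3) le] by auto
  show ?thesis
    using x c comp_cancel[OF _ _ c(2) assms] ipathD[OF x le] ipath_0_in[OF x] deg_ipath_0[OF x]
    by (auto simp: cylinder_def deg_comp[OF assms])
qed (simp add: cylinder_def)

lemma cylinder_prefix:
  assumes "x \<in> inf_paths G" "n \<le> m"
  shows "cylinder G (x 0 m) \<subseteq> cylinder G (x 0 n)"
  using assms ipath_eq_initial by (auto simp: cylinder_def deg_ipath_0)

lemma in_own_cylinder: "x \<in> inf_paths G \<Longrightarrow> x \<in> cylinder G (x 0 n)"
  by (simp add: cylinder_def deg_ipath_0)

text \<open>The path \<alpha> followed by the diagonal prefixes of x is a growing chain, whose limit
  is the path sought.\<close>

lemma prepend_ex:
  assumes \<alpha>: "\<alpha> \<in> paths G" and x: "x \<in> inf_paths G" "x 0 0 = src G \<alpha>"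
  shows "\<exists>y. y \<in> inf_paths G \<and> (\<forall>n. deg G \<alpha> \<le> n \<longrightarrow> y 0 n = pcomp G \<alpha> (x 0 (n - deg G \<alpha>)))"
proof -
  define v :: "nat \<Rightarrow> nat ^ 'k" where "v j = (\<chi> i. j)" for j
  have v: "v j \<le> v (Suc j)" for j by (auto simp: v_def less_eq_vec_def)
  have s: "src G \<alpha> = rng G (x 0 n)" for n using x rng_ipath[of x 0 n] by (simp add: vec_le_add)
  define l where "l j = pcomp G \<alpha> (x 0 (v j))" for j
  note xin = ipath_0_in[OF x(1)]
  have l: "l j \<in> paths G" "deg G (l j) = deg G \<alpha> + v j" for j
    unfolding l_def using comp_in[OF \<alpha> xin s] deg_comp[OF \<alpha> xin s] deg_ipath_0[OF x(1)] by auto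
  have src: "src G (l j) = rng G (x (v j) (v (Suc j)))" for j
    unfolding l_def using src_comp[OF \<alpha> xin s] ipath_comp(1)[OF x(1) vec_le_add(3) v] by simp
  have step: "l (Suc j) = pcomp G (l j) (x (v j) (v (Suc j)))" for j
    unfolding l_def using comp_assoc[OF \<alpha> xin ipathD(1)[OF x(1) v] s] ipath_comp[OF x(1) vec_le_add(3) v] by simp
  have "(\<chi> i. j) \<le> deg G (l j)" for j by (simp add: l v_def vec_le_add)
  then obtain y where y: "y \<in> inf_paths G" "\<And>j. y 0 (deg G (l j)) = l j"
    using inf_path_of_seq[of l "\<lambda>j. x (v j) (v (Suc j))"] l(1) ipathD(1)[OF x(1) v] src step by metis
  \<comment> \<open>The chain prescribes y only at the degrees \<open>deg G \<alpha> + v j\<close>;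
    any other degree lies below one of these and is reached by taking initial segments.\<close>
  have "y 0 n = pcomp G \<alpha> (x 0 (n - deg G \<alpha>))" if n: "deg G \<alpha> \<le> n" for n
  proof -
    define j where "j = (\<Sum>i\<in>UNIV. n $ i)"
    have j: "n \<le> v j" unfolding j_def v_def by (rule vec_le_sum)
    then have le: "n \<le> deg G \<alpha> + v j" by (simp add: vec_add_diff)
    have le': "n - deg G \<alpha> \<le> v j" using vec_add_diff(8)[OF n] j by (rule order_trans)
    let ?m = "n - deg G \<alpha>"
    have s2: "src G (pcomp G \<alpha> (x 0 ?m)) = rng G (x ?m (v j))"
      using src_comp[OF \<alpha> xin s] ipath_comp(1)[OF x(1) vec_le_add(3) le'] by simp
    have eq: "l j = pcomp G (pcomp G \<alpha> (x 0 ?m)) (x ?m (v j))"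
      unfolding l_def using comp_assoc[OF \<alpha> xin ipathD(1)[OF x(1) le'] s] ipath_comp[OF x(1) vec_le_add(3) le'] by simp
    have d: "deg G (pcomp G \<alpha> (x 0 ?m)) = n"
      using deg_comp[OF \<alpha> xin s] deg_ipath_0[OF x(1)] n by (simp add: vec_add_diff)
    have "y 0 n = initial_path n (l j)" using ipath_initial[OF y(1) le] y(2)[of j] l(2) by simp
    also have "\<dots> = pcomp G \<alpha> (x 0 ?m)"
      using initial_path_comp[OF comp_in[OF \<alpha> xin s] ipathD(1)[OF x(1) le'] s2] eq d by simp
    finally show ?thesis .
  qed
  with y(1) show ?thesis by blast
qed

lemma
  assumes \<alpha>: "\<alpha> \<in> paths G" and x: "x \<in> inf_paths_from G (src G \<alpha>)"
  shows prepend_in: "prepend G \<alpha> x \<in> inf_paths G"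
    and prepend_at: "deg G \<alpha> \<le> n \<Longrightarrow> prepend G \<alpha> x 0 n = pcomp G \<alpha> (x 0 (n - deg G \<alpha>))"
proof -
  have x': "x \<in> inf_paths G" "x 0 0 = src G \<alpha>" using x by (auto simp: inf_paths_from_def)
  have "\<exists>!y. y \<in> inf_paths G \<and> (\<forall>n. deg G \<alpha> \<le> n \<longrightarrow> y 0 n = pcomp G \<alpha> (x 0 (n - deg G \<alpha>)))"
  proof (rule ex_ex1I[OF prepend_ex[OF \<alpha> x']])
    fix y z
    assume y: "y \<in> inf_paths G \<and> (\<forall>n. deg G \<alpha> \<le> n \<longrightarrow> y 0 n = pcomp G \<alpha> (x 0 (n - deg G \<alpha>)))"
      and z: "z \<in> inf_paths G \<and> (\<forall>n. deg G \<alpha> \<le> n \<longrightarrow> z 0 n = pcomp G \<alpha> (x 0 (n - deg G \<alpha>)))"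
    show "y = z"
    proof (rule ipath_eqI)
      show "\<exists>N\<ge>n. y 0 N = z 0 N" for n
        using y z vec_le_add(1)[of "deg G \<alpha>" n] vec_le_add(2)[of n "deg G \<alpha>"] by metis
    qed (use y z in auto)
  qed
  from theI'[OF this]
  show "prepend G \<alpha> x \<in> inf_paths G"
    and "deg G \<alpha> \<le> n \<Longrightarrow> prepend G \<alpha> x 0 n = pcomp G \<alpha> (x 0 (n - deg G \<alpha>))"
    unfolding prepend_def by auto
qed

lemma
  assumes \<alpha>: "\<alpha> \<in> paths G" and x: "x \<in> inf_paths_from G (src G \<alpha>)"
  shows prepend_cylinder: "prepend G \<alpha> x \<in> cylinder G \<alpha>"
    and shift_prepend: "shift (deg G \<alpha>) (prepend G \<alpha> x) = x"
proof -
  have x': "x \<in> inf_paths G" "x 0 0 = src G \<alpha>" using x by (auto simp: inf_paths_from_def)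
  have s: "src G \<alpha> = rng G (x 0 n)" for n using x' rng_ipath[of x 0 n] by (simp add: vec_le_add)
  let ?y = "prepend G \<alpha> x"
  have y: "?y 0 (deg G \<alpha> + n) = pcomp G \<alpha> (x 0 n)" for n
    using prepend_at[OF assms, of "deg G \<alpha> + n"] by (simp add: vec_le_add)
  have "?y \<in> cylinder G (pcomp G \<alpha> (x 0 n))" for n
    using y[of n] prepend_in[OF assms] deg_comp[OF \<alpha> ipath_0_in[OF x'(1)] s]
    by (simp add: cylinder_def deg_ipath_0 x'(1))
  then have c: "?y \<in> cylinder G \<alpha>" "?y (deg G \<alpha>) (deg G \<alpha> + n) = x 0 n" for n
    using cylinder_iff[OF \<alpha> ipath_0_in[OF x'(1)] s, of ?y] by (auto simp: deg_ipath_0 x'(1))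
  show "?y \<in> cylinder G \<alpha>" by (rule c)
  have "shift (deg G \<alpha>) ?y = shift 0 x"
  proof (rule shift_eqI)
    show "\<exists>N\<ge>n. ?y (deg G \<alpha>) (deg G \<alpha> + N) = x 0 (0 + N)" for n
      using c(2)[of n] by auto
  qed (use prepend_in[OF assms] x' in auto)
  then show "shift (deg G \<alpha>) ?y = x" by (simp add: shift_def)
qed

text \<open>Prefix \<alpha> and tail together give all prefixes of degree at least
  \<open>deg G \<alpha>\<close>. This injectivity of the shift on a cylinder later makes the path
  operators bounded.\<close>

lemma cylinder_shift_eqI:
  assumes \<alpha>: "\<alpha> \<in> paths G" and "x \<in> cylinder G \<alpha>" "y \<in> cylinder G \<alpha>"
    and eq: "shift (deg G \<alpha>) x = shift (deg G \<alpha>) y"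
  shows "x = y"
proof (rule ipath_eqI)
  show x: "x \<in> inf_paths G" "y \<in> inf_paths G" using assms by (auto simp: cylinder_def)
  fix n
  have "x (deg G \<alpha>) (deg G \<alpha> + n) = y (deg G \<alpha>) (deg G \<alpha> + n)"
    using fun_cong[OF fun_cong[OF eq], of 0 n] by (simp add: shift_def add.commute)
  moreover have "x 0 (deg G \<alpha>) = y 0 (deg G \<alpha>)" using assms by (simp add: cylinder_def)
  ultimately have "x 0 (deg G \<alpha> + n) = y 0 (deg G \<alpha> + n)"
    using ipath_comp(2)[OF x(1) vec_le_add(3,1)] ipath_comp(2)[OF x(2) vec_le_add(3,1)] by metis
  then show "\<exists>N\<ge>n. x 0 N = y 0 N" using vec_le_add(2) by blast
qed

lemma shift_cylinder_from:
  "\<lbrakk>\<alpha> \<in> paths G; y \<in> cylinder G \<alpha>\<rbrakk> \<Longrightarrow> shift (deg G \<alpha>) y \<in> inf_paths_from G (src G \<alpha>)"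
  using src_ipath[of y 0 "deg G \<alpha>"] shift_in[of y "deg G \<alpha>"]
  by (auto simp: cylinder_def inf_paths_from_def shift_def vec_le_add)

lemma prepend_shift:
  assumes "\<alpha> \<in> paths G" "y \<in> cylinder G \<alpha>"
  shows "prepend G \<alpha> (shift (deg G \<alpha>) y) = y"
proof -
  note start = shift_cylinder_from[OF assms]
  show ?thesis
    using cylinder_shift_eqI[OF assms(1) prepend_cylinder[OF assms(1) start] assms(2)]
      shift_prepend[OF assms(1) start] by simp
qed

text \<open>Paths of degree (1,...,1) can be appended forever, and then every coordinate of the
  degree grows without bound.\<close>

lemma cylinder_nonempty:
  assumes ns: "no_sources G" and \<mu>: "\<mu> \<in> paths G"
  shows "cylinder G \<mu> \<noteq> {}"
proof -
  have "\<exists>h. \<forall>\<kappa>\<in>paths G. h \<kappa> \<in> paths G \<and> rng G (h \<kappa>) = src G \<kappa> \<and> deg G (h \<kappa>) = 1"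
  proof (rule bchoice, rule ballI)
    fix \<kappa> assume "\<kappa> \<in> paths G"
    then have "src G \<kappa> \<in> vertices G" by (rule src_vertex)
    with ns have "paths_from G (src G \<kappa>) \<inter> paths_deg G 1 \<noteq> {}" unfolding no_sources_def by blast
    then show "\<exists>\<eta>. \<eta> \<in> paths G \<and> rng G \<eta> = src G \<kappa> \<and> deg G \<eta> = 1"
      unfolding paths_from_def paths_deg_def by auto
  qed
  then obtain h where h: "\<And>\<kappa>. \<kappa> \<in> paths G \<Longrightarrow> h \<kappa> \<in> paths G \<and> rng G (h \<kappa>) = src G \<kappa> \<and> deg G (h \<kappa>) = 1"
    by blast
  define l where "l = rec_nat \<mu> (\<lambda>_ \<kappa>. pcomp G \<kappa> (h \<kappa>))"
  have l0: "l 0 = \<mu>" and lS: "l (Suc j) = pcomp G (l j) (h (l j))" for j by (simp_all add: l_def)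
  have l: "l j \<in> paths G" for j by (induction j) (use \<mu> h comp_in in \<open>auto simp: l0 lS\<close>)
  have large: "(\<chi> i. j) \<le> deg G (l j)" for j
  proof (induction j)
    case (Suc j)
    have "deg G (l (Suc j)) = deg G (l j) + 1" using deg_comp[of "l j" "h (l j)"] h[OF l] l lS by simp
    with Suc show ?case by (auto simp: less_eq_vec_def)
  qed (auto simp: less_eq_vec_def)
  obtain x where "x \<in> inf_paths G" "\<And>j. x 0 (deg G (l j)) = l j"
    using inf_path_of_seq[of l "\<lambda>j. h (l j)"] l h lS large by metis
  then have "x \<in> cylinder G \<mu>" using l0 by (metis (mono_tags, lifting) cylinder_def mem_Collect_eq)
  then show ?thesis by blast
qed

subsection \<open>Regular paths\<close>

lemma topspace_path_topology: "topspace (path_topology G) = inf_paths G"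
proof -
  have "x \<in> (\<Union>\<mu>\<in>paths G. cylinder G \<mu>)" if "x \<in> inf_paths G" for x
    using in_own_cylinder[OF that, of 0] ipath_0_in[OF that, of 0] by blast
  moreover have "(\<Union>\<mu>\<in>paths G. cylinder G \<mu>) \<subseteq> inf_paths G" by (auto simp: cylinder_def)
  ultimately show ?thesis unfolding path_topology_def by (auto simp: topology_generated_by_topspace)
qed

lemma openin_cylinder: "\<mu> \<in> paths G \<Longrightarrow> openin (path_topology G) (cylinder G \<mu>)"
  unfolding path_topology_def by (auto intro: topology_generated_by_Basis)

text \<open>By definition the cylinders are only a subbasis. Around a fixed x the prefix of degree m
  + n refines those of degrees m and n, so the cylinders of prefixes form a neighbourhood
  base.\<close>

lemma openin_cylinder_nbhd:
  assumes "openin (path_topology G) U" "x \<in> U"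
  obtains n where "cylinder G (x 0 n) \<subseteq> U"
proof -
  have "x \<in> inf_paths G" using assms openin_subset topspace_path_topology by blast
  have "generate_topology_on (cylinder G ` paths G) U"
    using assms(1) unfolding path_topology_def openin_topology_generated_by_iff .
  then have "x \<in> U \<longrightarrow> (\<exists>n. cylinder G (x 0 n) \<subseteq> U)"
  proof induction
    case (Int U V)
    show ?case
    proof
      assume "x \<in> U \<inter> V"
      then obtain m n where "cylinder G (x 0 m) \<subseteq> U" "cylinder G (x 0 n) \<subseteq> V" using Int by blast
      then have "cylinder G (x 0 (m + n)) \<subseteq> U \<inter> V"
        using cylinder_prefix[OF \<open>x \<in> inf_paths G\<close>] vec_le_add by blast
      then show "\<exists>n. cylinder G (x 0 n) \<subseteq> U \<inter> V" ..
    qed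
  next
    case (UN K)
    then show ?case by (meson Union_iff Union_upper subset_trans)
  next
    case (Basis U)
    then obtain \<mu> where \<mu>: "U = cylinder G \<mu>" by blast
    show ?case
    proof
      assume "x \<in> U"
      then have "x 0 (deg G \<mu>) = \<mu>" by (simp add: \<mu> cylinder_def)
      then show "\<exists>n. cylinder G (x 0 n) \<subseteq> U" using \<mu> by (metis subset_refl)
    qed
  qed simp
  then show thesis using that assms(2) by blast
qed

text \<open>Inequality of two shifts is witnessed by finite segments of equal degree. This makes it
  an open condition, and it also supplies distinct paths of equal degree to which CK1 can be
  applied.\<close>

lemma shift_neq_nbhd:
  assumes x: "x \<in> inf_paths G" and neq: "shift p x \<noteq> shift q x"
  obtains m where "x p (p + m) \<noteq> x q (q + m)"
  using shift_eqI[OF x x] neq by blast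

text \<open>Each of the defining conditions fails, if it fails, on a finite prefix. Closedness
  reduces the frontier to the set minus its interior.\<close>

lemma closedin_F_set: "closedin (path_topology G) (F_set G \<alpha> \<beta>)"
  unfolding closedin_def topspace_path_topology
proof
  show "F_set G \<alpha> \<beta> \<subseteq> inf_paths G" by (auto simp: F_set_def)
  show "openin (path_topology G) (inf_paths G - F_set G \<alpha> \<beta>)"
  proof (subst openin_subopen, rule ballI)
    fix x assume x: "x \<in> inf_paths G - F_set G \<alpha> \<beta>"
    then have xi: "x \<in> inf_paths G" by blast
    let ?a = "deg G \<alpha>" and ?b = "deg G \<beta>"
    have "\<exists>n. \<forall>y\<in>cylinder G (x 0 n). y \<notin> F_set G \<alpha> \<beta>"
    proof (cases "x 0 ?a = \<alpha> \<and> x 0 ?b = \<beta>")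
      case True
      then have "shift ?a x \<noteq> shift ?b x" using x by (auto simp: F_set_def)
      then obtain m where m: "x ?a (?a + m) \<noteq> x ?b (?b + m)" using shift_neq_nbhd[OF xi] by blast
      \<comment> \<open>This degree dominates both \<open>?a + m\<close> and \<open>?b + m\<close>,
        so y shares with x both of the segments being compared.\<close>
      have "y \<notin> F_set G \<alpha> \<beta>" if y: "y \<in> cylinder G (x 0 (?a + m + ?b))" for y
      proof
        assume F: "y \<in> F_set G \<alpha> \<beta>"
        have yi: "y \<in> inf_paths G" "x 0 (?a + m + ?b) = y 0 (?a + m + ?b)"
          using y by (auto simp: cylinder_def deg_ipath_0[OF xi])
        have "x ?a (?a + m) = y ?a (?a + m)"
          by (rule ipath_eq_segment[OF xi yi]) (auto simp: less_eq_vec_def)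
        moreover have "x ?b (?b + m) = y ?b (?b + m)"
          by (rule ipath_eq_segment[OF xi yi]) (auto simp: less_eq_vec_def)
        moreover have "shift ?a y = shift ?b y" using F by (simp add: F_set_def)
        from fun_cong[OF fun_cong[OF this], of 0 m]
        have "y ?a (?a + m) = y ?b (?b + m)" by (simp add: shift_def add.commute)
        ultimately show False using m by simp
      qed
      then show ?thesis by blast
    next
      case False
      have "y \<notin> F_set G \<alpha> \<beta>" if y: "y \<in> cylinder G (x 0 (?a + ?b))" for y
      proof -
        have yi: "y \<in> inf_paths G" "x 0 (?a + ?b) = y 0 (?a + ?b)"
          using y by (auto simp: cylinder_def deg_ipath_0[OF xi])
        have "x 0 ?a = y 0 ?a" "x 0 ?b = y 0 ?b"
          by (rule ipath_eq_initial[OF xi yi]; simp add: vec_le_add)+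
        with False show ?thesis by (auto simp: F_set_def)
      qed
      then show ?thesis by blast
    qed
    then obtain n where "\<forall>y\<in>cylinder G (x 0 n). y \<notin> F_set G \<alpha> \<beta>" ..
    then have "cylinder G (x 0 n) \<subseteq> inf_paths G - F_set G \<alpha> \<beta>" by (auto simp: cylinder_def)
    then show "\<exists>T. openin (path_topology G) T \<and> x \<in> T \<and> T \<subseteq> inf_paths G - F_set G \<alpha> \<beta>"
      using openin_cylinder[OF ipath_0_in[OF xi]] in_own_cylinder[OF xi] by meson
  qed
qed

text \<open>For a closed set, avoiding the frontier means that membership implies interior
  membership, and interior points have a cylinder neighbourhood inside the set.\<close>

lemma regular_iff_F_set:
  "x \<in> regular_paths G \<longleftrightarrow> x \<in> inf_paths G \<and>
     (\<forall>(\<alpha>, \<beta>)\<in>Sigma_pairs G. x \<in> F_set G \<alpha> \<beta> \<longrightarrow> (\<exists>n. cylinder G (x 0 n) \<subseteq> F_set G \<alpha> \<beta>))"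
proof -
  have "x \<in> path_topology G frontier_of F_set G \<alpha> \<beta> \<longleftrightarrow>
      x \<in> F_set G \<alpha> \<beta> \<and> \<not> (\<exists>n. cylinder G (x 0 n) \<subseteq> F_set G \<alpha> \<beta>)"
    if x: "x \<in> inf_paths G" for \<alpha> \<beta>
  proof -
    have "x \<in> path_topology G interior_of F_set G \<alpha> \<beta> \<longleftrightarrow> (\<exists>n. cylinder G (x 0 n) \<subseteq> F_set G \<alpha> \<beta>)"
      unfolding interior_of_def mem_Collect_eq
      using openin_cylinder ipath_0_in[OF x] in_own_cylinder[OF x] openin_cylinder_nbhd
      by (metis (no_types, lifting) subset_trans)
    then show ?thesis
      unfolding frontier_of_def using closure_of_closedin[OF closedin_F_set] by auto
  qed
  then show ?thesis unfolding regular_paths_def by blast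
qed

text \<open>Replacing \<open>(\<alpha>, \<beta>)\<close> by the degrees makes regularity visibly invariant under
  shifting and prepending.\<close>

lemma regular_iff:
  "x \<in> regular_paths G \<longleftrightarrow> x \<in> inf_paths G \<and>
     (\<forall>p q. shift p x = shift q x \<longrightarrow> (\<exists>n. \<forall>y\<in>cylinder G (x 0 n). shift p y = shift q y))"
proof (intro iffI conjI allI impI)
  assume x: "x \<in> regular_paths G"
  then show xi: "x \<in> inf_paths G" by (simp add: regular_iff_F_set)
  fix p q assume eq: "shift p x = shift q x"
  show "\<exists>n. \<forall>y\<in>cylinder G (x 0 n). shift p y = shift q y"
  \<comment> \<open>\<open>Sigma_pairs\<close> excludes equal paths, but equal prefixes force p = q,
    where the claim is trivial.\<close>
  proof (cases "x 0 p = x 0 q")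
    case True
    then have "p = q" using deg_ipath_0[OF xi] by metis
    then show ?thesis by simp
  next
    case False
    have "x p p = x q q" using fun_cong[OF fun_cong[OF eq], of 0 0] by (simp add: shift_def)
    then have "(x 0 p, x 0 q) \<in> Sigma_pairs G"
      using False xi by (simp add: Sigma_pairs_def ipath_0_in src_ipath vec_le_add)
    moreover have "x \<in> F_set G (x 0 p) (x 0 q)" using xi eq by (simp add: F_set_def deg_ipath_0)
    ultimately obtain n where "cylinder G (x 0 n) \<subseteq> F_set G (x 0 p) (x 0 q)"
      using x unfolding regular_iff_F_set by blast
    then show ?thesis using xi by (auto simp: F_set_def deg_ipath_0)
  qed
next
  assume x: "x \<in> inf_paths G \<and>
     (\<forall>p q. shift p x = shift q x \<longrightarrow> (\<exists>n. \<forall>y\<in>cylinder G (x 0 n). shift p y = shift q y))"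
  have "\<exists>n. cylinder G (x 0 n) \<subseteq> F_set G \<alpha> \<beta>" if F: "x \<in> F_set G \<alpha> \<beta>" for \<alpha> \<beta>
  proof -
    let ?a = "deg G \<alpha>" and ?b = "deg G \<beta>"
    have ab: "x 0 ?a = \<alpha>" "x 0 ?b = \<beta>" "shift ?a x = shift ?b x" using F by (auto simp: F_set_def)
    from x ab(3) obtain n where n: "\<And>y. y \<in> cylinder G (x 0 n) \<Longrightarrow> shift ?a y = shift ?b y" by blast
    have xi: "x \<in> inf_paths G" using x by blast
    \<comment> \<open>Lengthening the prefix by both degrees makes its cylinder also prescribe the
      segments \<alpha> and \<beta>.\<close>
    have "n \<le> n + ?a + ?b" "?a \<le> n + ?a + ?b" "?b \<le> n + ?a + ?b" by (auto simp: less_eq_vec_def)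
    then have "cylinder G (x 0 (n + ?a + ?b)) \<subseteq> cylinder G (x 0 n) \<inter> cylinder G \<alpha> \<inter> cylinder G \<beta>"
      using cylinder_prefix[OF xi, of _ "n + ?a + ?b"] ab by (metis Int_subset_iff)
    then have "cylinder G (x 0 (n + ?a + ?b)) \<subseteq> F_set G \<alpha> \<beta>"
      using n by (auto simp: F_set_def cylinder_def)
    then show ?thesis ..
  qed
  then show "x \<in> regular_paths G" unfolding regular_iff_F_set using x by blast
qed

lemma regular_in: "x \<in> regular_paths G \<Longrightarrow> x \<in> inf_paths G"
  by (simp add: regular_iff)

section \<open>Invariance of regularity under shifting and prepending\<close>

lemma shift_cylinder:
  assumes y: "y \<in> inf_paths G" and t: "t \<in> cylinder G (y 0 (a + n))"
  shows "shift a t \<in> cylinder G (shift a y 0 n)"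
proof -
  have t': "t \<in> inf_paths G" "y 0 (a + n) = t 0 (a + n)" using t by (auto simp: cylinder_def deg_ipath_0[OF y])
  have "y a (a + n) = t a (a + n)" by (rule ipath_eq_segment[OF y t']) (auto simp: vec_le_add)
  then show ?thesis using shift_in[OF t'(1)] deg_ipath_0[OF shift_in[OF y]]
    by (simp add: cylinder_def) (simp add: shift_def add.commute)
qed

text \<open>Regularity of the tail only equates the shifts of nearby paths after a further shift by
  a. The missing segment of degree a is copied from y, where the two shifts agree.\<close>

lemma regular_of_shift:
  assumes y: "y \<in> inf_paths G" and reg: "shift a y \<in> regular_paths G"
  shows "y \<in> regular_paths G"
  unfolding regular_iff
proof (intro conjI y allI impI)
  fix p q assume eq: "shift p y = shift q y"
  then have "shift a (shift p y) = shift a (shift q y)" by simp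
  then have "shift p (shift a y) = shift q (shift a y)" by (simp add: shift_shift add.commute)
  then obtain n where n: "\<And>t. t \<in> cylinder G (shift a y 0 n) \<Longrightarrow> shift p t = shift q t"
    using reg unfolding regular_iff by blast
  \<comment> \<open>Large enough for the neighbourhood of the tail (a + n) and for the segments of
    degree a that start at p and at q.\<close>
  let ?N = "a + n + p + q"
  have "shift p t = shift q t" if t: "t \<in> cylinder G (y 0 ?N)" for t
  proof -
    have ti: "t \<in> inf_paths G" "y 0 ?N = t 0 ?N" using t by (auto simp: cylinder_def deg_ipath_0[OF y])
    have "t \<in> cylinder G (y 0 (a + n))"
      using cylinder_prefix[OF y, of "a + n" ?N] t by (auto simp: less_eq_vec_def)
    then have "shift p (shift a t) = shift q (shift a t)" by (intro n shift_cylinder[OF y])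
    then have "shift a (shift p t) = shift a (shift q t)" by (simp add: shift_shift add.commute)
    moreover have "y p (p + a) = t p (p + a)"
      by (rule ipath_eq_segment[OF y ti]) (auto simp: less_eq_vec_def)
    moreover have "y q (q + a) = t q (q + a)"
      by (rule ipath_eq_segment[OF y ti]) (auto simp: less_eq_vec_def)
    moreover have "y p (p + a) = y q (q + a)"
      using fun_cong[OF fun_cong[OF eq], of 0 a] by (simp add: shift_def add.commute)
    ultimately have eqs: "shift a (shift p t) = shift a (shift q t)" "shift p t 0 a = shift q t 0 a"
      by (simp_all add: shift_def add.commute)
    let ?\<alpha> = "shift p t 0 a"
    have "shift p t \<in> cylinder G ?\<alpha>" "shift q t \<in> cylinder G ?\<alpha>" "?\<alpha> \<in> paths G" "deg G ?\<alpha> = a"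
      using shift_in[OF ti(1)] in_own_cylinder[of "shift q t" a] in_own_cylinder[of "shift p t" a]
        ipath_0_in deg_ipath_0 eqs(2) by auto
    then show ?thesis using cylinder_shift_eqI[of ?\<alpha> "shift p t" "shift q t"] eqs(1) by simp
  qed
  then show "\<exists>n. \<forall>y\<in>cylinder G (y 0 n). shift p y = shift q y" by blast
qed

lemma prepend_regular:
  assumes "\<alpha> \<in> paths G" "x \<in> inf_paths_from G (src G \<alpha>)" "x \<in> regular_paths G"
  shows "prepend G \<alpha> x \<in> regular_paths G"
  using regular_of_shift[OF prepend_in[OF assms(1,2)], of "deg G \<alpha>"] shift_prepend[OF assms(1,2)] assms(3)
  by simp

text \<open>A path near the tail is lifted to a path near y by prepending \<open>y 0 a\<close>;
  there the regularity of y applies.\<close>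

lemma shift_regular:
  assumes reg: "y \<in> regular_paths G"
  shows "shift a y \<in> regular_paths G"
  unfolding regular_iff
proof (intro conjI allI impI)
  have y: "y \<in> inf_paths G" using reg by (rule regular_in)
  show x: "shift a y \<in> inf_paths G" using y by (rule shift_in)
  fix p q assume "shift p (shift a y) = shift q (shift a y)"
  then obtain n where n: "\<And>t. t \<in> cylinder G (y 0 n) \<Longrightarrow> shift (p + a) t = shift (q + a) t"
    using reg unfolding regular_iff shift_shift by blast
  define \<alpha> where "\<alpha> = y 0 a"
  have \<alpha>: "\<alpha> \<in> paths G" "deg G \<alpha> = a" "y \<in> cylinder G \<alpha>"
    unfolding \<alpha>_def using y ipath_0_in deg_ipath_0 in_own_cylinder by auto
  have ya: "y 0 (a + n) = pcomp G \<alpha> (shift a y 0 n)"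
    using ipath_comp(2)[OF y vec_le_add(3,1), of a n] by (simp add: \<alpha>_def shift_def add.commute)
  have "shift p s = shift q s" if s: "s \<in> cylinder G (shift a y 0 n)" for s
  proof -
    have si: "s \<in> inf_paths G" "s 0 n = shift a y 0 n" using s by (auto simp: cylinder_def deg_ipath_0[OF x])
    have "s 0 0 = shift a y 0 0" using ipath_eq_initial[OF si(1) x si(2)] by (simp add: vec_le_add)
    then have sf: "s \<in> inf_paths_from G (src G \<alpha>)"
      using shift_cylinder_from[OF \<alpha>(1,3)] si \<alpha>(2) by (auto simp: inf_paths_from_def)
    let ?t = "prepend G \<alpha> s"
    have "?t 0 (a + n) = y 0 (a + n)"
      using prepend_at[OF \<alpha>(1) sf, of "a + n"] \<alpha> si ya by (simp add: vec_le_add)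
    then have "?t \<in> cylinder G (y 0 (a + n))"
      using prepend_in[OF \<alpha>(1) sf] by (simp add: cylinder_def deg_ipath_0[OF y])
    then have "?t \<in> cylinder G (y 0 n)" using cylinder_prefix[OF y, of n "a + n"] by (auto simp: vec_le_add)
    from n[OF this] show ?thesis
      using shift_prepend[OF \<alpha>(1) sf] \<alpha>(2) by (simp flip: shift_shift)
  qed
  then show "\<exists>n. \<forall>s\<in>cylinder G (shift a y 0 n). shift p s = shift q s" by blast
qed

end

section \<open>\<open>C\<^sup>*\<close>-algebras and positive functionals\<close>

text \<open>\<open>cstar_subalgebra\<close> without closedness, so that the dense span of monomials
  is covered as well.\<close>

definition star_subalgebra :: "'a star_alg \<Rightarrow> 'a set \<Rightarrow> bool" where
  "star_subalgebra A B \<longleftrightarrow>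
     B \<subseteq> carrier A \<and> \<zero>\<^bsub>A\<^esub> \<in> B \<and>
     (\<forall>a\<in>B. \<forall>b\<in>B. a \<oplus>\<^bsub>A\<^esub> b \<in> B) \<and>
     (\<forall>k. \<forall>a\<in>B. k \<odot>\<^bsub>A\<^esub> a \<in> B) \<and>
     (\<forall>a\<in>B. \<forall>b\<in>B. a \<otimes>\<^bsub>A\<^esub> b \<in> B) \<and>
     (\<forall>a\<in>B. star A a \<in> B)"

lemma cstar_subalgebra_iff:
  "cstar_subalgebra A B \<longleftrightarrow> star_subalgebra A B \<and> closedin (norm_topology A) B"
  by (auto simp: cstar_subalgebra_def star_subalgebra_def)

lemma star_subalgebraD:
  assumes "star_subalgebra A B"
  shows "a \<in> B \<Longrightarrow> a \<in> carrier A" "\<zero>\<^bsub>A\<^esub> \<in> B" "a \<in> B \<Longrightarrow> b \<in> B \<Longrightarrow> a \<oplus>\<^bsub>A\<^esub> b \<in> B"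
    "a \<in> B \<Longrightarrow> k \<odot>\<^bsub>A\<^esub> a \<in> B" "a \<in> B \<Longrightarrow> b \<in> B \<Longrightarrow> a \<otimes>\<^bsub>A\<^esub> b \<in> B" "a \<in> B \<Longrightarrow> star A a \<in> B"
  using assms by (auto simp: star_subalgebra_def)

lemma star_subalgebra_Inter:
  assumes "F \<noteq> {}" "\<And>B. B \<in> F \<Longrightarrow> star_subalgebra A B"
  shows "star_subalgebra A (\<Inter>F)"
proof -
  obtain B where B: "B \<in> F" using assms(1) by blast
  have "\<Inter>F \<subseteq> carrier A" using B star_subalgebraD(1)[OF assms(2)[OF B]] by blast
  then show ?thesis
    unfolding star_subalgebra_def Inter_iff Ball_def
    using star_subalgebraD[OF assms(2)] by simp
qed

context cstar_algebra
begin

abbreviation alg_mult :: "'a \<Rightarrow> 'a \<Rightarrow> 'a" (infixl "\<cdot>" 70) where "a \<cdot> b \<equiv> a \<otimes>\<^bsub>A\<^esub> b"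

section \<open>Scalar, norm and distance calculus\<close>

lemma scale_closed [simp]: "a \<in> carrier A \<Longrightarrow> k \<odot>\<^bsub>A\<^esub> a \<in> carrier A"
  using smult_closed[of k a] by (simp add: complex_ring_def)

declare mult_closed [simp] star_closed [simp] star_star [simp]

lemma scale_add_l: "a \<in> carrier A \<Longrightarrow> (k + l) \<odot>\<^bsub>A\<^esub> a = k \<odot>\<^bsub>A\<^esub> a \<oplus>\<^bsub>A\<^esub> l \<odot>\<^bsub>A\<^esub> a"
  using smult_l_distr[of k l a] by (simp add: complex_ring_def)

lemma scale_add_r: "a \<in> carrier A \<Longrightarrow> b \<in> carrier A \<Longrightarrow>
    k \<odot>\<^bsub>A\<^esub> (a \<oplus>\<^bsub>A\<^esub> b) = k \<odot>\<^bsub>A\<^esub> a \<oplus>\<^bsub>A\<^esub> k \<odot>\<^bsub>A\<^esub> b"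
  using smult_r_distr[of k a b] by (simp add: complex_ring_def)

lemma scale_scale: "a \<in> carrier A \<Longrightarrow> k \<odot>\<^bsub>A\<^esub> (l \<odot>\<^bsub>A\<^esub> a) = (k * l) \<odot>\<^bsub>A\<^esub> a"
  using smult_assoc1[of k l a] by (simp add: complex_ring_def)

lemma scale_1 [simp]: "a \<in> carrier A \<Longrightarrow> 1 \<odot>\<^bsub>A\<^esub> a = a"
  using smult_one[of a] by (simp add: complex_ring_def)

lemma scale_0 [simp]: "a \<in> carrier A \<Longrightarrow> 0 \<odot>\<^bsub>A\<^esub> a = \<zero>\<^bsub>A\<^esub>"
  using smult_l_null[of a] by (simp add: complex_ring_def)

lemma scale_zero [simp]: "k \<odot>\<^bsub>A\<^esub> \<zero>\<^bsub>A\<^esub> = \<zero>\<^bsub>A\<^esub>"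
  using smult_r_null[of k] by (simp add: complex_ring_def)

lemma minus_scale:
  assumes "a \<in> carrier A" "b \<in> carrier A"
  shows "a \<ominus>\<^bsub>A\<^esub> b = a \<oplus>\<^bsub>A\<^esub> (-1) \<odot>\<^bsub>A\<^esub> b"
proof -
  have "(-1) \<odot>\<^bsub>A\<^esub> b \<oplus>\<^bsub>A\<^esub> b = \<zero>\<^bsub>A\<^esub>"
    using scale_add_l[of b "-1" 1] assms by simp
  then have "\<ominus>\<^bsub>A\<^esub> b = (-1) \<odot>\<^bsub>A\<^esub> b"
    using M.minus_equality assms scale_closed by blast
  then show ?thesis by (simp add: M.minus_eq)
qed

lemma mult_zero_l [simp]: "a \<in> carrier A \<Longrightarrow> \<zero>\<^bsub>A\<^esub> \<cdot> a = \<zero>\<^bsub>A\<^esub>"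
  using smult_mult_l[of "\<zero>\<^bsub>A\<^esub>" a 0] by simp

lemma mult_zero_r [simp]: "a \<in> carrier A \<Longrightarrow> a \<cdot> \<zero>\<^bsub>A\<^esub> = \<zero>\<^bsub>A\<^esub>"
  using smult_mult_r[of a "\<zero>\<^bsub>A\<^esub>" 0] by simp

lemma star_zero [simp]: "star A \<zero>\<^bsub>A\<^esub> = \<zero>\<^bsub>A\<^esub>"
  using star_smult[of "\<zero>\<^bsub>A\<^esub>" 0] by simp

lemma norm_star: "a \<in> carrier A \<Longrightarrow> cnorm A (star A a) = cnorm A a"
proof -
  have le: "cnorm A a \<le> cnorm A (star A a)" if a: "a \<in> carrier A" for a
  proof (cases "cnorm A a = 0")
    case False
    then have "0 < cnorm A a" using norm_nonneg[OF a] by simp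
    moreover have "(cnorm A a)\<^sup>2 \<le> cnorm A (star A a) * cnorm A a"
      using cstar_identity[OF a] norm_mult_le[of "star A a" a] a by simp
    ultimately show ?thesis by (simp add: power2_eq_square)
  qed (use norm_nonneg[of "star A a"] a in simp)
  assume "a \<in> carrier A"
  then show ?thesis using le[of a] le[of "star A a"] by simp
qed

sublocale D: Metric_space "carrier A" "cdist A"
  by (rule Metric_space_cdist)

lemma dist_add:
  assumes "a \<in> carrier A" "b \<in> carrier A" "v \<in> carrier A" "w \<in> carrier A"
  shows "cdist A (a \<oplus>\<^bsub>A\<^esub> b) (v \<oplus>\<^bsub>A\<^esub> w) \<le> cdist A a v + cdist A b w"
proof -
  have translate: "cdist A (x \<oplus>\<^bsub>A\<^esub> z) (y \<oplus>\<^bsub>A\<^esub> z) = cdist A x y"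
    if "x \<in> carrier A" "y \<in> carrier A" "z \<in> carrier A" for x y z
  proof -
    have "(x \<oplus>\<^bsub>A\<^esub> z) \<ominus>\<^bsub>A\<^esub> (y \<oplus>\<^bsub>A\<^esub> z) = x \<ominus>\<^bsub>A\<^esub> y"
      using that
      by (simp add: M.minus_eq M.minus_add M.a_assoc M.a_comm[of "\<ominus>\<^bsub>A\<^esub> y" "\<ominus>\<^bsub>A\<^esub> z"] M.r_neg2)
    then show ?thesis using that by (simp add: cdist_def)
  qed
  have "cdist A (a \<oplus>\<^bsub>A\<^esub> b) (v \<oplus>\<^bsub>A\<^esub> w) \<le> cdist A (a \<oplus>\<^bsub>A\<^esub> b) (v \<oplus>\<^bsub>A\<^esub> b) + cdist A (v \<oplus>\<^bsub>A\<^esub> b) (v \<oplus>\<^bsub>A\<^esub> w)"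
    using assms by (intro D.triangle) auto
  also have "\<dots> = cdist A a v + cdist A b w"
    using translate[of a v b] translate[of b w v] assms M.a_comm[of v] by simp
  finally show ?thesis .
qed

lemma dist_scale:
  assumes "a \<in> carrier A" "b \<in> carrier A"
  shows "cdist A (k \<odot>\<^bsub>A\<^esub> a) (k \<odot>\<^bsub>A\<^esub> b) = cmod k * cdist A a b"
proof -
  have "k \<odot>\<^bsub>A\<^esub> a \<ominus>\<^bsub>A\<^esub> k \<odot>\<^bsub>A\<^esub> b = k \<odot>\<^bsub>A\<^esub> (a \<ominus>\<^bsub>A\<^esub> b)"
    using assms by (simp add: minus_scale scale_add_r scale_scale mult.commute)
  then show ?thesis using assms norm_smult[of "a \<ominus>\<^bsub>A\<^esub> b" k] by (simp add: cdist_def)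
qed

lemma dist_mult_r:
  assumes "a \<in> carrier A" "b \<in> carrier A" "c \<in> carrier A"
  shows "cdist A (a \<cdot> c) (b \<cdot> c) \<le> cdist A a b * cnorm A c"
proof -
  have "a \<cdot> c \<ominus>\<^bsub>A\<^esub> b \<cdot> c = (a \<ominus>\<^bsub>A\<^esub> b) \<cdot> c"
    using assms by (simp add: minus_scale mult_l_distr smult_mult_l)
  then show ?thesis using assms norm_mult_le[of "a \<ominus>\<^bsub>A\<^esub> b" c] by (simp add: cdist_def)
qed

lemma dist_mult_l:
  assumes "a \<in> carrier A" "b \<in> carrier A" "c \<in> carrier A"
  shows "cdist A (c \<cdot> a) (c \<cdot> b) \<le> cnorm A c * cdist A a b"
proof -
  have "c \<cdot> a \<ominus>\<^bsub>A\<^esub> c \<cdot> b = c \<cdot> (a \<ominus>\<^bsub>A\<^esub> b)"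
    using assms by (simp add: minus_scale mult_r_distr smult_mult_r)
  then show ?thesis using assms norm_mult_le[of c "a \<ominus>\<^bsub>A\<^esub> b"] by (simp add: cdist_def)
qed

lemma dist_star:
  assumes "a \<in> carrier A" "b \<in> carrier A"
  shows "cdist A (star A a) (star A b) = cdist A a b"
proof -
  have "star A a \<ominus>\<^bsub>A\<^esub> star A b = star A (a \<ominus>\<^bsub>A\<^esub> b)"
    using assms star_smult[of b "-1"] by (simp add: minus_scale star_add)
  then show ?thesis using assms norm_star[of "a \<ominus>\<^bsub>A\<^esub> b"] by (simp add: cdist_def)
qed

lemma dist_zero: "a \<in> carrier A \<Longrightarrow> cdist A a \<zero>\<^bsub>A\<^esub> = cnorm A a"
  by (simp add: cdist_def minus_scale)

lemma dist_mult:
  assumes "a \<in> carrier A" "b \<in> carrier A" "v \<in> carrier A" "w \<in> carrier A"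
  shows "cdist A (a \<cdot> b) (v \<cdot> w) \<le> cdist A a v * cnorm A b + cnorm A v * cdist A b w"
  using D.triangle[of "a \<cdot> b" "v \<cdot> b" "v \<cdot> w"] dist_mult_r[of a v b] dist_mult_l[of b w v]
    assms by simp

section \<open>Closures and generated subalgebras\<close>

lemma norm_closedI:
  assumes "C \<subseteq> carrier A"
    and "\<And>a. a \<in> carrier A \<Longrightarrow> (\<And>e. 0 < e \<Longrightarrow> \<exists>c\<in>C. cdist A a c < e) \<Longrightarrow> a \<in> C"
  shows "closedin (norm_topology A) C"
  unfolding norm_topology_def D.closedin_metric
proof (intro conjI assms(1) allI impI)
  fix a assume a: "a \<in> carrier A - C"
  then obtain e where "0 < e" "\<And>c. c \<in> C \<Longrightarrow> \<not> cdist A a c < e" using assms(2) by blast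
  then show "\<exists>r>0. disjnt C (D.mball a r)" by (auto simp: disjnt_def)
qed

lemma cstar_subalgebra_carrier: "cstar_subalgebra A (carrier A)"
  unfolding cstar_subalgebra_iff star_subalgebra_def by (auto intro: norm_closedI)

text \<open>Since the closure is again a C*-subalgebra, a star-subalgebra that contains generators
  is dense in what they generate.\<close>

lemma cstar_subalgebra_closure:
  assumes V: "star_subalgebra A V"
  shows "cstar_subalgebra A {a \<in> carrier A. \<forall>e>0. \<exists>v\<in>V. cdist A a v < e}" (is "cstar_subalgebra A ?C")
proof -
  note VD = star_subalgebraD[OF V]
  have c_add: "a \<oplus>\<^bsub>A\<^esub> b \<in> ?C" if mem: "a \<in> ?C" "b \<in> ?C" for a b
  proof safe
    fix e :: real assume e: "0 < e"
    obtain v where "v \<in> V" "cdist A a v < e / 2" using mem(1) half_gt_zero[OF e] by blast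
    moreover obtain w where "w \<in> V" "cdist A b w < e / 2" using mem(2) half_gt_zero[OF e] by blast
    ultimately show "\<exists>v\<in>V. cdist A (a \<oplus>\<^bsub>A\<^esub> b) v < e"
      using mem VD dist_add[of a b v w] by (intro bexI[of _ "v \<oplus>\<^bsub>A\<^esub> w"]) auto
  qed (use that in auto)
  have c_mult: "a \<cdot> b \<in> ?C" if mem: "a \<in> ?C" "b \<in> ?C" for a b
  proof safe
    fix e :: real assume e: "0 < e"
    have ab: "a \<in> carrier A" "b \<in> carrier A" using mem by auto
    \<comment> \<open>The error of a product is at most d(a,v) |b| + |v| d(b,w), so v is chosen
      first and the tolerance for w depends on its norm. The added 1 excludes division by
      zero.\<close>
    have "0 < e / (2 * (cnorm A b + 1))" using e norm_nonneg[OF ab(2)] by (simp add: add_nonneg_pos)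
    then obtain v where v: "v \<in> V" "cdist A a v < e / (2 * (cnorm A b + 1))" using mem by blast
    have vA: "v \<in> carrier A" using v VD by blast
    have "0 < e / (2 * (cnorm A v + 1))" using e norm_nonneg[OF vA] by (simp add: add_nonneg_pos)
    then obtain w where w: "w \<in> V" "cdist A b w < e / (2 * (cnorm A v + 1))" using mem by blast
    have wA: "w \<in> carrier A" using w VD by blast
    have small: "x * y < e / 2" if "0 \<le> x" "0 \<le> y" "x < e / (2 * (y + 1))" for x y
    proof -
      have "x * y \<le> x * (y + 1)" using that by (intro mult_left_mono) auto
      also have "\<dots> < e / 2" using that by (simp add: field_simps)
      finally show ?thesis .
    qed
    have "cdist A (a \<cdot> b) (v \<cdot> w) < e"
      using dist_mult[OF ab vA wA] small[OF _ norm_nonneg[OF ab(2)] v(2)] small[OF _ norm_nonneg[OF vA] w(2)]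
      by (simp add: mult.commute)
    then show "\<exists>v\<in>V. cdist A (a \<cdot> b) v < e" using v w VD by blast
  qed (use that in auto)
  have c_scale: "k \<odot>\<^bsub>A\<^esub> a \<in> ?C" if mem: "a \<in> ?C" for k a
  proof safe
    fix e :: real assume e: "0 < e"
    have "0 < e / (cmod k + 1)" using e by (simp add: add_nonneg_pos)
    then obtain v where v: "v \<in> V" "cdist A a v < e / (cmod k + 1)" using mem by blast
    have "cmod k * cdist A a v \<le> (cmod k + 1) * cdist A a v" by (intro mult_right_mono) auto
    also have "\<dots> < e"
      using v(2) add_nonneg_pos[of "cmod k" 1] by (simp add: pos_less_divide_eq mult.commute)
    finally have "cdist A (k \<odot>\<^bsub>A\<^esub> a) (k \<odot>\<^bsub>A\<^esub> v) < e" using mem v VD by (simp add: dist_scale)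
    then show "\<exists>v\<in>V. cdist A (k \<odot>\<^bsub>A\<^esub> a) v < e" using v VD by blast
  qed (use that in auto)
  have c_star: "star A a \<in> ?C" if mem: "a \<in> ?C" for a
  proof safe
    fix e :: real assume "0 < e"
    then obtain v where v: "v \<in> V" "cdist A a v < e" using mem by blast
    then show "\<exists>v\<in>V. cdist A (star A a) v < e"
      using mem VD dist_star[of a v] by (intro bexI[of _ "star A v"]) auto
  qed (use mem in auto)
  have c_zero: "\<zero>\<^bsub>A\<^esub> \<in> ?C" using VD by (auto intro!: bexI[of _ "\<zero>\<^bsub>A\<^esub>"])
  have "star_subalgebra A ?C"
    unfolding star_subalgebra_def by (intro conjI ballI allI c_add c_mult c_scale c_star c_zero) auto
  moreover have "closedin (norm_topology A) ?C"
  proof (rule norm_closedI)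
    fix a assume a: "a \<in> carrier A" "\<And>e. 0 < e \<Longrightarrow> \<exists>c\<in>?C. cdist A a c < e"
    have "\<exists>v\<in>V. cdist A a v < e" if e: "0 < e" for e
    proof -
      obtain c where c: "c \<in> ?C" "cdist A a c < e / 2" using a(2)[of "e / 2"] e by auto
      then obtain v where v: "v \<in> V" "cdist A c v < e / 2" using half_gt_zero[OF e] by blast
      then show ?thesis using D.triangle[of a c v] a(1) c VD by (intro bexI[of _ v]) auto
    qed
    then show "a \<in> ?C" using a(1) by blast
  qed auto
  ultimately show ?thesis by (simp add: cstar_subalgebra_iff)
qed

lemma subset_closure:
  "star_subalgebra A V \<Longrightarrow> V \<subseteq> {a \<in> carrier A. \<forall>e>0. \<exists>v\<in>V. cdist A a v < e}"
  using star_subalgebraD(1)[of A V] D.mdist_zero by (auto intro!: bexI)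

lemma cstar_subalgebra_generated:
  assumes "G \<subseteq> carrier A"
  shows "cstar_subalgebra A (cstar_generated A G)"
proof -
  have ne: "{B. cstar_subalgebra A B \<and> G \<subseteq> B} \<noteq> {}"
    using assms cstar_subalgebra_carrier by blast
  then have "closedin (norm_topology A) (cstar_generated A G)"
    unfolding cstar_generated_def by (intro closedin_Inter) (auto simp: cstar_subalgebra_iff)
  moreover have "star_subalgebra A (cstar_generated A G)"
    unfolding cstar_generated_def
    by (rule star_subalgebra_Inter[OF ne]) (simp add: cstar_subalgebra_iff)
  ultimately show ?thesis by (simp add: cstar_subalgebra_iff)
qed

text \<open>A self-adjoint \<open>y\<close> with \<open>1 - a = (1 - y)\<^sup>2\<close>, found as the fixed point of
  \<open>y \<mapsto> (a + y\<^sup>2) / 2\<close>.\<close>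

lemma square_root:
  assumes a: "a \<in> carrier A" "star A a = a" and small: "cnorm A a \<le> 1 / 2"
  obtains y where "y \<in> carrier A" "star A y = y" "2 \<odot>\<^bsub>A\<^esub> y = a \<oplus>\<^bsub>A\<^esub> y \<cdot> y"
proof -
  define T where "T y = (1/2) \<odot>\<^bsub>A\<^esub> (a \<oplus>\<^bsub>A\<^esub> y \<cdot> y)" for y
  have T: "T y \<in> carrier A" if "y \<in> carrier A" for y using that a by (simp add: T_def)
  \<comment> \<open>For v and w in the ball of radius 1/2 the factor is at most 1/2, so T is a
    contraction there.\<close>
  have T_dist: "cdist A (T v) (T w) \<le> 1/2 * (cnorm A v + cnorm A w) * cdist A v w"
    if "v \<in> carrier A" "w \<in> carrier A" for v w
  proof -
    have "cdist A (T v) (T w) = 1/2 * cdist A (a \<oplus>\<^bsub>A\<^esub> v \<cdot> v) (a \<oplus>\<^bsub>A\<^esub> w \<cdot> w)"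
      using that a by (simp add: T_def dist_scale)
    also have "\<dots> \<le> 1/2 * (cdist A a a + cdist A (v \<cdot> v) (w \<cdot> w))"
      using that a dist_add[of a "v \<cdot> v" a "w \<cdot> w"] by simp
    also have "\<dots> \<le> 1/2 * (cdist A v w * cnorm A v + cnorm A w * cdist A v w)"
      using that a dist_mult[of v v w w] by simp
    finally show ?thesis by (simp add: algebra_simps)
  qed
  define s where "s n = (T ^^ n) \<zero>\<^bsub>A\<^esub>" for n
  have s0: "s 0 = \<zero>\<^bsub>A\<^esub>" and sS: "s (Suc n) = T (s n)" for n by (simp_all add: s_def)
  have sA: "s n \<in> carrier A" for n by (induction n) (auto simp: s0 sS T)
  have s_star: "star A (s n) = s n" for n
    by (induction n) (use a sA in \<open>auto simp: s0 sS T_def star_smult star_add star_mult\<close>)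
  have s_norm: "cnorm A (s n) \<le> 1/2" for n
  proof (induction n)
    case (Suc n)
    have "cnorm A (s (Suc n)) = 1/2 * cnorm A (a \<oplus>\<^bsub>A\<^esub> s n \<cdot> s n)"
      using sA[of n] a by (simp add: sS T_def norm_smult)
    also have "\<dots> \<le> 1/2 * (cnorm A a + cnorm A (s n) * cnorm A (s n))"
      using norm_triangle[of a "s n \<cdot> s n"] norm_mult_le[of "s n" "s n"] sA[of n] a by simp
    \<comment> \<open>The value is 3/8, so the ball of radius 1/2 is invariant.\<close>
    also have "\<dots> \<le> 1/2 * (1/2 + 1/2 * (1/2))"
      using Suc small norm_nonneg[OF sA[of n]] by (intro mult_left_mono add_mono mult_mono) auto
    finally show ?case by simp
  next
    case 0
    show ?case using norm_eq_0[of "\<zero>\<^bsub>A\<^esub>"] by (simp add: s0)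
  qed
  have s_dist: "cdist A (s n) (s (Suc n)) \<le> (1/2) ^ n" for n
  proof (induction n)
    case 0
    have "cdist A (s 0) (s 1) = cnorm A (s 1)" using sA[of 1] D.commute[of "s 1"] dist_zero[of "s 1"] by (simp add: s0)
    then show ?case using s_norm[of 1] by simp
  next
    case (Suc n)
    have "cdist A (s (Suc n)) (s (Suc (Suc n))) \<le> 1/2 * (cnorm A (s n) + cnorm A (s (Suc n))) * cdist A (s n) (s (Suc n))"
      using T_dist[OF sA sA, of n "Suc n"] by (simp add: sS)
    also have "\<dots> \<le> 1/2 * (1/2 + 1/2) * (1/2) ^ n"
      using Suc s_norm[of n] s_norm[of "Suc n"] norm_nonneg[OF sA]
      by (intro mult_mono add_mono) (auto simp: add_nonneg_nonneg)
    finally show ?case by simp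
  qed
  \<comment> \<open>The bound telescopes exactly: consecutive values of 2 (1/2)^n differ by (1/2)^n
    times 1.\<close>
  have geom: "cdist A (s n) (s (n + k)) \<le> 2 * (1/2) ^ n - 2 * (1/2) ^ (n + k)" for n k
  proof (induction k)
    case (Suc k)
    have "cdist A (s n) (s (n + Suc k)) \<le> cdist A (s n) (s (n + k)) + cdist A (s (n + k)) (s (Suc (n + k)))"
      using D.triangle[of "s n" "s (n + k)" "s (Suc (n + k))"] sA by simp
    then show ?case using Suc s_dist[of "n + k"] by simp
  qed (simp add: sA)
  have "D.MCauchy s"
    unfolding D.MCauchy_def
  proof (intro conjI allI impI)
    show "range s \<subseteq> carrier A" using sA by auto
    fix e :: real assume e: "0 < e"
    obtain N where N: "(1/2) ^ N < e / 2" using real_arch_pow_inv[of "e / 2" "1/2"] e by auto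
    have le: "cdist A (s n) (s m) < e" if "N \<le> n" "n \<le> m" for n m
    proof -
      have "cdist A (s n) (s m) \<le> 2 * (1/2) ^ n - 2 * (1/2) ^ m"
        using geom[of n "m - n"] that by simp
      also have "\<dots> \<le> 2 * (1/2) ^ n" by simp
      also have "\<dots> \<le> 2 * (1/2) ^ N" using that by (simp add: power_decreasing)
      finally show ?thesis using N by simp
    qed
    show "\<exists>N. \<forall>n n'. N \<le> n \<longrightarrow> N \<le> n' \<longrightarrow> cdist A (s n) (s n') < e"
      using le D.commute by (metis nat_le_linear)
  qed
  then obtain y where y: "limitin D.mtopology s y sequentially"
    using complete unfolding D.mcomplete_def by blast
  then have yA: "y \<in> carrier A" and lim: "\<And>e. 0 < e \<Longrightarrow> \<exists>N. \<forall>n\<ge>N. cdist A (s n) y < e"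
    unfolding D.limit_metric_sequentially by blast+
  define d where "d n = cdist A (s n) y" for n
  have d0: "d \<longlonglongrightarrow> 0"
    using lim unfolding LIMSEQ_iff d_def by simp
  have "cdist A (star A y) y \<le> 2 * d n" for n
    using D.triangle[of "star A y" "s n" y] dist_star[OF sA yA, of n] D.commute[of "star A y" "s n"] yA sA[of n]
    by (simp add: s_star d_def)
  moreover have "(\<lambda>n. 2 * d n) \<longlonglongrightarrow> 0" using tendsto_mult_right_zero[OF d0, of 2] by simp
  ultimately have "cdist A (star A y) y \<le> 0" by (intro LIMSEQ_le_const[of "\<lambda>n. 2 * d n"]) auto
  then have star: "star A y = y" using D.zero[of "star A y" y] D.nonneg[of "star A y" y] yA by simp
  have "cdist A y (T y) \<le> d (Suc n) + 1/2 * (1/2 + cnorm A y) * d n" for n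
  proof -
    have "cdist A y (T y) \<le> cdist A y (s (Suc n)) + cdist A (s (Suc n)) (T y)"
      by (rule D.triangle) (use yA sA T in auto)
    moreover have "cdist A (s (Suc n)) (T y) \<le> 1/2 * (cnorm A (s n) + cnorm A y) * d n"
      using T_dist[OF sA yA, of n] by (simp add: sS d_def)
    moreover have "\<dots> \<le> 1/2 * (1/2 + cnorm A y) * d n"
      using s_norm[of n] by (intro mult_right_mono) (auto simp: d_def)
    ultimately show ?thesis using D.commute[of y "s (Suc n)"] by (simp add: d_def)
  qed
  moreover have "(\<lambda>n. d (Suc n) + 1/2 * (1/2 + cnorm A y) * d n) \<longlonglongrightarrow> 0 + 1/2 * (1/2 + cnorm A y) * 0"
    by (intro tendsto_intros d0 LIMSEQ_Suc)
  ultimately have "cdist A y (T y) \<le> 0 + 1/2 * (1/2 + cnorm A y) * 0"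
    by (intro LIMSEQ_le_const) auto
  then have "T y = y" using D.zero[of y "T y"] D.nonneg[of y "T y"] yA T by simp
  then have "2 \<odot>\<^bsub>A\<^esub> y = 2 \<odot>\<^bsub>A\<^esub> ((1/2) \<odot>\<^bsub>A\<^esub> (a \<oplus>\<^bsub>A\<^esub> y \<cdot> y))" by (simp add: T_def)
  then have "2 \<odot>\<^bsub>A\<^esub> y = a \<oplus>\<^bsub>A\<^esub> y \<cdot> y" using a yA by (simp add: scale_scale)
  with yA star show thesis by (rule that)
qed

end

subsection \<open>Positive functionals peaking at a projection\<close>

text \<open>Living on a subset B instead of on a second algebra, it applies directly to states
  pulled back from the image of B.\<close>

locale positive_functional = cstar_algebra A for A :: "'a star_alg" +
  fixes B :: "'a set" and \<phi> :: "'a \<Rightarrow> complex"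
  assumes subalg: "star_subalgebra A B"
    and add: "a \<in> B \<Longrightarrow> b \<in> B \<Longrightarrow> \<phi> (a \<oplus>\<^bsub>A\<^esub> b) = \<phi> a + \<phi> b"
    and scale: "a \<in> B \<Longrightarrow> \<phi> (k \<odot>\<^bsub>A\<^esub> a) = k * \<phi> a"
    and pos: "a \<in> B \<Longrightarrow> \<phi> (star A a \<cdot> a) \<in> \<real>\<^sub>\<ge>\<^sub>0"
begin

lemmas B_simps [simp] = star_subalgebraD[OF subalg]

lemma zero: "\<phi> \<zero>\<^bsub>A\<^esub> = 0"
  using scale[of "\<zero>\<^bsub>A\<^esub>" 0] by simp

lemma quadratic_expand:
  assumes "a \<in> B" "b \<in> B"
  shows "\<phi> (star A (a \<oplus>\<^bsub>A\<^esub> k \<odot>\<^bsub>A\<^esub> b) \<cdot> (a \<oplus>\<^bsub>A\<^esub> k \<odot>\<^bsub>A\<^esub> b)) =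
    \<phi> (star A a \<cdot> a) + k * \<phi> (star A a \<cdot> b) + cnj k * \<phi> (star A b \<cdot> a) +
    cnj k * k * \<phi> (star A b \<cdot> b)"
  using assms
  by (simp add: star_add star_smult mult_l_distr mult_r_distr smult_mult_l smult_mult_r add scale scale_scale
      algebra_simps)

text \<open>Polarisation: the quadratic expansion is real for k = 1 and for k = i, which compares
  the imaginary and the real parts respectively.\<close>

lemma hermitian:
  assumes "a \<in> B" "b \<in> B"
  shows "\<phi> (star A b \<cdot> a) = cnj (\<phi> (star A a \<cdot> b))"
proof -
  have im: "Im (\<phi> (star A c \<cdot> c)) = 0" if "c \<in> B" for c
    using pos[OF that] by (simp add: complex_nonneg_Reals_iff)
  have "Im (\<phi> (star A a \<cdot> b) + \<phi> (star A b \<cdot> a)) = 0"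
    using quadratic_expand[OF assms, of 1] im[of "a \<oplus>\<^bsub>A\<^esub> 1 \<odot>\<^bsub>A\<^esub> b"] im[of a] im[of b] assms by simp
  moreover have "Im (\<i> * \<phi> (star A a \<cdot> b) - \<i> * \<phi> (star A b \<cdot> a)) = 0"
    using quadratic_expand[OF assms, of \<i>] im[of "a \<oplus>\<^bsub>A\<^esub> \<i> \<odot>\<^bsub>A\<^esub> b"] im[of a] im[of b] assms by simp
  ultimately show ?thesis by (simp add: complex_eq_iff)
qed

text \<open>Along a suitable line through a the quadratic form is affine, because its leading term
  vanishes; a nonnegative affine function has no slope.\<close>

lemma null_vector:
  assumes "a \<in> B" "b \<in> B" and b0: "\<phi> (star A b \<cdot> b) = 0"
  shows "\<phi> (star A a \<cdot> b) = 0"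
proof (rule ccontr)
  define c where "c = \<phi> (star A a \<cdot> b)"
  assume "\<phi> (star A a \<cdot> b) \<noteq> 0"
  then have c: "0 < (cmod c)\<^sup>2" by (simp add: c_def)
  define u where "u = Re (\<phi> (star A a \<cdot> a))"
  \<comment> \<open>Chosen so that u - 2 t |c|^2 equals -1.\<close>
  define t where "t = (u + 1) / (2 * (cmod c)\<^sup>2)"
  let ?k = "- complex_of_real t * cnj c"
  have "\<phi> (star A (a \<oplus>\<^bsub>A\<^esub> ?k \<odot>\<^bsub>A\<^esub> b) \<cdot> (a \<oplus>\<^bsub>A\<^esub> ?k \<odot>\<^bsub>A\<^esub> b)) =
      \<phi> (star A a \<cdot> a) - 2 * of_real t * (c * cnj c)"
    unfolding quadratic_expand[OF assms(1,2)] hermitian[OF assms(1,2)] b0 c_def[symmetric]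
    by (simp add: algebra_simps)
  moreover have "a \<oplus>\<^bsub>A\<^esub> ?k \<odot>\<^bsub>A\<^esub> b \<in> B" using assms by simp
  ultimately have "0 \<le> Re (\<phi> (star A a \<cdot> a) - 2 * of_real t * (c * cnj c))"
    using pos by (metis complex_nonneg_Reals_iff)
  then have "0 \<le> u - 2 * t * (cmod c)\<^sup>2"
    by (simp add: u_def complex_mult_cnj cmod_power2 mult.assoc flip: of_real_mult of_real_add of_real_power)
  moreover have "2 * t * (cmod c)\<^sup>2 = u + 1" using c unfolding t_def by (simp add: field_simps)
  ultimately show False by simp
qed

end

text \<open>P acts as a unit under \<phi>. Absorption is assumed on the left only; the right-hand
  version follows from positivity.\<close>

locale peaked_functional = positive_functional +
  fixes P :: 'a
  assumes P_in [simp]: "P \<in> B" and P_star [simp]: "star A P = P" and P_idem [simp]: "P \<cdot> P = P"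
    and P_peak [simp]: "\<phi> P = 1" and P_left: "a \<in> B \<Longrightarrow> \<phi> (P \<cdot> a) = \<phi> a"
begin

lemma null:
  assumes "b \<in> B" "\<phi> (star A b \<cdot> b) = 0"
  shows "\<phi> b = 0"
  using null_vector[of P b] P_left[of b] assms by simp

text \<open>For b = a - aP one has bP = 0, so P annihilates \<open>star A b \<cdot> b\<close> from
  the left. By left absorption \<phi> vanishes there, and b is null.\<close>

lemma P_right:
  assumes "a \<in> B"
  shows "\<phi> (a \<cdot> P) = \<phi> a"
proof -
  define b where "b = a \<oplus>\<^bsub>A\<^esub> (-1) \<odot>\<^bsub>A\<^esub> (a \<cdot> P)"
  have b: "b \<in> B" using assms by (simp add: b_def)
  have bP: "b \<cdot> P = \<zero>\<^bsub>A\<^esub>"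
  proof -
    have "b \<cdot> P = 1 \<odot>\<^bsub>A\<^esub> (a \<cdot> P) \<oplus>\<^bsub>A\<^esub> (-1) \<odot>\<^bsub>A\<^esub> (a \<cdot> P)"
      using assms by (simp add: b_def mult_l_distr smult_mult_l mult_assoc)
    then show ?thesis using scale_add_l[of "a \<cdot> P" 1 "-1"] assms by simp
  qed
  have "P \<cdot> star A b = star A (b \<cdot> P)" using b by (simp add: star_mult)
  then have "P \<cdot> (star A b \<cdot> b) = \<zero>\<^bsub>A\<^esub>"
    using b bP by (simp flip: mult_assoc)
  then have "\<phi> (star A b \<cdot> b) = 0" using P_left[of "star A b \<cdot> b"] b zero by simp
  from null[OF b this] show ?thesis using assms by (simp add: b_def add scale)
qed

lemma functional_star: "a \<in> B \<Longrightarrow> \<phi> (star A a) = cnj (\<phi> a)"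
  using hermitian[of P a] P_left[of a] P_right[of "star A a"] by simp

text \<open>Completing the square: a - \<phi>(a) P is the component of a orthogonal to P, which has
  length one for the form of \<phi>.\<close>

lemma Cauchy_Schwarz:
  assumes "a \<in> B"
  shows "(cmod (\<phi> a))\<^sup>2 \<le> Re (\<phi> (star A a \<cdot> a))"
proof -
  let ?k = "- \<phi> a"
  have "\<phi> (star A (a \<oplus>\<^bsub>A\<^esub> ?k \<odot>\<^bsub>A\<^esub> P) \<cdot> (a \<oplus>\<^bsub>A\<^esub> ?k \<odot>\<^bsub>A\<^esub> P)) =
      \<phi> (star A a \<cdot> a) - \<phi> a * cnj (\<phi> a)"
    unfolding quadratic_expand[OF assms P_in] using assms
    by (simp add: P_left P_right functional_star algebra_simps)
  moreover have "a \<oplus>\<^bsub>A\<^esub> ?k \<odot>\<^bsub>A\<^esub> P \<in> B" using assms by simp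
  ultimately have "0 \<le> Re (\<phi> (star A a \<cdot> a) - \<phi> a * cnj (\<phi> a))"
    using pos by (metis complex_nonneg_Reals_iff)
  then show ?thesis by (simp add: complex_mult_cnj cmod_power2)
qed

text \<open>Absorption by P gives \<phi>(PQ) = \<phi>(QP) = 1, so P - Q is a null vector. The peak
  can therefore be moved to any projection of value 1, in particular along the prefixes of an
  infinite path.\<close>

lemma peaked_at:
  assumes Q: "Q \<in> B" "star A Q = Q" "Q \<cdot> Q = Q" "\<phi> Q = 1"
  shows "peaked_functional A B \<phi> Q"
proof unfold_locales
  fix a assume a: "a \<in> B"
  define b where "b = P \<oplus>\<^bsub>A\<^esub> (-1) \<odot>\<^bsub>A\<^esub> Q"
  have b: "b \<in> B" "star A b = b" using Q by (simp_all add: b_def star_add star_smult)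
  have "\<phi> (star A b \<cdot> b) = 0"
    unfolding b_def quadratic_expand[OF P_in Q(1)] using Q by (simp add: P_left P_right)
  then have "\<phi> (star A b \<cdot> a) = 0"
    using null_vector[OF a b(1)] hermitian[OF a b(1)] by simp
  then show "\<phi> (Q \<cdot> a) = \<phi> a"
    using a Q b(2) P_left[OF a] by (simp add: b_def mult_l_distr smult_mult_l add scale)
qed (use Q in auto)

text \<open>Since \<open>\<phi> (b\<^sup>* a b) \<le> \<phi> (b\<^sup>* b)\<close> for self-adjoint \<open>a\<close> of norm at most \<open>1/2\<close>
  (write \<open>1 - a\<close> as a square), continuity is automatic.\<close>

lemma bounded:
  assumes B: "B = carrier A" and a: "a \<in> carrier A"
  shows "cmod (\<phi> a) \<le> 2 * cnorm A a"
proof -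
  have le1: "Re (\<phi> h) \<le> 1" if h: "h \<in> carrier A" "star A h = h" "cnorm A h \<le> 1 / 2" for h
  proof -
    obtain y where y: "y \<in> carrier A" "star A y = y" "2 \<odot>\<^bsub>A\<^esub> y = h \<oplus>\<^bsub>A\<^esub> y \<cdot> y"
      using square_root[OF h] .
    have "2 * \<phi> y = \<phi> h + \<phi> (y \<cdot> y)"
      using scale[of y 2] y h add[of h "y \<cdot> y"] by (simp add: B)
    \<comment> \<open>The stand-in for 1 - y: since P is absorbed on both sides, \<phi> of its
      square is 1 - 2 \<phi>(y) + \<phi>(y y), that is, 1 - \<phi>(h).\<close>
    moreover define b where "b = P \<oplus>\<^bsub>A\<^esub> (-1) \<odot>\<^bsub>A\<^esub> (y \<cdot> P)"
    have yP: "y \<cdot> P \<in> B" "b \<in> B" using y P_in by (simp_all add: B b_def)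
    have "star A (y \<cdot> P) \<cdot> (y \<cdot> P) = P \<cdot> ((y \<cdot> y) \<cdot> P)"
      using y P_in by (simp add: B star_mult mult_assoc)
    then have "\<phi> (star A (y \<cdot> P) \<cdot> (y \<cdot> P)) = \<phi> (y \<cdot> y)"
      using y P_in by (simp add: B P_left P_right)
    moreover have "\<phi> (star A P \<cdot> (y \<cdot> P)) = \<phi> y" "\<phi> (star A (y \<cdot> P) \<cdot> P) = \<phi> y"
      using y P_in by (simp_all add: B P_left P_right star_mult)
    ultimately have "\<phi> (star A b \<cdot> b) = 1 - \<phi> h"
      unfolding b_def quadratic_expand[OF P_in yP(1)] by (simp add: algebra_simps)
    then show ?thesis using pos[OF yP(2)] by (simp add: complex_nonneg_Reals_iff)
  qed
  have sa: "Re (\<phi> h) \<le> 2 * cnorm A h" if h: "h \<in> carrier A" "star A h = h" for h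
  proof (cases "cnorm A h = 0")
    case True
    then show ?thesis using h norm_eq_0[of h] zero by auto
  next
    case False
    then have n: "0 < cnorm A h" using norm_nonneg[OF h(1)] by simp
    \<comment> \<open>Rescaling to norm 1/2, where square roots are available; this is the origin of
      the factor 2.\<close>
    let ?k = "complex_of_real (1 / (2 * cnorm A h))"
    have "Re (?k * \<phi> h) = 1 / (2 * cnorm A h) * Re (\<phi> h)"
      by (simp only: times_complex.sel Re_complex_of_real Im_complex_of_real)
    moreover have "\<phi> (?k \<odot>\<^bsub>A\<^esub> h) = ?k * \<phi> h" by (rule scale) (simp add: B h)
    moreover have "Re (\<phi> (?k \<odot>\<^bsub>A\<^esub> h)) \<le> 1"
      by (rule le1) (use h n in \<open>auto simp: star_smult norm_smult norm_divide\<close>)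
    ultimately have "1 / (2 * cnorm A h) * Re (\<phi> h) \<le> 1" by simp
    then show ?thesis using n by (simp add: field_simps)
  qed
  have "(cmod (\<phi> a))\<^sup>2 \<le> 2 * (cnorm A a)\<^sup>2"
    using Cauchy_Schwarz[of a] sa[of "star A a \<cdot> a"] a cstar_identity[OF a]
    by (simp add: B star_mult)
  also have "\<dots> \<le> (2 * cnorm A a)\<^sup>2" by (simp add: power_mult_distrib)
  finally show ?thesis by (rule power2_le_imp_le) (use norm_nonneg[OF a] in simp)
qed

lemma bounded_diff:
  assumes B: "B = carrier A" and ab: "a \<in> carrier A" "b \<in> carrier A"
  shows "cmod (\<phi> a - \<phi> b) \<le> 2 * cdist A a b"
  using bounded[OF B, of "a \<ominus>\<^bsub>A\<^esub> b"] ab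
  by (simp add: cdist_def) (simp add: minus_scale add scale B)

end

section \<open>Cuntz--Krieger algebras\<close>

context cstar_algebra
begin

lemma finsum_mult_l:
  assumes "finite I" "c \<in> carrier A" "f \<in> I \<rightarrow> carrier A"
  shows "c \<cdot> (\<Oplus>\<^bsub>A\<^esub>i\<in>I. f i) = (\<Oplus>\<^bsub>A\<^esub>i\<in>I. c \<cdot> f i)"
  using assms(1,3)
proof induction
  case (insert i I)
  then show ?case using assms(2) by (simp add: M.finsum_insert mult_r_distr Pi_def)
qed (simp add: assms(2))

lemma finsum_mult_r:
  assumes "finite I" "c \<in> carrier A" "f \<in> I \<rightarrow> carrier A"
  shows "(\<Oplus>\<^bsub>A\<^esub>i\<in>I. f i) \<cdot> c = (\<Oplus>\<^bsub>A\<^esub>i\<in>I. f i \<cdot> c)"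
  using assms(1,3)
proof induction
  case (insert i I)
  then show ?case using assms(2) by (simp add: M.finsum_insert mult_l_distr Pi_def)
qed (simp add: assms(2))

lemma finsum_in:
  assumes "finite I" "V \<subseteq> carrier A" "\<zero>\<^bsub>A\<^esub> \<in> V" "\<And>i. i \<in> I \<Longrightarrow> f i \<in> V"
    and "\<And>a b. a \<in> V \<Longrightarrow> b \<in> V \<Longrightarrow> a \<oplus>\<^bsub>A\<^esub> b \<in> V"
  shows "(\<Oplus>\<^bsub>A\<^esub>i\<in>I. f i) \<in> V"
  using assms(1,4)
proof (induction rule: finite_induct)
  case (insert i I)
  then have "f \<in> I \<rightarrow> carrier A" "f i \<in> carrier A" using assms(2) by auto
  then show ?case using insert assms(5) by (simp add: M.finsum_insert)
qed (simp add: assms(3))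

end

locale Cuntz_Krieger_algebra = higher_rank_graph G + cstar_algebra A
  for G :: "('p, 'k::finite) kgraph" and A :: "'a star_alg" +
  fixes S :: "'p \<Rightarrow> 'a"
  assumes CK: "CK_family G A S" and generated: "cstar_generated A (S ` paths G) = carrier A"
    and row_finite: "row_finite G" and no_sources: "no_sources G"
begin

section \<open>The Cuntz-Krieger relations\<close>

lemma S_in [simp]: "\<mu> \<in> paths G \<Longrightarrow> S \<mu> \<in> carrier A"
  using CK by (simp add: CK_family_def)

lemma S_partial_isometry: "\<mu> \<in> paths G \<Longrightarrow> S \<mu> \<cdot> star A (S \<mu>) \<cdot> S \<mu> = S \<mu>"
  using CK by (simp add: CK_family_def)

lemma S_comp:
  "\<lbrakk>\<mu> \<in> paths G; \<nu> \<in> paths G; src G \<mu> = rng G \<nu>\<rbrakk> \<Longrightarrow> S (pcomp G \<mu> \<nu>) = S \<mu> \<cdot> S \<nu>"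
  using CK by (simp add: CK_family_def)

lemma CK1_raw:
  assumes "\<mu> \<in> paths G" "\<nu> \<in> paths G" "deg G \<mu> = deg G \<nu>"
  shows "star A (S \<mu>) \<cdot> S \<nu> =
    (if \<mu> = \<nu> then S (src G \<mu>) \<cdot> star A (S (src G \<mu>)) else \<zero>\<^bsub>A\<^esub>)"
  using CK[unfolded CK_family_def, THEN conjunct2, THEN conjunct2, THEN conjunct1, rule_format, of \<mu> "deg G \<nu>" \<nu>]
    assms by (simp add: paths_deg_def)

lemma CK2_raw:
  assumes "v \<in> vertices G"
  shows "star A (S v) \<cdot> S v =
    (\<Oplus>\<^bsub>A\<^esub>\<kappa>\<in>paths_from G v \<inter> paths_deg G n. S \<kappa> \<cdot> star A (S \<kappa>))"
  using CK[unfolded CK_family_def, THEN conjunct2, THEN conjunct2, THEN conjunct2, rule_format, OF assms, of n] .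

text \<open>Functoriality gives only an idempotent. CK1 makes it normal, and the partial isometry
  identity then turns \<open>S v\<close> into \<open>S v \<cdot> star A (S v)\<close>, which is
  self-adjoint.\<close>

lemma S_vertex:
  assumes "v \<in> paths G" "deg G v = 0"
  shows "S v \<cdot> S v = S v" "star A (S v) = S v"
proof -
  have v: "rng G v = v" "src G v = v" "pcomp G v v = v"
    using assms deg_0_rng deg_0_src comp_rng[of v] by auto
  show idem: "S v \<cdot> S v = S v" using S_comp[of v v] assms v by simp
  have normal: "star A (S v) \<cdot> S v = S v \<cdot> star A (S v)" using CK1_raw[of v v] assms v by simp
  have "S v = S v \<cdot> (star A (S v) \<cdot> S v)"
    using S_partial_isometry[of v] assms by (simp add: mult_assoc)
  also have "\<dots> = (S v \<cdot> S v) \<cdot> star A (S v)" using assms by (simp add: normal mult_assoc)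
  finally have "S v = S v \<cdot> star A (S v)" by (simp add: idem)
  moreover have "star A (S v \<cdot> star A (S v)) = S v \<cdot> star A (S v)"
    using assms by (simp add: star_mult)
  ultimately show "star A (S v) = S v" by simp
qed

lemma CK1:
  assumes "\<mu> \<in> paths G" "\<nu> \<in> paths G" "deg G \<mu> = deg G \<nu>"
  shows "star A (S \<mu>) \<cdot> S \<nu> = (if \<mu> = \<nu> then S (src G \<mu>) else \<zero>\<^bsub>A\<^esub>)"
  using CK1_raw[OF assms] S_vertex[OF src_in deg_src, OF assms(1,1)] by auto

lemma
  assumes "\<mu> \<in> paths G"
  shows S_src: "S \<mu> \<cdot> S (src G \<mu>) = S \<mu>" and S_rng: "S (rng G \<mu>) \<cdot> S \<mu> = S \<mu>"
proof -
  show "S \<mu> \<cdot> S (src G \<mu>) = S \<mu>"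
    using S_comp[of \<mu> "src G \<mu>"] assms by (simp add: src_in rng_src comp_src)
  show "S (rng G \<mu>) \<cdot> S \<mu> = S \<mu>"
    using S_comp[of "rng G \<mu>" \<mu>] assms by (simp add: rng_in src_rng comp_rng)
qed

lemma S_comp_star:
  assumes "\<mu> \<in> paths G" "\<nu> \<in> paths G" "src G \<mu> = rng G \<nu>"
  shows "star A (S (pcomp G \<mu> \<nu>)) = star A (S \<nu>) \<cdot> star A (S \<mu>)"
    and "star A (S (pcomp G \<mu> \<nu>)) \<cdot> S \<mu> = star A (S \<nu>)"
proof -
  show 1: "star A (S (pcomp G \<mu> \<nu>)) = star A (S \<nu>) \<cdot> star A (S \<mu>)"
    using assms by (simp add: S_comp star_mult)
  have "star A (S \<nu>) \<cdot> S (src G \<mu>) = star A (S (src G \<mu>) \<cdot> S \<nu>)"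
    using S_vertex(2)[OF src_in deg_src, OF assms(1,1)] star_mult[of "S (src G \<mu>)" "S \<nu>"] assms(1,2)
    by (simp add: src_in)
  also have "\<dots> = star A (S \<nu>)" using S_rng[of \<nu>] assms by simp
  finally show "star A (S (pcomp G \<mu> \<nu>)) \<cdot> S \<mu> = star A (S \<nu>)"
    using assms by (simp add: 1 mult_assoc CK1)
qed

section \<open>Range projections and cylinders\<close>

abbreviation proj :: "'p \<Rightarrow> 'a" where "proj \<equiv> range_proj A S"

lemma
  assumes "\<mu> \<in> paths G"
  shows proj_in [simp]: "proj \<mu> \<in> carrier A" and proj_star [simp]: "star A (proj \<mu>) = proj \<mu>"
    and proj_idem [simp]: "proj \<mu> \<cdot> proj \<mu> = proj \<mu>"
proof -
  show "proj \<mu> \<in> carrier A" "star A (proj \<mu>) = proj \<mu>"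
    using assms by (simp_all add: range_proj_def star_mult)
  have "proj \<mu> \<cdot> proj \<mu> = (S \<mu> \<cdot> star A (S \<mu>) \<cdot> S \<mu>) \<cdot> star A (S \<mu>)"
    using assms by (simp add: range_proj_def mult_assoc)
  then show "proj \<mu> \<cdot> proj \<mu> = proj \<mu>"
    using assms by (simp add: S_partial_isometry) (simp add: range_proj_def)
qed

lemma proj_mult_S:
  assumes "\<alpha> \<in> paths G" "\<gamma> \<in> paths G" "src G \<alpha> = rng G \<gamma>"
  shows "proj (pcomp G \<alpha> \<gamma>) \<cdot> S \<alpha> = S (pcomp G \<alpha> \<gamma>) \<cdot> star A (S \<gamma>)"
  using assms S_comp_star(2)[OF assms] by (simp add: range_proj_def mult_assoc comp_in)

lemma S_star_mult_proj:
  assumes "\<alpha> \<in> paths G" "\<gamma> \<in> paths G" "src G \<alpha> = rng G \<gamma>"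
  shows "star A (S \<alpha>) \<cdot> proj (pcomp G \<alpha> \<gamma>) = S \<gamma> \<cdot> star A (S (pcomp G \<alpha> \<gamma>))"
proof -
  have "star A (S \<alpha>) \<cdot> proj (pcomp G \<alpha> \<gamma>) = star A (proj (pcomp G \<alpha> \<gamma>) \<cdot> S \<alpha>)"
    using assms by (simp add: star_mult comp_in)
  then show ?thesis using assms by (simp add: proj_mult_S star_mult comp_in)
qed

lemma proj_mult_S_neq:
  assumes "\<mu> \<in> paths G" "\<alpha> \<in> paths G" "deg G \<mu> = deg G \<alpha>" "\<mu> \<noteq> \<alpha>"
  shows "proj \<mu> \<cdot> S \<alpha> = \<zero>\<^bsub>A\<^esub>" "star A (S \<alpha>) \<cdot> proj \<mu> = \<zero>\<^bsub>A\<^esub>"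
proof -
  show 1: "proj \<mu> \<cdot> S \<alpha> = \<zero>\<^bsub>A\<^esub>"
    using assms CK1[of \<mu> \<alpha>] by (simp add: range_proj_def mult_assoc)
  have "star A (S \<alpha>) \<cdot> proj \<mu> = star A (proj \<mu> \<cdot> S \<alpha>)" using assms by (simp add: star_mult)
  then show "star A (S \<alpha>) \<cdot> proj \<mu> = \<zero>\<^bsub>A\<^esub>" by (simp add: 1)
qed

lemma proj_comp_le:
  assumes "\<nu> \<in> paths G" "\<xi> \<in> paths G" "src G \<nu> = rng G \<xi>"
  shows "proj (pcomp G \<nu> \<xi>) \<cdot> proj \<nu> = proj (pcomp G \<nu> \<xi>)"
proof -
  have "proj (pcomp G \<nu> \<xi>) \<cdot> proj \<nu> = (proj (pcomp G \<nu> \<xi>) \<cdot> S \<nu>) \<cdot> star A (S \<nu>)"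
    using assms by (simp add: range_proj_def mult_assoc comp_in)
  also have "\<dots> = S (pcomp G \<nu> \<xi>) \<cdot> star A (S (pcomp G \<nu> \<xi>))"
    using assms by (simp add: proj_mult_S mult_assoc comp_in S_comp_star(1))
  finally show ?thesis by (simp add: range_proj_def)
qed

lemma
  assumes "\<mu> \<in> paths G"
  shows finite_extensions: "finite (paths_from G (src G \<mu>) \<inter> paths_deg G n)"
    and CK2: "S (src G \<mu>) = (\<Oplus>\<^bsub>A\<^esub>\<zeta>\<in>paths_from G (src G \<mu>) \<inter> paths_deg G n. proj \<zeta>)"
proof -
  show "finite (paths_from G (src G \<mu>) \<inter> paths_deg G n)"
    using row_finite src_vertex[OF assms] by (simp add: row_finite_def)
  have "star A (S (src G \<mu>)) \<cdot> S (src G \<mu>) = S (src G \<mu>)"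
    using S_vertex[of "src G \<mu>"] assms by (simp add: src_in deg_src)
  then show "S (src G \<mu>) = (\<Oplus>\<^bsub>A\<^esub>\<zeta>\<in>paths_from G (src G \<mu>) \<inter> paths_deg G n. proj \<zeta>)"
    using CK2_raw[OF src_vertex[OF assms], of n] by (simp add: range_proj_def)
qed

lemma extensionD:
  assumes "\<zeta> \<in> paths_from G v \<inter> paths_deg G n"
  shows "\<zeta> \<in> paths G" "rng G \<zeta> = v" "deg G \<zeta> = n"
  using assms by (auto simp: paths_from_def paths_deg_def)

text \<open>Inserting CK2 at the source replaces \<mu> by its extensions of a chosen degree, so that
  paths of different degrees can be compared by CK1.\<close>

lemma refine_at_source:
  assumes \<mu>: "\<mu> \<in> paths G" and b: "b \<in> carrier A"
  shows "S \<mu> \<cdot> b =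
    (\<Oplus>\<^bsub>A\<^esub>\<zeta>\<in>paths_from G (src G \<mu>) \<inter> paths_deg G n. S (pcomp G \<mu> \<zeta>) \<cdot> star A (S \<zeta>) \<cdot> b)"
proof -
  let ?I = "paths_from G (src G \<mu>) \<inter> paths_deg G n"
  have fin: "finite ?I" using \<mu> by (rule finite_extensions)
  have pI: "proj \<in> ?I \<rightarrow> carrier A" using extensionD by auto
  have "S \<mu> \<cdot> b = (S \<mu> \<cdot> (\<Oplus>\<^bsub>A\<^esub>\<zeta>\<in>?I. proj \<zeta>)) \<cdot> b"
    using S_src[OF \<mu>] CK2[OF \<mu>, of n] by simp
  also have "\<dots> = (\<Oplus>\<^bsub>A\<^esub>\<zeta>\<in>?I. (S \<mu> \<cdot> proj \<zeta>) \<cdot> b)"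
    using fin pI \<mu> b by (subst finsum_mult_l) (auto intro!: finsum_mult_r simp: Pi_iff)
  also have "\<dots> = (\<Oplus>\<^bsub>A\<^esub>\<zeta>\<in>?I. S (pcomp G \<mu> \<zeta>) \<cdot> star A (S \<zeta>) \<cdot> b)"
  proof (rule M.finsum_cong'[OF refl])
    show "(\<lambda>\<zeta>. S (pcomp G \<mu> \<zeta>) \<cdot> star A (S \<zeta>) \<cdot> b) \<in> ?I \<rightarrow> carrier A"
      using \<mu> b extensionD by (auto simp: comp_in)
    show "S \<mu> \<cdot> proj \<zeta> \<cdot> b = S (pcomp G \<mu> \<zeta>) \<cdot> star A (S \<zeta>) \<cdot> b" if "\<zeta> \<in> ?I" for \<zeta>
      using extensionD[OF that] \<mu> by (simp add: S_comp range_proj_def mult_assoc)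
  qed
  finally show ?thesis .
qed

text \<open>Extending \<mu> by all \<zeta> of degree \<open>deg G \<nu>\<close> makes every
  \<mu>\<zeta> long enough to have a prefix of that degree. The prefix must be \<nu>, so each
  summand lies below \<open>proj \<nu>\<close>.\<close>

lemma proj_le_of_cylinder:
  assumes \<mu>: "\<mu> \<in> paths G" and \<nu>: "\<nu> \<in> paths G" and sub: "cylinder G \<mu> \<subseteq> cylinder G \<nu>"
  shows "proj \<mu> \<cdot> proj \<nu> = proj \<mu>"
proof -
  let ?I = "paths_from G (src G \<mu>) \<inter> paths_deg G (deg G \<nu>)"
  have term_eq: "S (pcomp G \<mu> \<zeta>) \<cdot> star A (S \<zeta>) \<cdot> star A (S \<mu>) = proj (pcomp G \<mu> \<zeta>)"
    if "\<zeta> \<in> ?I" for \<zeta>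
    using extensionD[OF that] \<mu> by (simp add: range_proj_def S_comp_star(1) mult_assoc comp_in)
  have cI: "(\<lambda>\<zeta>. proj (pcomp G \<mu> \<zeta>)) \<in> ?I \<rightarrow> carrier A"
  proof
    fix \<zeta> assume "\<zeta> \<in> ?I"
    from extensionD[OF this] show "proj (pcomp G \<mu> \<zeta>) \<in> carrier A" using \<mu> by (simp add: comp_in)
  qed
  have "proj \<mu> = (\<Oplus>\<^bsub>A\<^esub>\<zeta>\<in>?I. S (pcomp G \<mu> \<zeta>) \<cdot> star A (S \<zeta>) \<cdot> star A (S \<mu>))"
    unfolding range_proj_def using \<mu> by (intro refine_at_source) simp_all
  also have "\<dots> = (\<Oplus>\<^bsub>A\<^esub>\<zeta>\<in>?I. proj (pcomp G \<mu> \<zeta>))"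
    using cI term_eq by (rule M.finsum_cong'[OF refl])
  finally have sum: "proj \<mu> = (\<Oplus>\<^bsub>A\<^esub>\<zeta>\<in>?I. proj (pcomp G \<mu> \<zeta>))" .
  have le: "proj (pcomp G \<mu> \<zeta>) \<cdot> proj \<nu> = proj (pcomp G \<mu> \<zeta>)" if \<zeta>: "\<zeta> \<in> ?I" for \<zeta>
  proof -
    note \<zeta>D = extensionD[OF \<zeta>]
    have in1: "pcomp G \<mu> \<zeta> \<in> paths G" "deg G (pcomp G \<mu> \<zeta>) = deg G \<mu> + deg G \<nu>"
      using \<mu> \<zeta>D by (simp_all add: comp_in deg_comp)
    \<comment> \<open>The inclusion of cylinders says something about finite paths only through an
      actual infinite path; cutting y at \<open>deg G \<nu>\<close> exhibits \<nu> as a prefix of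
      \<mu>\<zeta>.\<close>
    obtain y where y: "y \<in> cylinder G (pcomp G \<mu> \<zeta>)"
      using cylinder_nonempty[OF no_sources in1(1)] by blast
    then have "y \<in> cylinder G \<mu>" using cylinder_iff[of \<mu> \<zeta> y] \<mu> \<zeta>D by simp
    then have y\<nu>: "y \<in> inf_paths G" "y 0 (deg G \<nu>) = \<nu>" using sub by (auto simp: cylinder_def)
    have split: "deg G \<nu> \<le> deg G \<mu> + deg G \<nu>" by (simp add: vec_le_add)
    define \<xi> where "\<xi> = y (deg G \<nu>) (deg G \<mu> + deg G \<nu>)"
    have "pcomp G \<mu> \<zeta> = pcomp G \<nu> \<xi>" "src G \<nu> = rng G \<xi>" "\<xi> \<in> paths G"
      using ipath_comp[OF y\<nu>(1) vec_le_add(3) split] y y\<nu> in1(2) ipathD[OF y\<nu>(1) split]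
      by (auto simp: \<xi>_def cylinder_def)
    then show ?thesis using proj_comp_le[of \<nu> \<xi>] \<nu> by simp
  qed
  have "proj \<mu> \<cdot> proj \<nu> = (\<Oplus>\<^bsub>A\<^esub>\<zeta>\<in>?I. proj (pcomp G \<mu> \<zeta>) \<cdot> proj \<nu>)"
    unfolding sum by (rule finsum_mult_r[OF finite_extensions[OF \<mu>] proj_in[OF \<nu>] cI])
  also have "\<dots> = proj \<mu>"
    unfolding sum using cI le by (rule M.finsum_cong'[OF refl])
  finally show ?thesis .
qed

text \<open>Two projections below one another coincide, by taking adjoints. This is how topological
  information about paths yields cycline pairs.\<close>

lemma proj_eq_of_cylinder:
  assumes "\<mu> \<in> paths G" "\<nu> \<in> paths G" "cylinder G \<mu> = cylinder G \<nu>"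
  shows "proj \<mu> = proj \<nu>"
proof -
  have "proj \<nu> = star A (proj \<nu> \<cdot> proj \<mu>)" using proj_le_of_cylinder[of \<nu> \<mu>] assms by simp
  also have "\<dots> = proj \<mu> \<cdot> proj \<nu>" using assms by (simp add: star_mult)
  also have "\<dots> = proj \<mu>" using proj_le_of_cylinder[of \<mu> \<nu>] assms by simp
  finally show ?thesis ..
qed

subsection \<open>The dense span of the \<open>S\<^sub>\<alpha> S\<^sub>\<beta>\<^sup>*\<close>\<close>

inductive_set monomial_span :: "'a set" where
  zero: "\<zero>\<^bsub>A\<^esub> \<in> monomial_span"
| monomial: "\<lbrakk>\<alpha> \<in> paths G; \<beta> \<in> paths G; src G \<alpha> = src G \<beta>\<rbrakk> \<Longrightarrow>
    S \<alpha> \<cdot> star A (S \<beta>) \<in> monomial_span"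
| add: "\<lbrakk>a \<in> monomial_span; b \<in> monomial_span\<rbrakk> \<Longrightarrow> a \<oplus>\<^bsub>A\<^esub> b \<in> monomial_span"
| scale: "a \<in> monomial_span \<Longrightarrow> k \<odot>\<^bsub>A\<^esub> a \<in> monomial_span"

lemma monomial_span_carrier: "a \<in> monomial_span \<Longrightarrow> a \<in> carrier A"
  by (induction rule: monomial_span.induct) auto

text \<open>After extending \<gamma> by degree \<open>deg G \<beta>\<close>, each extension splits
  as \<beta>'\<eta> with \<beta>' of the degree of \<beta>; CK1 leaves a single monomial if \<beta>'
  = \<beta> and zero otherwise.\<close>

lemma monomial_mult:
  assumes p: "\<alpha> \<in> paths G" "\<beta> \<in> paths G" "\<gamma> \<in> paths G" "\<delta> \<in> paths G"
    and s: "src G \<alpha> = src G \<beta>" "src G \<gamma> = src G \<delta>"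
  shows "S \<alpha> \<cdot> star A (S \<beta>) \<cdot> (S \<gamma> \<cdot> star A (S \<delta>)) \<in> monomial_span"
proof -
  let ?I = "paths_from G (src G \<gamma>) \<inter> paths_deg G (deg G \<beta>)"
  let ?t = "\<lambda>\<zeta>. S (pcomp G \<gamma> \<zeta>) \<cdot> star A (S \<zeta>) \<cdot> star A (S \<delta>)"
  have "S \<alpha> \<cdot> star A (S \<beta>) \<cdot> (S \<gamma> \<cdot> star A (S \<delta>)) =
      (\<Oplus>\<^bsub>A\<^esub>\<zeta>\<in>?I. S \<alpha> \<cdot> star A (S \<beta>) \<cdot> ?t \<zeta>)"
    unfolding refine_at_source[OF p(3) star_closed[OF S_in[OF p(4)]], of "deg G \<beta>"]
    using p extensionD finite_extensions[OF p(3)] by (intro finsum_mult_l) (auto simp: comp_in)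
  also have "\<dots> \<in> monomial_span"
  proof (rule finsum_in[OF finite_extensions[OF p(3)]])
    fix \<zeta> assume "\<zeta> \<in> ?I"
    note \<zeta> = extensionD[OF this]
    have gz: "pcomp G \<gamma> \<zeta> \<in> paths G" "deg G (pcomp G \<gamma> \<zeta>) = deg G \<beta> + deg G \<gamma>"
      "src G (pcomp G \<gamma> \<zeta>) = src G \<zeta>"
      using p \<zeta> by (simp_all add: comp_in deg_comp src_comp add.commute)
    obtain \<beta>' \<eta> where f: "\<beta>' \<in> paths G" "\<eta> \<in> paths G" "src G \<beta>' = rng G \<eta>"
      "pcomp G \<gamma> \<zeta> = pcomp G \<beta>' \<eta>" "deg G \<beta>' = deg G \<beta>"
      using factor[OF gz(1,2)] by metis
    have t: "?t \<zeta> = S \<beta>' \<cdot> (S \<eta> \<cdot> star A (S (pcomp G \<delta> \<zeta>)))"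
      using p \<zeta> s f by (simp add: f(4) S_comp star_mult mult_assoc)
    have dz: "pcomp G \<delta> \<zeta> \<in> paths G" "src G (pcomp G \<delta> \<zeta>) = src G \<zeta>"
      using p \<zeta> s by (simp_all add: comp_in src_comp)
    have "S \<alpha> \<cdot> star A (S \<beta>) \<cdot> ?t \<zeta> =
        S \<alpha> \<cdot> ((star A (S \<beta>) \<cdot> S \<beta>') \<cdot> (S \<eta> \<cdot> star A (S (pcomp G \<delta> \<zeta>))))"
      unfolding t using p f(1,2) dz by (simp add: mult_assoc)
    also have "\<dots> \<in> monomial_span"
    proof (cases "\<beta> = \<beta>'")
      case True
      have "S \<alpha> \<cdot> ((star A (S \<beta>) \<cdot> S \<beta>') \<cdot> (S \<eta> \<cdot> star A (S (pcomp G \<delta> \<zeta>)))) =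
          S \<alpha> \<cdot> ((S (rng G \<eta>) \<cdot> S \<eta>) \<cdot> star A (S (pcomp G \<delta> \<zeta>)))"
        using True p f dz by (simp add: CK1 mult_assoc rng_in)
      also have "\<dots> = S (pcomp G \<alpha> \<eta>) \<cdot> star A (S (pcomp G \<delta> \<zeta>))"
        using True p s f dz by (simp add: S_rng S_comp mult_assoc)
      also have "\<dots> \<in> monomial_span"
        using True p s f dz gz(3) src_comp[OF f(1-3)] by (intro monomial_span.monomial) (simp_all add: comp_in src_comp)
      finally show ?thesis .
    next
      case False
      then show ?thesis using p f dz by (simp add: CK1 monomial_span.zero)
    qed
    finally show "S \<alpha> \<cdot> star A (S \<beta>) \<cdot> ?t \<zeta> \<in> monomial_span" .
  qed (auto intro: monomial_span.intros monomial_span_carrier)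
  finally show ?thesis .
qed

lemma star_subalgebra_monomial_span: "star_subalgebra A monomial_span"
  unfolding star_subalgebra_def
proof (intro conjI ballI allI)
  show "star A a \<in> monomial_span" if "a \<in> monomial_span" for a
    using that
  proof induction
    case (monomial \<alpha> \<beta>)
    then show ?case using monomial_span.monomial[of \<beta> \<alpha>] by (simp add: star_mult)
  qed (auto simp: star_add star_smult monomial_span_carrier intro: monomial_span.intros)
  show "a \<cdot> b \<in> monomial_span" if "a \<in> monomial_span" "b \<in> monomial_span" for a b
    using that(1)
  proof induction
    case (monomial \<alpha> \<beta>)
    note ab = this
    show ?case using that(2)
    proof induction
      case (monomial \<gamma> \<delta>)
      then show ?case using monomial_mult ab by blast
    qed (use ab in \<open>auto simp: mult_r_distr smult_mult_r monomial_span_carrier intro: monomial_span.intros\<close>)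
  qed (use that(2) in \<open>auto simp: mult_l_distr smult_mult_l monomial_span_carrier intro: monomial_span.intros\<close>)
qed (auto intro: monomial_span.intros monomial_span_carrier)

text \<open>Each generator is itself a monomial, namely with its source vertex as second path; so
  the closure of the span contains everything generated.\<close>

lemma monomial_span_dense:
  assumes "a \<in> carrier A" "0 < e"
  shows "\<exists>v\<in>monomial_span. cdist A a v < e"
proof -
  let ?C = "{a \<in> carrier A. \<forall>e>0. \<exists>v\<in>monomial_span. cdist A a v < e}"
  have "S \<kappa> \<in> monomial_span" if "\<kappa> \<in> paths G" for \<kappa>
    using monomial_span.monomial[of \<kappa> "src G \<kappa>"] that
    by (simp add: src_in src_src S_vertex deg_src S_src)
  then have "S ` paths G \<subseteq> ?C" using subset_closure[OF star_subalgebra_monomial_span] by blast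
  moreover have "cstar_subalgebra A ?C" by (rule cstar_subalgebra_closure[OF star_subalgebra_monomial_span])
  ultimately have "cstar_generated A (S ` paths G) \<subseteq> ?C" unfolding cstar_generated_def by blast
  then show ?thesis using assms generated by blast
qed

lemma functionals_eqI:
  assumes \<phi>: "peaked_functional A (carrier A) \<phi> P" and \<psi>: "peaked_functional A (carrier A) \<psi> Q"
    and eq: "\<And>\<alpha> \<beta>. \<lbrakk>\<alpha> \<in> paths G; \<beta> \<in> paths G; src G \<alpha> = src G \<beta>\<rbrakk> \<Longrightarrow>
      \<phi> (S \<alpha> \<cdot> star A (S \<beta>)) = \<psi> (S \<alpha> \<cdot> star A (S \<beta>))"
    and a: "a \<in> carrier A"
  shows "\<phi> a = \<psi> a"
proof -
  interpret \<phi>: peaked_functional A "carrier A" \<phi> P by (rule \<phi>)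
  interpret \<psi>: peaked_functional A "carrier A" \<psi> Q by (rule \<psi>)
  have span: "\<phi> v = \<psi> v" if "v \<in> monomial_span" for v
    using that by induction (auto simp: \<phi>.zero \<psi>.zero \<phi>.add \<psi>.add \<phi>.scale \<psi>.scale eq monomial_span_carrier)
  have "cmod (\<phi> a - \<psi> a) \<le> e" if e: "0 < e" for e
  proof -
    \<comment> \<open>Each of the two functionals changes by at most twice the distance, hence e /
      4.\<close>
    obtain v where v: "v \<in> monomial_span" "cdist A a v < e / 4"
      using monomial_span_dense[OF a, of "e / 4"] e by auto
    have "\<phi> a - \<psi> a = (\<phi> a - \<phi> v) - (\<psi> a - \<psi> v)" using span[OF v(1)] by simp
    also have "cmod \<dots> \<le> cmod (\<phi> a - \<phi> v) + cmod (\<psi> a - \<psi> v)" by (rule norm_triangle_ineq4)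
    also have "\<dots> \<le> 2 * cdist A a v + 2 * cdist A a v"
      using v monomial_span_carrier a by (intro add_mono \<phi>.bounded_diff \<psi>.bounded_diff) auto
    finally show ?thesis using v(2) by simp
  qed
  then have "cmod (\<phi> a - \<psi> a) \<le> 0" by (rule field_le_epsilon) simp
  then show ?thesis by simp
qed

subsection \<open>Functionals peaking along a regular path\<close>

abbreviation cyclines :: "'a set" where "cyclines \<equiv> cycline_subalgebra G A S"

lemma cstar_subalgebra_cyclines: "cstar_subalgebra A cyclines"
  unfolding cycline_subalgebra_def
  by (rule cstar_subalgebra_generated) (auto simp: cycline_def)

lemma star_subalgebra_cyclines: "star_subalgebra A cyclines"
  using cstar_subalgebra_cyclines by (simp add: cstar_subalgebra_iff)

lemma cycline_in: "(\<alpha>, \<beta>) \<in> cycline G A S \<Longrightarrow> S \<alpha> \<cdot> star A (S \<beta>) \<in> cyclines"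
  unfolding cycline_subalgebra_def cstar_generated_def by blast

text \<open>A pair (\<mu>, \<mu>) is trivially cycline. Hence prescribing a functional on the
  cycline subalgebra fixes its values on all range projections.\<close>

lemma proj_cycline: "\<mu> \<in> paths G \<Longrightarrow> proj \<mu> \<in> cyclines"
  unfolding range_proj_def by (rule cycline_in) (simp add: cycline_def)

lemma cycline_sym: "(\<alpha>, \<beta>) \<in> cycline G A S \<Longrightarrow> (\<beta>, \<alpha>) \<in> cycline G A S"
  by (auto simp: cycline_def)

lemma cyclineI:
  assumes p: "\<mu> \<in> paths G" "\<nu> \<in> paths G" "src G \<mu> = src G \<nu>"
    and cyl: "\<And>\<delta>. \<delta> \<in> paths G \<Longrightarrow> rng G \<delta> = src G \<mu> \<Longrightarrow>
      cylinder G (pcomp G \<mu> \<delta>) = cylinder G (pcomp G \<nu> \<delta>)"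
  shows "(\<mu>, \<nu>) \<in> cycline G A S"
  using p cyl unfolding cycline_def
  by (auto simp: paths_from_def comp_in intro!: proj_eq_of_cylinder)

text \<open>The hypothesis concerns only paths through \<alpha>\<kappa>. For y through
  \<beta>\<kappa> with tail w behind \<beta>, it applies to \<alpha>w; this path then also begins
  with \<beta> and has tail w behind it, so it is y.\<close>

lemma cylinder_sym_of_shift:
  assumes p: "\<alpha> \<in> paths G" "\<beta> \<in> paths G" "\<kappa> \<in> paths G" and s: "src G \<alpha> = rng G \<kappa>" "src G \<beta> = rng G \<kappa>"
    and F: "\<And>y. y \<in> cylinder G (pcomp G \<alpha> \<kappa>) \<Longrightarrow>
      y \<in> cylinder G \<beta> \<and> shift (deg G \<alpha>) y = shift (deg G \<beta>) y"
  shows "cylinder G (pcomp G \<alpha> \<kappa>) = cylinder G (pcomp G \<beta> \<kappa>)"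
proof (intro subset_antisym subsetI)
  have seg: "y m (m + n) = shift m y 0 n" for y :: "('p, 'k) ipath" and m n
    by (simp add: shift_def add.commute)
  show "y \<in> cylinder G (pcomp G \<beta> \<kappa>)" if "y \<in> cylinder G (pcomp G \<alpha> \<kappa>)" for y
    using F[OF that] that cylinder_iff[OF p(1,3) s(1)] cylinder_iff[OF p(2,3) s(2)] by (simp add: seg)
  show "y \<in> cylinder G (pcomp G \<alpha> \<kappa>)" if y: "y \<in> cylinder G (pcomp G \<beta> \<kappa>)" for y
  proof -
    have y\<beta>: "y \<in> cylinder G \<beta>" "shift (deg G \<beta>) y 0 (deg G \<kappa>) = \<kappa>"
      using y cylinder_iff[OF p(2,3) s(2)] by (simp_all add: seg)
    define w where "w = shift (deg G \<beta>) y"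
    have w: "w \<in> inf_paths_from G (src G \<alpha>)"
      unfolding w_def using shift_cylinder_from[OF p(2) y\<beta>(1)] s by simp
    let ?y = "prepend G \<alpha> w"
    have mem: "?y \<in> cylinder G (pcomp G \<alpha> \<kappa>)"
      using cylinder_iff[OF p(1,3) s(1)] prepend_cylinder[OF p(1) w] shift_prepend[OF p(1) w] y\<beta>(2)
      by (simp add: seg w_def)
    have "?y = y"
      using F[OF mem] shift_prepend[OF p(1) w] y\<beta>(1) cylinder_shift_eqI[OF p(2), of ?y y] by (simp add: w_def)
    then show ?thesis using mem by simp
  qed
qed

text \<open>The two projections are chosen separately because \<alpha> and \<beta> may have
  different degrees: cutting x at distance m behind each of them leaves tails of equal degree.
  Different tails cancel by CK1; equal ones lead to a cycline pair.\<close>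

lemma compress_monomial:
  assumes x: "x \<in> regular_paths G" and p: "\<alpha> \<in> paths G" "\<beta> \<in> paths G" and s: "src G \<alpha> = src G \<beta>"
  obtains m n where "proj (x 0 m) \<cdot> (S \<alpha> \<cdot> star A (S \<beta>)) \<cdot> proj (x 0 n) \<in> cyclines"
proof -
  let ?a = "deg G \<alpha>" and ?b = "deg G \<beta>"
  have xi: "x \<in> inf_paths G" using x by (rule regular_in)
  note xp = ipath_0_in[OF xi] and xd = deg_ipath_0[OF xi]
  have zero: "\<zero>\<^bsub>A\<^esub> \<in> cyclines" using star_subalgebraD(2)[OF star_subalgebra_cyclines] .
  have regroup: "proj (x 0 m) \<cdot> (S \<alpha> \<cdot> star A (S \<beta>)) \<cdot> proj (x 0 n) =
      (proj (x 0 m) \<cdot> S \<alpha>) \<cdot> (star A (S \<beta>) \<cdot> proj (x 0 n))" for m n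
    using p xp by (simp add: mult_assoc)
  consider "x 0 ?a \<noteq> \<alpha>" | "x 0 ?b \<noteq> \<beta>"
    | (neq) "x 0 ?a = \<alpha>" "x 0 ?b = \<beta>" "shift ?a x \<noteq> shift ?b x"
    | (eq) "x 0 ?a = \<alpha>" "x 0 ?b = \<beta>" "shift ?a x = shift ?b x" by blast
  then show thesis
  proof cases
    case 1
    then have "proj (x 0 ?a) \<cdot> S \<alpha> = \<zero>\<^bsub>A\<^esub>" using proj_mult_S_neq(1)[of "x 0 ?a" \<alpha>] xp xd p by simp
    then show thesis using that[of ?a 0] p xp zero by (simp add: regroup)
  next
    case 2
    then have "star A (S \<beta>) \<cdot> proj (x 0 ?b) = \<zero>\<^bsub>A\<^esub>" using proj_mult_S_neq(2)[of "x 0 ?b" \<beta>] xp xd p by simp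
    then show thesis using that[of 0 ?b] p xp zero by (simp add: regroup)
  next
    case neq
    then obtain m where m: "x ?a (?a + m) \<noteq> x ?b (?b + m)" using shift_neq_nbhd[OF xi] by blast
    define \<gamma> \<gamma>' where "\<gamma> = x ?a (?a + m)" and "\<gamma>' = x ?b (?b + m)"
    have g: "\<gamma> \<in> paths G" "deg G \<gamma> = m" "src G \<alpha> = rng G \<gamma>" "x 0 (?a + m) = pcomp G \<alpha> \<gamma>"
      using ipathD[OF xi vec_le_add(1)[of ?a m]] ipath_comp[OF xi vec_le_add(3) vec_le_add(1)[of ?a m]] neq(1)
      by (simp_all add: \<gamma>_def)
    have g': "\<gamma>' \<in> paths G" "deg G \<gamma>' = m" "src G \<beta> = rng G \<gamma>'" "x 0 (?b + m) = pcomp G \<beta> \<gamma>'"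
      using ipathD[OF xi vec_le_add(1)[of ?b m]] ipath_comp[OF xi vec_le_add(3) vec_le_add(1)[of ?b m]] neq(2)
      by (simp_all add: \<gamma>'_def)
    have "(proj (x 0 (?a + m)) \<cdot> S \<alpha>) \<cdot> (star A (S \<beta>) \<cdot> proj (x 0 (?b + m))) =
        S (pcomp G \<alpha> \<gamma>) \<cdot> ((star A (S \<gamma>) \<cdot> S \<gamma>') \<cdot> star A (S (pcomp G \<beta> \<gamma>')))"
      unfolding g(4) g'(4) proj_mult_S[OF p(1) g(1,3)] S_star_mult_proj[OF p(2) g'(1,3)]
      using p g g' by (simp add: mult_assoc comp_in)
    also have "\<dots> = \<zero>\<^bsub>A\<^esub>" using m p g g' by (simp add: CK1 comp_in flip: \<gamma>_def \<gamma>'_def)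
    finally show thesis using that[of "?a + m" "?b + m"] zero by (simp add: regroup)
  next
    case eq
    then obtain n where n: "\<And>y. y \<in> cylinder G (x 0 n) \<Longrightarrow> shift ?a y = shift ?b y"
      using x unfolding regular_iff by blast
    \<comment> \<open>Then the prefix of degree \<open>?a + m\<close> refines the neighbourhood
      given by n and also contains \<beta>.\<close>
    define m where "m = n + ?b"
    define \<gamma> where "\<gamma> = x ?a (?a + m)"
    have g: "\<gamma> \<in> paths G" "deg G \<gamma> = m" "src G \<alpha> = rng G \<gamma>" "x 0 (?a + m) = pcomp G \<alpha> \<gamma>"
      using ipathD[OF xi vec_le_add(1)[of ?a m]] ipath_comp[OF xi vec_le_add(3) vec_le_add(1)[of ?a m]] eq(1)
      by (simp_all add: \<gamma>_def)
    have le: "n \<le> ?a + m" "?b \<le> ?a + m" by (auto simp: m_def less_eq_vec_def)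
    have F: "y \<in> cylinder G \<beta> \<and> shift ?a y = shift ?b y" if "y \<in> cylinder G (pcomp G \<alpha> \<gamma>)" for y
      using that cylinder_prefix[OF xi le(1)] cylinder_prefix[OF xi le(2)] n eq(2) by (auto simp: g(4))
    have cyc: "(pcomp G \<alpha> \<gamma>, pcomp G \<beta> \<gamma>) \<in> cycline G A S"
    proof (rule cyclineI)
      fix \<delta> assume \<delta>: "\<delta> \<in> paths G" "rng G \<delta> = src G (pcomp G \<alpha> \<gamma>)"
      then have s': "src G \<gamma> = rng G \<delta>" using p g by (simp add: src_comp)
      \<comment> \<open>The extension \<delta> is absorbed into the common tail, so the symmetry
        argument applies with \<kappa> = \<gamma>\<delta>.\<close>
      have "cylinder G (pcomp G \<alpha> (pcomp G \<gamma> \<delta>)) = cylinder G (pcomp G \<beta> (pcomp G \<gamma> \<delta>))"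
      proof (rule cylinder_sym_of_shift)
        fix y assume "y \<in> cylinder G (pcomp G \<alpha> (pcomp G \<gamma> \<delta>))"
        then have "y \<in> cylinder G (pcomp G \<alpha> \<gamma>)"
          using cylinder_iff[of "pcomp G \<alpha> \<gamma>" \<delta> y] comp_assoc[of \<alpha> \<gamma> \<delta>] p g \<delta> s' by (simp add: comp_in)
        then show "y \<in> cylinder G \<beta> \<and> shift ?a y = shift ?b y" by (rule F)
      qed (use p g s \<delta> s' in \<open>simp_all add: comp_in rng_comp\<close>)
      then show "cylinder G (pcomp G (pcomp G \<alpha> \<gamma>) \<delta>) = cylinder G (pcomp G (pcomp G \<beta> \<gamma>) \<delta>)"
        using comp_assoc[of \<alpha> \<gamma> \<delta>] comp_assoc[of \<beta> \<gamma> \<delta>] p g s \<delta> s' by simp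
    qed (use p g s in \<open>simp_all add: comp_in src_comp\<close>)
    have "proj (x 0 (?a + m)) \<cdot> (S \<alpha> \<cdot> star A (S \<beta>)) =
        (proj (pcomp G \<alpha> \<gamma>) \<cdot> S \<alpha>) \<cdot> star A (S \<beta>)"
      using p g by (simp add: mult_assoc comp_in)
    also have "\<dots> = S (pcomp G \<alpha> \<gamma>) \<cdot> star A (S (pcomp G \<beta> \<gamma>))"
      using p g s by (simp add: proj_mult_S S_comp_star(1) mult_assoc comp_in)
    \<comment> \<open>The left compression is already a cycline monomial; the vertex projection on
      the right gives the two-sided form.\<close>
    finally have "proj (x 0 (?a + m)) \<cdot> (S \<alpha> \<cdot> star A (S \<beta>)) \<cdot> proj (x 0 0) \<in> cyclines"
      using star_subalgebraD(5)[OF star_subalgebra_cyclines] cycline_in[OF cyc] proj_cycline[OF xp] by simp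
    then show thesis by (rule that)
  qed
qed

text \<open>Value 1 on every \<open>proj (x 0 n)\<close> moves the peaks to these projections, so
  both functionals take the same value on a monomial as on its compression.\<close>

lemma functionals_eq_of_cyclines:
  assumes x: "x \<in> regular_paths G"
    and \<phi>: "peaked_functional A (carrier A) \<phi> P" "\<And>n. \<phi> (proj (x 0 n)) = 1"
    and \<psi>: "peaked_functional A (carrier A) \<psi> Q" "\<And>n. \<psi> (proj (x 0 n)) = 1"
    and eq: "\<And>c. c \<in> cyclines \<Longrightarrow> \<phi> c = \<psi> c"
    and a: "a \<in> carrier A"
  shows "\<phi> a = \<psi> a"
proof (rule functionals_eqI[OF \<phi>(1) \<psi>(1) _ a])
  note xp = ipath_0_in[OF regular_in[OF x]]
  have compress: "\<theta> (proj (x 0 m) \<cdot> b \<cdot> proj (x 0 n)) = \<theta> b"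
    if "peaked_functional A (carrier A) \<theta> R" "\<And>n. \<theta> (proj (x 0 n)) = 1" "b \<in> carrier A" for \<theta> R b m n
  proof -
    interpret \<theta>: peaked_functional A "carrier A" \<theta> R by (rule that)
    have peaked: "peaked_functional A (carrier A) \<theta> (proj (x 0 n))" for n
      by (rule \<theta>.peaked_at) (use that(2) xp in auto)
    show ?thesis
      using peaked_functional.P_right[OF peaked[of n], of "proj (x 0 m) \<cdot> b"]
        peaked_functional.P_left[OF peaked[of m], of b] that(3) xp by simp
  qed
  fix \<alpha> \<beta> assume p: "\<alpha> \<in> paths G" "\<beta> \<in> paths G" "src G \<alpha> = src G \<beta>"
  obtain m n where "proj (x 0 m) \<cdot> (S \<alpha> \<cdot> star A (S \<beta>)) \<cdot> proj (x 0 n) \<in> cyclines"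
    using compress_monomial[OF x p] .
  from eq[OF this] show "\<phi> (S \<alpha> \<cdot> star A (S \<beta>)) = \<psi> (S \<alpha> \<cdot> star A (S \<beta>))"
    using compress[OF \<phi>] compress[OF \<psi>] p by simp
qed

end

section \<open>Operators on \<open>\<ell>\<^sup>2(X)\<close>\<close>

lemma ell2D: "f \<in> ell2 X \<Longrightarrow> (\<lambda>x. (cmod (f x))\<^sup>2) summable_on X" "f \<in> ell2 X \<Longrightarrow> x \<notin> X \<Longrightarrow> f x = 0"
  by (auto simp: ell2_def)

lemma ell2_zero [simp]: "(\<lambda>_. 0) \<in> ell2 X"
  by (simp add: ell2_def)

lemma ell2_scale [simp]: "f \<in> ell2 X \<Longrightarrow> (\<lambda>x. k * f x) \<in> ell2 X"
  by (auto simp: ell2_def norm_mult power_mult_distrib intro: summable_on_cmult_right)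

lemma ell2_add [simp]:
  assumes "f \<in> ell2 X" "g \<in> ell2 X"
  shows "(\<lambda>x. f x + g x) \<in> ell2 X"
proof -
  have "(\<lambda>x. (cmod (f x + g x))\<^sup>2) summable_on X"
  proof (rule summable_on_comparison_test)
    show "(\<lambda>x. 2 * (cmod (f x))\<^sup>2 + 2 * (cmod (g x))\<^sup>2) summable_on X"
      using assms ell2D(1) by (intro summable_on_add summable_on_cmult_right) auto
    fix x
    have "(cmod (f x + g x))\<^sup>2 \<le> (cmod (f x) + cmod (g x))\<^sup>2"
      by (intro power_mono norm_triangle_ineq) auto
    also have "\<dots> \<le> 2 * (cmod (f x))\<^sup>2 + 2 * (cmod (g x))\<^sup>2"
      using sum_squares_bound[of "cmod (f x)" "cmod (g x)"] by (simp add: power2_sum)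
    finally show "(cmod (f x + g x))\<^sup>2 \<le> 2 * (cmod (f x))\<^sup>2 + 2 * (cmod (g x))\<^sup>2" .
  qed auto
  then show ?thesis using assms by (auto simp: ell2_def)
qed

lemma ell2_inner_abs_summable:
  assumes "f \<in> ell2 X" "g \<in> ell2 X"
  shows "(\<lambda>x. cmod (f x * cnj (g x))) summable_on X"
proof (rule summable_on_comparison_test)
  show "(\<lambda>x. (cmod (f x))\<^sup>2 + (cmod (g x))\<^sup>2) summable_on X"
    using assms ell2D(1) by (intro summable_on_add) auto
  fix x
  have "2 * (cmod (f x) * cmod (g x)) \<le> (cmod (f x))\<^sup>2 + (cmod (g x))\<^sup>2"
    using sum_squares_bound[of "cmod (f x)" "cmod (g x)"] by (simp only: mult.assoc)
  moreover have "0 \<le> cmod (f x) * cmod (g x)" by simp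
  ultimately have "cmod (f x) * cmod (g x) \<le> (cmod (f x))\<^sup>2 + (cmod (g x))\<^sup>2" by linarith
  then show "cmod (f x * cnj (g x)) \<le> (cmod (f x))\<^sup>2 + (cmod (g x))\<^sup>2"
    by (simp only: norm_mult complex_mod_cnj)
qed auto

lemma ell2_inner_summable:
  "f \<in> ell2 X \<Longrightarrow> g \<in> ell2 X \<Longrightarrow> (\<lambda>x. f x * cnj (g x)) summable_on X"
  by (rule abs_summable_summable[OF ell2_inner_abs_summable])

lemma ell2_inner_add:
  "\<lbrakk>f \<in> ell2 X; g \<in> ell2 X; h \<in> ell2 X\<rbrakk> \<Longrightarrow>
    ell2_inner X (\<lambda>x. f x + g x) h = ell2_inner X f h + ell2_inner X g h"
  unfolding ell2_inner_def by (simp add: distrib_right infsum_add ell2_inner_summable)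

lemma ell2_inner_scale: "ell2_inner X (\<lambda>x. k * f x) h = k * ell2_inner X f h"
  unfolding ell2_inner_def by (simp add: mult.assoc infsum_cmult_right')

lemma ell2_inner_commute: "ell2_inner X g f = cnj (ell2_inner X f g)"
  unfolding ell2_inner_def by (simp add: mult.commute flip: infsum_cnj)

lemma ell2_inner_add_right:
  "\<lbrakk>f \<in> ell2 X; g \<in> ell2 X; h \<in> ell2 X\<rbrakk> \<Longrightarrow>
    ell2_inner X h (\<lambda>x. f x + g x) = ell2_inner X h f + ell2_inner X h g"
  by (subst (1 2 3) ell2_inner_commute) (simp add: ell2_inner_add)

lemma ell2_inner_scale_right: "ell2_inner X h (\<lambda>x. k * f x) = cnj k * ell2_inner X h f"
  by (subst (1 2) ell2_inner_commute) (simp add: ell2_inner_scale)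

lemma ell2_norm_nonneg [simp]: "0 \<le> ell2_norm X f"
  by (simp add: ell2_norm_def infsum_nonneg)

lemma ell2_norm_sq: "(ell2_norm X f)\<^sup>2 = (\<Sum>\<^sub>\<infinity>x\<in>X. (cmod (f x))\<^sup>2)"
  by (simp add: ell2_norm_def infsum_nonneg)

lemma ell2_inner_self:
  assumes "f \<in> ell2 X"
  shows "ell2_inner X f f = of_real ((ell2_norm X f)\<^sup>2)"
proof -
  have "f x * cnj (f x) = of_real ((cmod (f x))\<^sup>2)" for x
    using complex_norm_square[of "f x"] by (simp only:)
  moreover have "((\<lambda>x. complex_of_real ((cmod (f x))\<^sup>2)) has_sum of_real (\<Sum>\<^sub>\<infinity>x\<in>X. (cmod (f x))\<^sup>2)) X"
    unfolding has_sum_of_real_iff using ell2D(1)[OF assms] by (rule has_sum_infsum)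
  ultimately show ?thesis
    unfolding ell2_inner_def ell2_norm_sq by (simp only: infsumI)
qed

lemma ell2_Cauchy_Schwarz:
  assumes "f \<in> ell2 X" "g \<in> ell2 X"
  shows "cmod (ell2_inner X f g) \<le> ell2_norm X f * ell2_norm X g"
proof -
  have L2: "L2_set (\<lambda>x. cmod (h x)) F \<le> ell2_norm X h" if "finite F" "F \<subseteq> X" "h \<in> ell2 X" for h F
    unfolding L2_set_def ell2_norm_def
    using that ell2D(1) by (intro real_sqrt_le_mono finite_sum_le_infsum) auto
  have "cmod (ell2_inner X f g) \<le> (\<Sum>\<^sub>\<infinity>x\<in>X. cmod (f x * cnj (g x)))"
    unfolding ell2_inner_def by (rule norm_infsum_bound) (rule ell2_inner_abs_summable[OF assms])
  also have "\<dots> \<le> ell2_norm X f * ell2_norm X g"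
  proof (rule infsum_le_finite_sums[OF ell2_inner_abs_summable[OF assms]])
    fix F assume F: "finite F" "F \<subseteq> X"
    have "(\<Sum>x\<in>F. cmod (f x * cnj (g x))) = (\<Sum>x\<in>F. \<bar>cmod (f x)\<bar> * \<bar>cmod (g x)\<bar>)"
      by (simp add: norm_mult)
    also have "\<dots> \<le> L2_set (\<lambda>x. cmod (f x)) F * L2_set (\<lambda>x. cmod (g x)) F"
      by (rule L2_set_mult_ineq)
    also have "\<dots> \<le> ell2_norm X f * ell2_norm X g"
      using L2 F assms by (intro mult_mono) auto
    finally show "(\<Sum>x\<in>F. cmod (f x * cnj (g x))) \<le> ell2_norm X f * ell2_norm X g" .
  qed
  finally show ?thesis .
qed

lemma ell2_norm_add_sq:
  assumes "f \<in> ell2 X" "g \<in> ell2 X"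
  shows "(ell2_norm X (\<lambda>x. f x + g x))\<^sup>2 = (ell2_norm X f)\<^sup>2 + (ell2_norm X g)\<^sup>2 + 2 * Re (ell2_inner X f g)"
proof -
  have "complex_of_real ((ell2_norm X (\<lambda>x. f x + g x))\<^sup>2) =
      of_real ((ell2_norm X f)\<^sup>2) + of_real ((ell2_norm X g)\<^sup>2) + (ell2_inner X f g + cnj (ell2_inner X f g))"
    unfolding ell2_inner_self[OF assms(1), symmetric] ell2_inner_self[OF assms(2), symmetric]
      ell2_inner_self[OF ell2_add[OF assms], symmetric]
    using assms by (simp add: ell2_inner_add ell2_inner_add_right ell2_inner_commute[of X g f])
  then have "complex_of_real ((ell2_norm X (\<lambda>x. f x + g x))\<^sup>2) =
      complex_of_real ((ell2_norm X f)\<^sup>2 + (ell2_norm X g)\<^sup>2 + 2 * Re (ell2_inner X f g))"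
    by (simp only: complex_add_cnj of_real_add)
  then show ?thesis by (simp only: of_real_eq_iff)
qed

lemma ell2_norm_triangle:
  assumes "f \<in> ell2 X" "g \<in> ell2 X"
  shows "ell2_norm X (\<lambda>x. f x + g x) \<le> ell2_norm X f + ell2_norm X g"
proof (rule power2_le_imp_le)
  have "Re (ell2_inner X f g) \<le> ell2_norm X f * ell2_norm X g"
    using ell2_Cauchy_Schwarz[OF assms] complex_Re_le_cmod order_trans by blast
  then show "(ell2_norm X (\<lambda>x. f x + g x))\<^sup>2 \<le> (ell2_norm X f + ell2_norm X g)\<^sup>2"
    using ell2_norm_add_sq[OF assms] by (simp add: power2_sum)
qed simp

lemma ell2_norm_scale: "ell2_norm X (\<lambda>x. k * f x) = cmod k * ell2_norm X f"
  by (simp add: ell2_norm_def norm_mult power_mult_distrib infsum_cmult_right' real_sqrt_mult)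

lemma ell2_norm_zero [simp]: "ell2_norm X (\<lambda>_. 0) = 0"
  by (simp add: ell2_norm_def)

lemma delta_ell2 [simp]: "x \<in> X \<Longrightarrow> delta x \<in> ell2 X"
  by (auto simp: ell2_def delta_def intro!: finite_nonzero_values_imp_summable_on)

lemma ell2_inner_delta: "x \<in> X \<Longrightarrow> ell2_inner X f (delta x) = f x"
proof -
  assume x: "x \<in> X"
  have "ell2_inner X f (delta x) = (\<Sum>\<^sub>\<infinity>y\<in>{x}. f y)"
    unfolding ell2_inner_def by (rule infsum_cong_neutral) (use x in \<open>auto simp: delta_def\<close>)
  then show ?thesis by simp
qed

lemma ell2_norm_delta [simp]: "x \<in> X \<Longrightarrow> ell2_norm X (delta x) = 1"
proof -
  assume x: "x \<in> X"
  have "complex_of_real ((ell2_norm X (delta x))\<^sup>2) = 1"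
    using ell2_inner_self[OF delta_ell2[OF x]] ell2_inner_delta[OF x, of "delta x"] by (simp add: delta_def)
  then have "(ell2_norm X (delta x))\<^sup>2 = 1" by (metis of_real_eq_1_iff)
  then show ?thesis using ell2_norm_nonneg[of X "delta x"] by (simp add: power2_eq_1_iff)
qed

text \<open>Quantitative density of finitely supported vectors, used to extend the adjoint relation
  from basis vectors.\<close>

lemma ell2_tail:
  assumes f: "f \<in> ell2 X" and e: "0 < e"
  obtains F where "finite F" "F \<subseteq> X" "(\<lambda>x. if x \<in> F then 0 else f x) \<in> ell2 X"
    "ell2_norm X (\<lambda>x. if x \<in> F then 0 else f x) < e"
proof -
  let ?s = "\<lambda>x. (cmod (f x))\<^sup>2"
  have s: "?s summable_on X" using ell2D(1)[OF f] .
  have "(sum ?s \<longlongrightarrow> infsum ?s X) (finite_subsets_at_top X)" using s by (rule infsum_tendsto)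
  then have "eventually (\<lambda>F. dist (sum ?s F) (infsum ?s X) < e\<^sup>2) (finite_subsets_at_top X)"
    by (rule tendstoD) (use e in simp)
  then obtain F where F: "finite F" "F \<subseteq> X" "dist (sum ?s F) (infsum ?s X) < e\<^sup>2"
    unfolding eventually_finite_subsets_at_top by blast
  let ?t = "\<lambda>x. if x \<in> F then 0 else f x"
  have sF: "?s summable_on X - F" using s by (rule summable_on_subset_banach) auto
  have t: "?t \<in> ell2 X"
    using f s by (auto simp: ell2_def intro: summable_on_comparison_test)
  have "(ell2_norm X ?t)\<^sup>2 = infsum ?s (X - F)"
    unfolding ell2_norm_sq by (rule infsum_cong_neutral) auto
  also have "\<dots> = infsum ?s X - sum ?s F"
    using infsum_Un_disjoint[OF summable_on_finite[OF F(1), of ?s] sF] F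
    by (simp add: Un_absorb1)
  also have "\<dots> < e\<^sup>2" using F(3) by (simp add: dist_real_def)
  finally have "ell2_norm X ?t < e" using e by (auto intro: power2_less_imp_less)
  with F t show thesis by (intro that)
qed

subsection \<open>Bounded operators and their adjoints\<close>

lemma
  assumes "T \<in> bounded_ops X"
  shows op_in: "f \<in> ell2 X \<Longrightarrow> T f \<in> ell2 X"
    and op_undefined: "f \<notin> ell2 X \<Longrightarrow> T f = undefined"
    and op_add: "f \<in> ell2 X \<Longrightarrow> g \<in> ell2 X \<Longrightarrow> T (\<lambda>x. f x + g x) = (\<lambda>x. T f x + T g x)"
    and op_scale: "f \<in> ell2 X \<Longrightarrow> T (\<lambda>x. k * f x) = (\<lambda>x. k * T f x)"
  using assms by (auto simp: bounded_ops_def)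

lemma op_zero: "T \<in> bounded_ops X \<Longrightarrow> T (\<lambda>_. 0) = (\<lambda>_. 0)"
  using op_scale[of T X "\<lambda>_. 0" 0] by simp

lemma op_bound:
  assumes "T \<in> bounded_ops X"
  obtains c where "0 \<le> c" "\<And>f. f \<in> ell2 X \<Longrightarrow> ell2_norm X (T f) \<le> c * ell2_norm X f"
proof -
  have "\<exists>c. \<forall>f\<in>ell2 X. ell2_norm X (T f) \<le> c * ell2_norm X f" using assms by (simp add: bounded_ops_def)
  then obtain c where c: "\<And>f. f \<in> ell2 X \<Longrightarrow> ell2_norm X (T f) \<le> c * ell2_norm X f" by blast
  have "ell2_norm X (T f) \<le> max c 0 * ell2_norm X f" if "f \<in> ell2 X" for f
    using c[OF that] mult_right_mono[of c "max c 0" "ell2_norm X f"] by simp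
  then show thesis using that[of "max c 0"] by simp
qed

lemma bounded_opsI:
  assumes "\<And>f. f \<in> ell2 X \<Longrightarrow> T f \<in> ell2 X" "\<And>f. f \<notin> ell2 X \<Longrightarrow> T f = undefined"
    and "\<And>f g. f \<in> ell2 X \<Longrightarrow> g \<in> ell2 X \<Longrightarrow> T (\<lambda>x. f x + g x) = (\<lambda>x. T f x + T g x)"
    and "\<And>f k. f \<in> ell2 X \<Longrightarrow> T (\<lambda>x. k * f x) = (\<lambda>x. k * T f x)"
    and "\<And>f. f \<in> ell2 X \<Longrightarrow> ell2_norm X (T f) \<le> c * ell2_norm X f"
  shows "T \<in> bounded_ops X"
  using assms unfolding bounded_ops_def by (auto simp: PiE_def extensional_def intro!: exI[of _ c])

lemma op_finite_sum:
  assumes T: "T \<in> bounded_ops X" and F: "finite F" "F \<subseteq> X"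
  shows "(\<lambda>x. \<Sum>y\<in>F. c y * delta y x) \<in> ell2 X"
    and "T (\<lambda>x. \<Sum>y\<in>F. c y * delta y x) = (\<lambda>x. \<Sum>y\<in>F. c y * T (delta y) x)"
proof -
  have "(\<lambda>x. \<Sum>y\<in>F. c y * delta y x) \<in> ell2 X \<and>
      T (\<lambda>x. \<Sum>y\<in>F. c y * delta y x) = (\<lambda>x. \<Sum>y\<in>F. c y * T (delta y) x)"
    using F
  proof (induction F)
    case (insert y F)
    then have "(\<lambda>x. c y * delta y x) \<in> ell2 X" "(\<lambda>x. \<Sum>z\<in>F. c z * delta z x) \<in> ell2 X" by auto
    from op_add[OF T this] ell2_add[OF this] insert op_scale[OF T delta_ell2, of y "c y"] show ?case by simp
  qed (simp add: op_zero[OF T])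
  then show "(\<lambda>x. \<Sum>y\<in>F. c y * delta y x) \<in> ell2 X"
    "T (\<lambda>x. \<Sum>y\<in>F. c y * delta y x) = (\<lambda>x. \<Sum>y\<in>F. c y * T (delta y) x)" by auto
qed

lemma ell2_inner_finite_sum:
  assumes "finite F" "\<And>y. y \<in> F \<Longrightarrow> h y \<in> ell2 X" "g \<in> ell2 X"
  shows "(\<lambda>x. \<Sum>y\<in>F. c y * h y x) \<in> ell2 X \<and>
    ell2_inner X (\<lambda>x. \<Sum>y\<in>F. c y * h y x) g = (\<Sum>y\<in>F. c y * ell2_inner X (h y) g)"
  using assms(1,2)
proof (induction F)
  case (insert y F)
  then have "(\<lambda>x. c y * h y x) \<in> ell2 X" "(\<lambda>x. \<Sum>z\<in>F. c z * h z x) \<in> ell2 X" by auto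
  with insert assms(3) show ?case by (simp add: ell2_inner_add ell2_inner_scale)
qed (simp add: ell2_inner_def)

lemma sum_delta_eq:
  "finite F \<Longrightarrow> (\<Sum>y\<in>F. c y * delta y x) = (if x \<in> F then c x else 0)"
  by (simp add: delta_def if_distrib[of "\<lambda>u. _ * u"] cong: if_cong)

text \<open>An explicit candidate for the description in \<open>hilbert_adjoint\<close>: pairing
  with \<open>delta x\<close> forces each coordinate.\<close>

definition adjoint_op :: "'x set \<Rightarrow> 'x oper \<Rightarrow> 'x oper" where
  "adjoint_op X T = restrict (\<lambda>g x. if x \<in> X then ell2_inner X g (T (delta x)) else 0) (ell2 X)"

text \<open>Duality: for h the candidate image of g, test with its restriction f to a finite set.
  Then the modulus of the inner product of T f with g is the square of the norm of f, and
  Cauchy-Schwarz bounds that norm uniformly in the finite set.\<close>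

lemma adjoint_op_bound:
  assumes T: "T \<in> bounded_ops X" and c: "0 \<le> c" "\<And>f. f \<in> ell2 X \<Longrightarrow> ell2_norm X (T f) \<le> c * ell2_norm X f"
    and g: "g \<in> ell2 X"
  shows "adjoint_op X T g \<in> ell2 X" "ell2_norm X (adjoint_op X T g) \<le> c * ell2_norm X g"
proof -
  define h where "h = adjoint_op X T g"
  have h: "h x = (if x \<in> X then ell2_inner X g (T (delta x)) else 0)" for x
    using g by (simp add: h_def adjoint_op_def)
  have bound: "(\<Sum>x\<in>F. (cmod (h x))\<^sup>2) \<le> (c * ell2_norm X g)\<^sup>2" if F: "finite F" "F \<subseteq> X" for F
  proof -
    define s where "s = (\<Sum>x\<in>F. (cmod (h x))\<^sup>2)"
    have s0: "0 \<le> s" by (simp add: s_def sum_nonneg)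
    define f where "f = (\<lambda>x. \<Sum>y\<in>F. h y * delta y x)"
    have f: "f \<in> ell2 X" "T f = (\<lambda>x. \<Sum>y\<in>F. h y * T (delta y) x)"
      unfolding f_def by (rule op_finite_sum[OF T F])+
    have "(ell2_norm X f)\<^sup>2 = (\<Sum>\<^sub>\<infinity>x\<in>F. (cmod (h x))\<^sup>2)"
      unfolding ell2_norm_sq f_def sum_delta_eq[OF F(1)]
      by (rule infsum_cong_neutral) (use F in auto)
    then have nf: "(ell2_norm X f)\<^sup>2 = s" using F by (simp add: s_def)
    have "ell2_inner X (T f) g = (\<Sum>y\<in>F. h y * ell2_inner X (T (delta y)) g)"
      unfolding f(2) using ell2_inner_finite_sum[OF F(1), of "\<lambda>y. T (delta y)" X g h] op_in[OF T delta_ell2] F(2) g by (simp add: subset_eq)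
    also have "\<dots> = (\<Sum>y\<in>F. of_real ((cmod (h y))\<^sup>2))"
    proof (rule sum.cong[OF refl])
      fix y assume "y \<in> F"
      then have "ell2_inner X (T (delta y)) g = cnj (h y)"
        using F(2) by (auto simp: h ell2_inner_commute[of X "T (delta y)" g])
      then show "h y * ell2_inner X (T (delta y)) g = of_real ((cmod (h y))\<^sup>2)"
        by (simp only: complex_norm_square)
    qed
    finally have "cmod (ell2_inner X (T f) g) = s"
      using s0 by (simp add: s_def flip: of_real_power of_real_sum)
    then have "s \<le> ell2_norm X (T f) * ell2_norm X g"
      using ell2_Cauchy_Schwarz[OF op_in[OF T f(1)] g] by simp
    also have "\<dots> \<le> (c * ell2_norm X f) * ell2_norm X g" using c(2)[OF f(1)] by (intro mult_right_mono) auto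
    finally have le: "s \<le> (c * ell2_norm X g) * ell2_norm X f" by (simp add: ac_simps)
    have "ell2_norm X f \<le> c * ell2_norm X g"
    proof (cases "ell2_norm X f = 0")
      case False
      then have "0 < ell2_norm X f" by (simp add: less_le)
      then show ?thesis using le unfolding nf[symmetric] by (simp add: power2_eq_square)
    qed (use c in simp)
    then show ?thesis unfolding s_def[symmetric] nf[symmetric] by (intro power_mono) auto
  qed
  have sum: "(\<lambda>x. (cmod (h x))\<^sup>2) summable_on X"
    by (rule nonneg_bdd_above_summable_on) (use bound in \<open>auto intro!: bdd_aboveI2\<close>)
  then show "adjoint_op X T g \<in> ell2 X" unfolding h_def[symmetric] by (simp add: ell2_def h)
  have "(ell2_norm X h)\<^sup>2 \<le> (c * ell2_norm X g)\<^sup>2"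
    unfolding ell2_norm_sq using sum bound by (rule infsum_le_finite_sums)
  then show "ell2_norm X (adjoint_op X T g) \<le> c * ell2_norm X g"
    unfolding h_def[symmetric] by (rule power2_le_imp_le) (use c in simp)
qed

lemma adjoint_op_in:
  assumes T: "T \<in> bounded_ops X"
  shows "adjoint_op X T \<in> bounded_ops X"
proof -
  obtain c where c: "0 \<le> c" "\<And>f. f \<in> ell2 X \<Longrightarrow> ell2_norm X (T f) \<le> c * ell2_norm X f"
    using op_bound[OF T] by blast
  show ?thesis
  proof (rule bounded_opsI)
    show "adjoint_op X T (\<lambda>x. f x + g x) = (\<lambda>x. adjoint_op X T f x + adjoint_op X T g x)"
      if "f \<in> ell2 X" "g \<in> ell2 X" for f g
      using that op_in[OF T] by (auto simp: adjoint_op_def ell2_inner_add fun_eq_iff)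
  qed (use adjoint_op_bound[OF T c] in \<open>auto simp: adjoint_op_def ell2_inner_scale fun_eq_iff\<close>)
qed

lemma adjoint_op_inner:
  assumes T: "T \<in> bounded_ops X" and f: "f \<in> ell2 X" and g: "g \<in> ell2 X"
  shows "ell2_inner X (T f) g = ell2_inner X f (adjoint_op X T g)"
proof -
  obtain c where c: "0 \<le> c" "\<And>f. f \<in> ell2 X \<Longrightarrow> ell2_norm X (T f) \<le> c * ell2_norm X f"
    using op_bound[OF T] by blast
  let ?S = "adjoint_op X T"
  have Sg: "?S g \<in> ell2 X" using adjoint_op_in[OF T] op_in g by blast
  \<comment> \<open>The relation is exact on the finite part of f; K times the norm of the tail
    bounds the remaining error.\<close>
  define K where "K = c * ell2_norm X g + ell2_norm X (?S g)"
  have K: "0 \<le> K" using c by (simp add: K_def)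
  have "cmod (ell2_inner X (T f) g - ell2_inner X f (?S g)) \<le> e" if e: "0 < e" for e
  proof -
    have "0 < e / (K + 1)" using e K by simp
    then obtain F where F: "finite F" "F \<subseteq> X" "(\<lambda>x. if x \<in> F then 0 else f x) \<in> ell2 X"
      "ell2_norm X (\<lambda>x. if x \<in> F then 0 else f x) < e / (K + 1)"
      using ell2_tail[OF f] by blast
    define t where "t = (\<lambda>x. if x \<in> F then 0 else f x)"
    have t: "t \<in> ell2 X" "ell2_norm X t < e / (K + 1)" using F by (simp_all add: t_def)
    define u where "u = (\<lambda>x. \<Sum>y\<in>F. f y * delta y x)"
    have u: "u \<in> ell2 X" "T u = (\<lambda>x. \<Sum>y\<in>F. f y * T (delta y) x)"
      unfolding u_def by (rule op_finite_sum[OF T F(1,2)])+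
    have fut: "f = (\<lambda>x. u x + t x)" by (auto simp: u_def t_def sum_delta_eq[OF F(1)])
    have "ell2_inner X (T u) g = (\<Sum>y\<in>F. f y * ell2_inner X (T (delta y)) g)"
      unfolding u(2) using ell2_inner_finite_sum[OF F(1), of "\<lambda>y. T (delta y)" X g f] op_in[OF T delta_ell2] F(2) g by (simp add: subset_eq)
    also have "\<dots> = (\<Sum>y\<in>F. f y * ell2_inner X (delta y) (?S g))"
    proof (rule sum.cong[OF refl])
      fix y assume "y \<in> F"
      then have "y \<in> X" using F by blast
      then show "f y * ell2_inner X (T (delta y)) g = f y * ell2_inner X (delta y) (?S g)"
        using g ell2_inner_commute[of X "delta y" "?S g"] ell2_inner_commute[of X "T (delta y)" g]
        by (simp add: ell2_inner_delta) (simp add: adjoint_op_def)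
    qed
    also have "\<dots> = ell2_inner X u (?S g)"
      unfolding u_def using ell2_inner_finite_sum[OF F(1), of delta X "?S g" f] F(2) Sg by (auto simp: subset_eq)
    finally have uu: "ell2_inner X (T u) g = ell2_inner X u (?S g)" .
    have "ell2_inner X (T f) g - ell2_inner X f (?S g) = ell2_inner X (T t) g - ell2_inner X t (?S g)"
      unfolding fut op_add[OF T u(1) t(1)] using t u(1) g Sg op_in[OF T] uu by (simp add: ell2_inner_add)
    also have "cmod \<dots> \<le> cmod (ell2_inner X (T t) g) + cmod (ell2_inner X t (?S g))"
      by (rule norm_triangle_ineq4)
    also have "\<dots> \<le> (c * ell2_norm X t) * ell2_norm X g + ell2_norm X t * ell2_norm X (?S g)"
    proof (rule add_mono)
      have "cmod (ell2_inner X (T t) g) \<le> ell2_norm X (T t) * ell2_norm X g"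
        using ell2_Cauchy_Schwarz[OF op_in[OF T t(1)] g] .
      also have "\<dots> \<le> (c * ell2_norm X t) * ell2_norm X g"
        using c(2)[OF t(1)] by (intro mult_right_mono) auto
      finally show "cmod (ell2_inner X (T t) g) \<le> (c * ell2_norm X t) * ell2_norm X g" .
    qed (rule ell2_Cauchy_Schwarz[OF t(1) Sg])
    also have "\<dots> = K * ell2_norm X t" by (simp add: K_def algebra_simps)
    also have "\<dots> \<le> (K + 1) * ell2_norm X t" by (simp add: mult_right_mono)
    also have "\<dots> \<le> e" using t(2) K by (simp add: pos_less_divide_eq mult.commute)
    finally show ?thesis .
  qed
  then have "cmod (ell2_inner X (T f) g - ell2_inner X f (?S g)) \<le> 0" by (rule field_le_epsilon) simp
  then show ?thesis by simp
qed

lemma hilbert_adjoint_eq: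
  assumes T: "T \<in> bounded_ops X"
  shows "hilbert_adjoint X T = adjoint_op X T"
  unfolding hilbert_adjoint_def
proof (rule the_equality)
  show "adjoint_op X T \<in> bounded_ops X \<and>
    (\<forall>f\<in>ell2 X. \<forall>g\<in>ell2 X. ell2_inner X (T f) g = ell2_inner X f (adjoint_op X T g))"
    using adjoint_op_in[OF T] adjoint_op_inner[OF T] by blast
  fix S assume S: "S \<in> bounded_ops X \<and>
    (\<forall>f\<in>ell2 X. \<forall>g\<in>ell2 X. ell2_inner X (T f) g = ell2_inner X f (S g))"
  show "S = adjoint_op X T"
  proof (intro ext)
    fix g x
    consider "g \<notin> ell2 X" | "g \<in> ell2 X" "x \<notin> X" | "g \<in> ell2 X" "x \<in> X" by blast
    then show "S g x = adjoint_op X T g x"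
    proof cases
      case 1
      then show ?thesis using op_undefined[of S X g] op_undefined[OF adjoint_op_in[OF T]] S by simp
    next
      case 2
      then show ?thesis
        using ell2D(2)[of "S g" X x] ell2D(2)[of "adjoint_op X T g" X x] op_in[of S X g] S
          op_in[OF adjoint_op_in[OF T]] by simp
    next
      case 3
      have "S g x = cnj (ell2_inner X (delta x) (S g))"
        using ell2_inner_commute[of X "S g" "delta x"] ell2_inner_delta[OF 3(2), of "S g"] by simp
      also have "\<dots> = cnj (ell2_inner X (T (delta x)) g)" using S 3 by simp
      also have "\<dots> = adjoint_op X T g x" using 3 ell2_inner_commute[of X g "T (delta x)"] by (simp add: adjoint_op_def)
      finally show ?thesis .
    qed
  qed
qed

lemma adjoint_delta:
  assumes "T \<in> bounded_ops X" "x \<in> X"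
  shows "hilbert_adjoint X T (delta x) = (\<lambda>y. if y \<in> X then cnj (T (delta y) x) else 0)"
  using assms
  by (auto simp: hilbert_adjoint_eq adjoint_op_def fun_eq_iff ell2_inner_delta
      ell2_inner_commute[of X "delta x"])

text \<open>The explicit adjoint depends only on the values at basis vectors, and it recovers every
  coordinate of the operator.\<close>

lemma bounded_ops_eqI:
  assumes T: "T \<in> bounded_ops X" and S: "S \<in> bounded_ops X" and eq: "\<And>x. x \<in> X \<Longrightarrow> T (delta x) = S (delta x)"
  shows "T = S"
proof (intro ext)
  fix f y
  have adj: "adjoint_op X T = adjoint_op X S" unfolding adjoint_op_def by (intro restrict_ext ext) (simp add: eq)
  consider "f \<notin> ell2 X" | "f \<in> ell2 X" "y \<notin> X" | "f \<in> ell2 X" "y \<in> X" by blast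
  then show "T f y = S f y"
  proof cases
    case 1
    then show ?thesis using op_undefined[OF T] op_undefined[OF S] by simp
  next
    case 2
    then show ?thesis using ell2D(2)[OF op_in[OF T]] ell2D(2)[OF op_in[OF S]] by simp
  next
    case 3
    then show ?thesis
      using adjoint_op_inner[OF T, of f "delta y"] adjoint_op_inner[OF S, of f "delta y"] adj
      by (simp add: ell2_inner_delta)
  qed
qed

text \<open>Reindexing along an injective map does not increase the norm. With the shift as \<sigma>
  and a cylinder as D, this is the shape of the path operators.\<close>

lemma composition_op_in:
  assumes inj: "inj_on \<sigma> D" and D: "D \<subseteq> X" and \<sigma>: "\<sigma> ` D \<subseteq> X"
  shows "restrict (\<lambda>f x. if x \<in> D then f (\<sigma> x) else 0) (ell2 X) \<in> bounded_ops X"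
proof -
  have "(\<lambda>x. if x \<in> D then f (\<sigma> x) else 0) \<in> ell2 X \<and>
      ell2_norm X (\<lambda>x. if x \<in> D then f (\<sigma> x) else 0) \<le> ell2_norm X f" if f: "f \<in> ell2 X" for f
  proof -
    let ?s = "\<lambda>x. (cmod (f x))\<^sup>2" and ?g = "\<lambda>x. if x \<in> D then f (\<sigma> x) else 0"
    have s: "?s summable_on \<sigma> ` D" using ell2D(1)[OF f] \<sigma> by (rule summable_on_subset_banach)
    then have "(?s \<circ> \<sigma>) summable_on D" using summable_on_reindex[OF inj] by blast
    then have "(\<lambda>x. (cmod (?g x))\<^sup>2) summable_on X"
      by (rule iffD1[OF summable_on_cong_neutral, rotated -1]) (use D in auto)
    then have g: "?g \<in> ell2 X" using D by (auto simp: ell2_def)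
    have "(ell2_norm X ?g)\<^sup>2 = infsum (?s \<circ> \<sigma>) D"
      unfolding ell2_norm_sq by (rule infsum_cong_neutral) (use D in auto)
    also have "\<dots> = infsum ?s (\<sigma> ` D)" by (rule infsum_reindex[OF inj, symmetric])
    also have "\<dots> \<le> (ell2_norm X f)\<^sup>2"
      unfolding ell2_norm_sq using s ell2D(1)[OF f] \<sigma> by (rule infsum_mono2) simp
    finally have "ell2_norm X ?g \<le> ell2_norm X f" by (rule power2_le_imp_le) simp
    with g show ?thesis ..
  qed
  then show ?thesis by (intro bounded_opsI[where c = 1]) (auto simp: fun_eq_iff)
qed

subsection \<open>The operator norm\<close>

abbreviation op_norm :: "'x set \<Rightarrow> 'x oper \<Rightarrow> real" where
  "op_norm X \<equiv> cnorm (B_ell2 X)"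

lemma carrier_B_ell2 [simp]: "carrier (B_ell2 X) = bounded_ops X"
  by (simp add: B_ell2_def)

lemma op_norm_upper:
  assumes T: "T \<in> bounded_ops X" and f: "f \<in> ell2 X" "ell2_norm X f \<le> 1"
  shows "ell2_norm X (T f) \<le> op_norm X T"
proof -
  obtain c where c: "0 \<le> c" "\<And>f. f \<in> ell2 X \<Longrightarrow> ell2_norm X (T f) \<le> c * ell2_norm X f"
    using op_bound[OF T] by blast
  have "ell2_norm X (T f) \<le> c" if "f \<in> ell2 X" "ell2_norm X f \<le> 1" for f
    using c(2)[OF that(1)] mult_left_mono[OF that(2) c(1)] by simp
  then have "bdd_above ((\<lambda>f. ell2_norm X (T f)) ` {f \<in> ell2 X. ell2_norm X f \<le> 1})"
    by (intro bdd_aboveI2[of _ _ c]) auto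
  then show ?thesis unfolding B_ell2_def by (simp, intro cSUP_upper) (use f in auto)
qed

lemma op_norm_least:
  assumes "\<And>f. f \<in> ell2 X \<Longrightarrow> ell2_norm X f \<le> 1 \<Longrightarrow> ell2_norm X (T f) \<le> C"
  shows "op_norm X T \<le> C"
proof -
  have "{f \<in> ell2 X. ell2_norm X f \<le> 1} \<noteq> {}" by (auto intro!: exI[of _ "\<lambda>_. 0"])
  then show ?thesis unfolding B_ell2_def by (simp, intro cSUP_least) (use assms in auto)
qed

lemma op_norm_nonneg: "T \<in> bounded_ops X \<Longrightarrow> 0 \<le> op_norm X T"
  using op_norm_upper[of T X "\<lambda>_. 0"] by (simp add: op_zero)

lemma lincomb_op_in:
  assumes S: "S \<in> bounded_ops X" and T: "T \<in> bounded_ops X"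
  shows "restrict (\<lambda>f x. S f x + k * T f x) (ell2 X) \<in> bounded_ops X"
proof -
  obtain c where c: "0 \<le> c" "\<And>f. f \<in> ell2 X \<Longrightarrow> ell2_norm X (S f) \<le> c * ell2_norm X f"
    using op_bound[OF S] by blast
  obtain d where d: "0 \<le> d" "\<And>f. f \<in> ell2 X \<Longrightarrow> ell2_norm X (T f) \<le> d * ell2_norm X f"
    using op_bound[OF T] by blast
  show ?thesis
  proof (rule bounded_opsI)
    fix f assume f: "f \<in> ell2 X"
    have "ell2_norm X (\<lambda>x. S f x + k * T f x) \<le> ell2_norm X (S f) + cmod k * ell2_norm X (T f)"
      using ell2_norm_triangle[of "S f" X "\<lambda>x. k * T f x"] op_in[OF S f] op_in[OF T f] by (simp add: ell2_norm_scale)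
    also have "\<dots> \<le> c * ell2_norm X f + cmod k * (d * ell2_norm X f)"
      using c(2)[OF f] d(2)[OF f] by (intro add_mono mult_left_mono) auto
    finally show "ell2_norm X (restrict (\<lambda>f x. S f x + k * T f x) (ell2 X) f) \<le> (c + cmod k * d) * ell2_norm X f"
      using f by (simp add: algebra_simps)
  qed (use op_in[OF S] op_in[OF T] op_add[OF S] op_add[OF T] op_scale[OF S] op_scale[OF T] in
      \<open>auto simp: fun_eq_iff algebra_simps\<close>)
qed

text \<open>Subtraction in \<open>cdist\<close> is defined through an abstract inverse; uniqueness
  of inverses in the group makes it computable pointwise.\<close>

lemma abelian_group_B_ell2: "abelian_group (B_ell2 X)"
proof (rule abelian_groupI)
  fix S T assume S: "S \<in> carrier (B_ell2 X)" and T: "T \<in> carrier (B_ell2 X)"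
  show "S \<oplus>\<^bsub>B_ell2 X\<^esub> T \<in> carrier (B_ell2 X)"
    using lincomb_op_in[of S X T 1] S T by (simp add: B_ell2_def)
  show "S \<oplus>\<^bsub>B_ell2 X\<^esub> T = T \<oplus>\<^bsub>B_ell2 X\<^esub> S" by (simp add: B_ell2_def add.commute)
  show "S \<oplus>\<^bsub>B_ell2 X\<^esub> T \<oplus>\<^bsub>B_ell2 X\<^esub> U = S \<oplus>\<^bsub>B_ell2 X\<^esub> (T \<oplus>\<^bsub>B_ell2 X\<^esub> U)" for U
    by (auto simp: B_ell2_def fun_eq_iff restrict_def add.assoc)
next
  show "\<zero>\<^bsub>B_ell2 X\<^esub> \<in> carrier (B_ell2 X)"
    unfolding B_ell2_def by simp (rule bounded_opsI[where c = 0]; simp)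
next
  fix T assume T: "T \<in> carrier (B_ell2 X)"
  then show "\<zero>\<^bsub>B_ell2 X\<^esub> \<oplus>\<^bsub>B_ell2 X\<^esub> T = T"
    using op_undefined[of T X] by (auto simp: B_ell2_def fun_eq_iff restrict_def)
  \<comment> \<open>The combination T - 2T is -T, written so that closure under S + k T
    applies.\<close>
  have "restrict (\<lambda>f x. T f x + (-2) * T f x) (ell2 X) \<in> bounded_ops X"
    using T by (intro lincomb_op_in) auto
  then show "\<exists>S\<in>carrier (B_ell2 X). S \<oplus>\<^bsub>B_ell2 X\<^esub> T = \<zero>\<^bsub>B_ell2 X\<^esub>"
    by (intro bexI[of _ "restrict (\<lambda>f x. T f x + (-2) * T f x) (ell2 X)"])
      (auto simp: B_ell2_def fun_eq_iff restrict_def)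
qed

lemma minus_B_ell2:
  assumes S: "S \<in> bounded_ops X" and T: "T \<in> bounded_ops X" and f: "f \<in> ell2 X"
  shows "(S \<ominus>\<^bsub>B_ell2 X\<^esub> T) f = (\<lambda>x. S f x + (-1) * T f x)"
proof -
  interpret abelian_group "B_ell2 X" by (rule abelian_group_B_ell2)
  define N where "N = restrict (\<lambda>f x. T f x + (-2) * T f x) (ell2 X)"
  have N: "N \<in> bounded_ops X" unfolding N_def using T by (intro lincomb_op_in) auto
  have "N \<oplus>\<^bsub>B_ell2 X\<^esub> T = \<zero>\<^bsub>B_ell2 X\<^esub>"
    by (auto simp: N_def B_ell2_def fun_eq_iff restrict_def)
  then have "\<ominus>\<^bsub>B_ell2 X\<^esub> T = N" using minus_equality N T by simp
  then show ?thesis using f by (simp add: minus_eq) (simp add: B_ell2_def N_def fun_eq_iff)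
qed

lemma minus_B_ell2_in:
  "S \<in> bounded_ops X \<Longrightarrow> T \<in> bounded_ops X \<Longrightarrow> S \<ominus>\<^bsub>B_ell2 X\<^esub> T \<in> bounded_ops X"
  using abelian_group.minus_closed[OF abelian_group_B_ell2, of S X T] by simp

lemma Metric_space_B_ell2: "Metric_space (bounded_ops X) (cdist (B_ell2 X))"
proof
  have norm_minus: "ell2_norm X ((S \<ominus>\<^bsub>B_ell2 X\<^esub> T) f) = ell2_norm X ((T \<ominus>\<^bsub>B_ell2 X\<^esub> S) f)"
    if "S \<in> bounded_ops X" "T \<in> bounded_ops X" "f \<in> ell2 X" for S T f
  proof -
    have "(S \<ominus>\<^bsub>B_ell2 X\<^esub> T) f = (\<lambda>x. (-1) * (T \<ominus>\<^bsub>B_ell2 X\<^esub> S) f x)"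
      using that by (simp add: minus_B_ell2)
    then show ?thesis using ell2_norm_scale[of X "-1" "(T \<ominus>\<^bsub>B_ell2 X\<^esub> S) f"] by simp
  qed
  show "0 \<le> cdist (B_ell2 X) S T" for S T
    by (simp add: cdist_def op_norm_nonneg minus_B_ell2_in)
  show "cdist (B_ell2 X) S T = cdist (B_ell2 X) T S" for S T
  proof -
    have "op_norm X (S \<ominus>\<^bsub>B_ell2 X\<^esub> T) \<le> op_norm X (T \<ominus>\<^bsub>B_ell2 X\<^esub> S)"
      if "S \<in> bounded_ops X" "T \<in> bounded_ops X" for S T
      using that norm_minus[OF that] op_norm_upper[OF minus_B_ell2_in] by (intro op_norm_least) simp
    then show ?thesis by (auto simp: cdist_def intro: antisym)
  qed
  show "cdist (B_ell2 X) S T = 0 \<longleftrightarrow> S = T" if S: "S \<in> bounded_ops X" and T: "T \<in> bounded_ops X" for S T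
  proof
    assume "cdist (B_ell2 X) S T = 0"
    then have n: "op_norm X (S \<ominus>\<^bsub>B_ell2 X\<^esub> T) = 0" using S T by (simp add: cdist_def)
    show "S = T"
    proof (rule bounded_ops_eqI[OF S T])
      fix x assume x: "x \<in> X"
      let ?d = "(S \<ominus>\<^bsub>B_ell2 X\<^esub> T) (delta x)"
      have d: "?d \<in> ell2 X" using op_in[OF minus_B_ell2_in[OF S T]] x by simp
      have "ell2_norm X ?d = 0"
        using op_norm_upper[OF minus_B_ell2_in[OF S T] delta_ell2[OF x]] x n ell2_norm_nonneg[of X ?d] by simp
      then have "?d y = 0" for y
        using ell2_Cauchy_Schwarz[OF d delta_ell2[of y X]] ell2D(2)[OF d, of y]
        by (cases "y \<in> X") (auto simp: ell2_inner_delta)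
      then show "S (delta x) = T (delta x)" using minus_B_ell2[OF S T delta_ell2[OF x]] by (auto simp: fun_eq_iff)
    qed
  next
    assume "S = T"
    then have "op_norm X (S \<ominus>\<^bsub>B_ell2 X\<^esub> T) \<le> 0" using S by (intro op_norm_least) (simp add: minus_B_ell2)
    then show "cdist (B_ell2 X) S T = 0"
      using op_norm_nonneg[OF minus_B_ell2_in[OF S T]] by (simp add: cdist_def)
  qed
  show "cdist (B_ell2 X) S U \<le> cdist (B_ell2 X) S T + cdist (B_ell2 X) T U"
    if S: "S \<in> bounded_ops X" and T: "T \<in> bounded_ops X" and U: "U \<in> bounded_ops X" for S T U
  proof -
    have "op_norm X (S \<ominus>\<^bsub>B_ell2 X\<^esub> U) \<le> op_norm X (S \<ominus>\<^bsub>B_ell2 X\<^esub> T) + op_norm X (T \<ominus>\<^bsub>B_ell2 X\<^esub> U)"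
    proof (rule op_norm_least)
      fix f assume f: "f \<in> ell2 X" "ell2_norm X f \<le> 1"
      have "(S \<ominus>\<^bsub>B_ell2 X\<^esub> U) f = (\<lambda>x. (S \<ominus>\<^bsub>B_ell2 X\<^esub> T) f x + (T \<ominus>\<^bsub>B_ell2 X\<^esub> U) f x)"
        using f S T U by (simp add: minus_B_ell2)
      then have "ell2_norm X ((S \<ominus>\<^bsub>B_ell2 X\<^esub> U) f) \<le>
          ell2_norm X ((S \<ominus>\<^bsub>B_ell2 X\<^esub> T) f) + ell2_norm X ((T \<ominus>\<^bsub>B_ell2 X\<^esub> U) f)"
        using ell2_norm_triangle[OF op_in[OF minus_B_ell2_in[OF S T] f(1)] op_in[OF minus_B_ell2_in[OF T U] f(1)]]
        by (simp only:)
      also have "\<dots> \<le> op_norm X (S \<ominus>\<^bsub>B_ell2 X\<^esub> T) + op_norm X (T \<ominus>\<^bsub>B_ell2 X\<^esub> U)"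
        using op_norm_upper[OF minus_B_ell2_in] S T U f by (intro add_mono) auto
      finally show "ell2_norm X ((S \<ominus>\<^bsub>B_ell2 X\<^esub> U) f) \<le>
        op_norm X (S \<ominus>\<^bsub>B_ell2 X\<^esub> T) + op_norm X (T \<ominus>\<^bsub>B_ell2 X\<^esub> U)" .
    qed
    then show ?thesis using S T U by (simp add: cdist_def)
  qed
qed

section \<open>The sup norm of operator-valued functions on the torus\<close>

lemma C_tensor_bdd:
  assumes K: "compact K" and F: "F \<in> carrier (C_tensor K (B_ell2 X))"
  shows "bdd_above ((\<lambda>z. op_norm X (F z)) ` K)"
proof -
  interpret M: Metric_space "bounded_ops X" "cdist (B_ell2 X)" by (rule Metric_space_B_ell2)
  have FK: "F ` K \<subseteq> bounded_ops X" and cont: "continuous_map (top_of_set K) M.mtopology F"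
    using F by (auto simp: C_tensor_def norm_topology_def)
  have "compactin M.mtopology (F ` K)"
    by (rule image_compactin[OF _ cont]) (simp add: compactin_subtopology K)
  then have bnd: "M.mbounded (F ` K)" by (rule M.compactin_imp_mbounded)
  define Z where "Z = \<zero>\<^bsub>B_ell2 X\<^esub>"
  have Z: "Z \<in> bounded_ops X" using abelian_group.axioms(1)[OF abelian_group_B_ell2, of X]
      abelian_monoid.zero_closed[of "B_ell2 X"] by (simp add: Z_def)
  \<comment> \<open>With the zero operator added, boundedness in the metric becomes a bound on
    norms.\<close>
  have "M.mbounded (insert Z (F ` K))" using bnd Z by (simp add: M.mbounded_insert)
  then obtain C where C: "\<And>S T. S \<in> insert Z (F ` K) \<Longrightarrow> T \<in> insert Z (F ` K) \<Longrightarrow> cdist (B_ell2 X) S T \<le> C"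
    unfolding M.mbounded_alt by blast
  have "op_norm X (F z) \<le> C" if z: "z \<in> K" for z
  proof -
    have Fz: "F z \<in> bounded_ops X" using FK z by blast
    have "op_norm X (F z) \<le> op_norm X (F z \<ominus>\<^bsub>B_ell2 X\<^esub> Z)"
    proof (rule op_norm_least)
      fix f assume f: "f \<in> ell2 X" "ell2_norm X f \<le> 1"
      have "(F z \<ominus>\<^bsub>B_ell2 X\<^esub> Z) f = F z f"
        using minus_B_ell2[OF Fz Z f(1)] f(1) by (simp add: Z_def B_ell2_def)
      then show "ell2_norm X (F z f) \<le> op_norm X (F z \<ominus>\<^bsub>B_ell2 X\<^esub> Z)"
        using op_norm_upper[OF minus_B_ell2_in[OF Fz Z] f] by simp
    qed
    also have "\<dots> \<le> C" using C[of "F z" Z] z Fz Z by (simp add: cdist_def)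
    finally show ?thesis .
  qed
  then show ?thesis by (intro bdd_aboveI2)
qed

lemma C_tensor_norm_upper:
  assumes "compact K" "F \<in> carrier (C_tensor K (B_ell2 X))" "z \<in> K" "f \<in> ell2 X" "ell2_norm X f \<le> 1"
  shows "ell2_norm X (F z f) \<le> cnorm (C_tensor K (B_ell2 X)) F"
proof -
  have "F z \<in> bounded_ops X" using assms by (auto simp: C_tensor_def)
  then have "ell2_norm X (F z f) \<le> op_norm X (F z)" using assms by (intro op_norm_upper)
  also have "\<dots> \<le> (SUP z\<in>K. op_norm X (F z))"
    using C_tensor_bdd[OF assms(1,2)] assms(3) by (rule cSUP_upper2) simp
  finally show ?thesis by (simp add: C_tensor_def)
qed

lemma C_tensor_norm_least:
  assumes "K \<noteq> {}" "\<And>z f. z \<in> K \<Longrightarrow> f \<in> ell2 X \<Longrightarrow> ell2_norm X f \<le> 1 \<Longrightarrow> ell2_norm X (F z f) \<le> C"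
  shows "cnorm (C_tensor K (B_ell2 X)) F \<le> C"
  using assms unfolding C_tensor_def by simp (intro cSUP_least op_norm_least; blast)

lemma compact_torus: "compact (torus :: (complex ^ 'k::finite) set)"
  unfolding compact_eq_bounded_closed
proof
  show "bounded (torus :: (complex ^ 'k) set)"
  proof (rule boundedI)
    fix z :: "complex ^ 'k" assume "z \<in> torus"
    then show "norm z \<le> real CARD('k)"
      using L2_set_le_sum[of UNIV "\<lambda>i. norm (z $ i)"] by (simp add: norm_vec_def torus_def)
  qed
  show "closed (torus :: (complex ^ 'k) set)"
    unfolding torus_def by (intro closed_Collect_all closed_Collect_eq continuous_intros)
qed

lemma torus_nonempty: "(torus :: (complex ^ 'k::finite) set) \<noteq> {}"
  by (auto simp: torus_def intro!: exI[of _ "\<chi> i. 1"])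

lemma norm_torus_char: "z \<in> torus \<Longrightarrow> cmod (torus_char n z) = 1"
  by (simp add: torus_char_def torus_def norm_power_int flip: prod_norm)

section \<open>The twisted aperiodic representation\<close>

lemma delta_apply: "delta x y = (if y = x then 1 else 0)"
  by (simp add: delta_def)

locale twisted_representation = Cuntz_Krieger_algebra G A S
  for G :: "('p, 'k::finite) kgraph" and A :: "'a star_alg" and S +
  fixes \<pi> :: "'a \<Rightarrow> complex ^ 'k \<Rightarrow> ('p, 'k) ipath oper"
  assumes rep: "twisted_aperiodic_rep G A S \<pi>"
begin

abbreviation X :: "('p, 'k) ipath set" where "X \<equiv> regular_paths G"

lemma hom: "star_hom A (twisted_codomain G) \<pi>"
  using rep by (simp add: twisted_aperiodic_rep_def)

lemma rep_carrier: "a \<in> carrier A \<Longrightarrow> \<pi> a \<in> carrier (twisted_codomain G)"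
  using hom by (auto simp: star_hom_def)

lemma
  assumes z: "z \<in> torus" and a: "a \<in> carrier A"
  shows rep_in: "\<pi> a z \<in> bounded_ops X"
    and rep_scale: "f \<in> ell2 X \<Longrightarrow> \<pi> (k \<odot>\<^bsub>A\<^esub> a) z f = (\<lambda>x. k * \<pi> a z f x)"
    and rep_star: "\<pi> (star A a) z = hilbert_adjoint X (\<pi> a z)"
  using hom rep_carrier[OF a] z a
  by (auto simp: star_hom_def C_tensor_def B_ell2_def)

lemma
  assumes z: "z \<in> torus" and a: "a \<in> carrier A" and b: "b \<in> carrier A" and f: "f \<in> ell2 X"
  shows rep_add: "\<pi> (a \<oplus>\<^bsub>A\<^esub> b) z f = (\<lambda>x. \<pi> a z f x + \<pi> b z f x)"
    and rep_mult: "\<pi> (a \<cdot> b) z f = \<pi> a z (\<pi> b z f)"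
  using hom z a b f by (auto simp: star_hom_def C_tensor_def B_ell2_def)

lemma rep_ell2: "\<lbrakk>z \<in> torus; a \<in> carrier A; f \<in> ell2 X\<rbrakk> \<Longrightarrow> \<pi> a z f \<in> ell2 X"
  using op_in[OF rep_in] .

lemma rep_zero: "z \<in> torus \<Longrightarrow> f \<in> ell2 X \<Longrightarrow> \<pi> \<zero>\<^bsub>A\<^esub> z f = (\<lambda>_. 0)"
  using rep_scale[of z "\<zero>\<^bsub>A\<^esub>" f 0] by simp

lemma rep_adjoint:
  "\<lbrakk>z \<in> torus; a \<in> carrier A; f \<in> ell2 X; g \<in> ell2 X\<rbrakk> \<Longrightarrow>
    ell2_inner X (\<pi> a z f) g = ell2_inner X f (\<pi> (star A a) z g)"
  using adjoint_op_inner[OF rep_in] by (simp add: rep_star hilbert_adjoint_eq[OF rep_in])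

text \<open>The description has an explicit solution: restrict to regular paths through \<alpha> and
  compose with the shift. Invariance of regularity keeps this within the index set, and basis
  vectors give uniqueness.\<close>

lemma path_op:
  assumes \<alpha>: "\<alpha> \<in> paths G"
  shows "path_op G \<alpha> \<in> bounded_ops X"
    and "x \<in> X \<Longrightarrow> path_op G \<alpha> (delta x) =
      (if x \<in> inf_paths_from G (src G \<alpha>) then delta (prepend G \<alpha> x) else (\<lambda>_. 0))"
proof -
  let ?Q = "\<lambda>T. T \<in> bounded_ops X \<and> (\<forall>x\<in>X. T (delta x) =
        (if x \<in> inf_paths_from G (src G \<alpha>) then delta (prepend G \<alpha> x) else (\<lambda>_. 0)))"
  define D where "D = X \<inter> cylinder G \<alpha>"
  define V where "V = restrict (\<lambda>f y. if y \<in> D then f (shift (deg G \<alpha>) y) else 0) (ell2 X)"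
  have "inj_on (shift (deg G \<alpha>)) D"
    using cylinder_shift_eqI[OF \<alpha>] by (auto simp: inj_on_def D_def)
  then have "V \<in> bounded_ops X"
    unfolding V_def by (rule composition_op_in) (auto simp: D_def shift_regular)
  moreover have "V (delta x) =
      (if x \<in> inf_paths_from G (src G \<alpha>) then delta (prepend G \<alpha> x) else (\<lambda>_. 0))" if x: "x \<in> X" for x
  proof
    fix y
    show "V (delta x) y = (if x \<in> inf_paths_from G (src G \<alpha>) then delta (prepend G \<alpha> x) else (\<lambda>_. 0)) y"
    proof (cases "y \<in> D \<and> shift (deg G \<alpha>) y = x")
      case True
      then have "y \<in> cylinder G \<alpha>" "x = shift (deg G \<alpha>) y" by (auto simp: D_def)
      then show ?thesis
        using True shift_cylinder_from[OF \<alpha>, of y] prepend_shift[OF \<alpha>, of y] x by (auto simp: V_def delta_apply)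
    next
      case False
      have "y \<noteq> prepend G \<alpha> x" if "x \<in> inf_paths_from G (src G \<alpha>)"
        using False prepend_regular[OF \<alpha> that x] prepend_cylinder[OF \<alpha> that] shift_prepend[OF \<alpha> that]
        by (auto simp: D_def)
      then show ?thesis using False x by (auto simp: V_def delta_apply)
    qed
  qed
  ultimately have V: "?Q V" by blast
  have "?Q (path_op G \<alpha>)"
    unfolding path_op_def
  proof (rule theI[of ?Q, OF V])
    show "T = V" if "?Q T" for T
      using that V by (intro bounded_ops_eqI[of T X V]) auto
  qed
  then show "path_op G \<alpha> \<in> bounded_ops X"
    and "x \<in> X \<Longrightarrow> path_op G \<alpha> (delta x) =
      (if x \<in> inf_paths_from G (src G \<alpha>) then delta (prepend G \<alpha> x) else (\<lambda>_. 0))" by blast+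
qed

section \<open>The action of the generators on basis vectors\<close>

definition phase :: "complex ^ 'k \<Rightarrow> 'p \<Rightarrow> complex" where
  "phase z \<alpha> = torus_char (\<chi> i. int (deg G \<alpha> $ i)) z"

lemma phase_cnj: "z \<in> torus \<Longrightarrow> phase z \<alpha> * cnj (phase z \<alpha>) = 1"
  using complex_norm_square[of "phase z \<alpha>"] norm_torus_char[of z "\<chi> i. int (deg G \<alpha> $ i)"]
  by (simp flip: phase_def)

lemma rep_S_delta:
  assumes z: "z \<in> torus" and \<alpha>: "\<alpha> \<in> paths G" and x: "x \<in> X"
  shows "\<pi> (S \<alpha>) z (delta x) = (\<lambda>y. phase z \<alpha> *
    (if x \<in> inf_paths_from G (src G \<alpha>) then delta (prepend G \<alpha> x) else (\<lambda>_. 0)) y)"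
proof -
  have "\<pi> (S \<alpha>) z = phase z \<alpha> \<odot>\<^bsub>B_ell2 X\<^esub> path_op G \<alpha>"
    using rep \<alpha> z by (simp add: twisted_aperiodic_rep_def elem_tensor_def phase_def)
  then show ?thesis using path_op(2)[OF \<alpha> x] x by (simp add: B_ell2_def)
qed

lemma rep_S_star_delta:
  assumes z: "z \<in> torus" and \<alpha>: "\<alpha> \<in> paths G" and x: "x \<in> X"
  shows "\<pi> (star A (S \<alpha>)) z (delta x) = (\<lambda>y. cnj (phase z \<alpha>) *
    (if x \<in> cylinder G \<alpha> then delta (shift (deg G \<alpha>) x) else (\<lambda>_. 0)) y)"
proof
  fix y
  have "\<pi> (star A (S \<alpha>)) z (delta x) y = (if y \<in> X then cnj (\<pi> (S \<alpha>) z (delta y) x) else 0)"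
    using adjoint_delta[OF rep_in[OF z S_in[OF \<alpha>]] x] rep_star[OF z S_in[OF \<alpha>]] by simp
  also have "\<dots> = cnj (phase z \<alpha>) * (if x \<in> cylinder G \<alpha> then delta (shift (deg G \<alpha>) x) else (\<lambda>_. 0)) y"
  proof (cases "x \<in> cylinder G \<alpha> \<and> y = shift (deg G \<alpha>) x")
    case True
    then have "y \<in> X" "y \<in> inf_paths_from G (src G \<alpha>)" "prepend G \<alpha> y = x"
      using x shift_regular shift_cylinder_from[OF \<alpha>] prepend_shift[OF \<alpha>] by auto
    then show ?thesis using True by (simp add: rep_S_delta[OF z \<alpha>] delta_apply)
  next
    case False
    have "x \<noteq> prepend G \<alpha> y" if "y \<in> inf_paths_from G (src G \<alpha>)"
      using False prepend_cylinder[OF \<alpha> that] shift_prepend[OF \<alpha> that] by auto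
    then show ?thesis using False by (auto simp: rep_S_delta[OF z \<alpha>] delta_apply)
  qed
  finally show "\<pi> (star A (S \<alpha>)) z (delta x) y =
    cnj (phase z \<alpha>) * (if x \<in> cylinder G \<alpha> then delta (shift (deg G \<alpha>) x) else (\<lambda>_. 0)) y" .
qed

lemma rep_monomial_delta:
  assumes z: "z \<in> torus" and p: "\<alpha> \<in> paths G" "\<beta> \<in> paths G" "src G \<alpha> = src G \<beta>" and x: "x \<in> X"
  shows "\<pi> (S \<alpha> \<cdot> star A (S \<beta>)) z (delta x) = (\<lambda>y. phase z \<alpha> * cnj (phase z \<beta>) *
    (if x \<in> cylinder G \<beta> then delta (prepend G \<alpha> (shift (deg G \<beta>) x)) else (\<lambda>_. 0)) y)"
proof -
  note ops = rep_in[OF z S_in[OF p(1)]]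
  have m: "\<pi> (S \<alpha> \<cdot> star A (S \<beta>)) z (delta x) = \<pi> (S \<alpha>) z (\<pi> (star A (S \<beta>)) z (delta x))"
    using z p x by (simp add: rep_mult)
  show ?thesis
  proof (cases "x \<in> cylinder G \<beta>")
    case True
    have y: "shift (deg G \<beta>) x \<in> X" "shift (deg G \<beta>) x \<in> inf_paths_from G (src G \<alpha>)"
      using x shift_regular shift_cylinder_from[OF p(2) True] p(3) by auto
    show ?thesis
      unfolding m rep_S_star_delta[OF z p(2) x] using True y
      by (simp add: op_scale[OF ops] rep_S_delta[OF z p(1)] fun_eq_iff)
  next
    case False
    then show ?thesis unfolding m rep_S_star_delta[OF z p(2) x] by (simp add: op_zero[OF ops])
  qed
qed

lemma rep_proj_delta:
  assumes z: "z \<in> torus" and \<mu>: "\<mu> \<in> paths G" and x: "x \<in> X"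
  shows "\<pi> (proj \<mu>) z (delta x) = (if x \<in> cylinder G \<mu> then delta x else (\<lambda>_. 0))"
  unfolding range_proj_def
  using rep_monomial_delta[OF z \<mu> \<mu> refl x] phase_cnj[OF z] prepend_shift[OF \<mu>] by auto

subsection \<open>States on the image\<close>

abbreviation img where "img \<equiv> twisted_image G \<pi>"
abbreviation cod where "cod \<equiv> twisted_codomain G"

lemma carrier_image [simp]: "carrier (img B) = \<pi> ` B"
  by (simp add: twisted_image_def)

lemma image_ops:
  assumes "a \<in> carrier A" "b \<in> carrier A"
  shows "\<pi> a \<oplus>\<^bsub>img B\<^esub> \<pi> b = \<pi> (a \<oplus>\<^bsub>A\<^esub> b)"
    and "k \<odot>\<^bsub>img B\<^esub> \<pi> a = \<pi> (k \<odot>\<^bsub>A\<^esub> a)"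
    and "star (img B) (\<pi> a) \<otimes>\<^bsub>img B\<^esub> \<pi> b = \<pi> (star A a \<cdot> b)"
  using hom assms star_closed[OF assms(1)] unfolding star_hom_def
  by (simp_all add: twisted_image_def)

lemma cnorm_image: "cnorm (img B) = cnorm (cod)"
  by (simp add: twisted_image_def)

lemma state_positive_functional:
  assumes B: "star_subalgebra A B" and f: "state (img B) f"
  shows "positive_functional A B (\<lambda>a. f (\<pi> a))"
proof unfold_locales
  note BA = star_subalgebraD(1)[OF B]
  let ?I = "img B"
  have f_add: "\<forall>F\<in>\<pi> ` B. \<forall>H\<in>\<pi> ` B. f (F \<oplus>\<^bsub>?I\<^esub> H) = f F + f H"
    and f_scale: "\<forall>k. \<forall>F\<in>\<pi> ` B. f (k \<odot>\<^bsub>?I\<^esub> F) = k * f F"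
    and f_pos: "\<forall>F\<in>\<pi> ` B. f (star ?I F \<otimes>\<^bsub>?I\<^esub> F) \<in> \<real>\<^sub>\<ge>\<^sub>0"
    using f unfolding state_def carrier_image by simp_all
  show "f (\<pi> (a \<oplus>\<^bsub>A\<^esub> b)) = f (\<pi> a) + f (\<pi> b)" if "a \<in> B" "b \<in> B" for a b
    using f_add[rule_format, OF imageI[OF that(1)] imageI[OF that(2)]]
    unfolding image_ops(1)[OF BA[OF that(1)] BA[OF that(2)]] .
  show "f (\<pi> (k \<odot>\<^bsub>A\<^esub> a)) = k * f (\<pi> a)" if "a \<in> B" for k a
    using f_scale[rule_format, OF imageI[OF that], of k]
    unfolding image_ops(2)[OF BA[OF that] BA[OF that]] .
  show "f (\<pi> (star A a \<cdot> a)) \<in> \<real>\<^sub>\<ge>\<^sub>0" if "a \<in> B" for a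
    using f_pos[rule_format, OF imageI[OF that]]
    unfolding image_ops(3)[OF BA[OF that] BA[OF that]] .
qed (rule B)

text \<open>Turns the normalisation of a state into an estimate against any common bound of the
  operators on unit vectors; the state is applied to the element scaled by 1 / C.\<close>

lemma state_bound:
  assumes B: "star_subalgebra A B" and f: "state (img B) f" and a: "a \<in> B" and C: "0 < C"
    and le: "\<And>z g. z \<in> torus \<Longrightarrow> g \<in> ell2 X \<Longrightarrow> ell2_norm X g \<le> 1 \<Longrightarrow> ell2_norm X (\<pi> a z g) \<le> C"
  shows "cmod (f (\<pi> a)) \<le> C"
proof -
  interpret positive_functional A B "\<lambda>a. f (\<pi> a)" by (rule state_positive_functional[OF B f])
  let ?k = "complex_of_real (1 / C)"
  let ?H = "\<pi> (?k \<odot>\<^bsub>A\<^esub> a)"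
  have "cnorm (cod) ?H \<le> 1"
  proof (rule C_tensor_norm_least[OF torus_nonempty])
    fix z :: "complex ^ 'k" and g assume zg: "z \<in> torus" "g \<in> ell2 X" "ell2_norm X g \<le> 1"
    have "ell2_norm X (?H z g) = 1 / C * ell2_norm X (\<pi> a z g)"
      unfolding rep_scale[OF zg(1) B_simps(1)[OF a] zg(2)] ell2_norm_scale using C by (simp add: norm_divide)
    also have "\<dots> \<le> 1 / C * C" using le[OF zg] C by (intro mult_left_mono) auto
    finally show "ell2_norm X (?H z g) \<le> 1" using C by simp
  qed
  moreover have "?H \<in> \<pi> ` B" using a by simp
  ultimately have "cmod (f ?H) \<le> (SUP F\<in>{F \<in> \<pi> ` B. cnorm (cod) F \<le> 1}. cmod (f F))"
    using f unfolding state_def carrier_image cnorm_image by (intro cSUP_upper) auto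
  also have "\<dots> = 1" using f unfolding state_def carrier_image cnorm_image by blast
  finally have "cmod (?k * f (\<pi> a)) \<le> 1" using scale[OF a, of ?k] by simp
  then show ?thesis using C by (simp add: norm_mult norm_divide field_simps)
qed

lemma rep_projection_norm:
  assumes z: "z \<in> torus" and P: "P \<in> carrier A" "star A P = P" "P \<cdot> P = P" and g: "g \<in> ell2 X"
  shows "ell2_norm X (\<pi> P z g) \<le> ell2_norm X g"
proof -
  let ?p = "\<pi> P z g"
  have p: "?p \<in> ell2 X" using rep_ell2[OF z P(1) g] .
  have "complex_of_real ((ell2_norm X ?p)\<^sup>2) = ell2_inner X ?p ?p" using ell2_inner_self[OF p] by simp
  also have "\<dots> = ell2_inner X g (\<pi> P z ?p)" using rep_adjoint[OF z P(1) g p] P(2) by simp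
  also have "\<pi> P z ?p = ?p" using rep_mult[OF z P(1) P(1) g] P(3) by simp
  finally have "(ell2_norm X ?p)\<^sup>2 = cmod (ell2_inner X g ?p)"
    by (metis abs_of_nonneg norm_of_real zero_le_power2)
  also have "\<dots> \<le> ell2_norm X g * ell2_norm X ?p" by (rule ell2_Cauchy_Schwarz[OF g p])
  finally have "ell2_norm X ?p * ell2_norm X ?p \<le> ell2_norm X g * ell2_norm X ?p"
    by (simp add: power2_eq_square)
  then show ?thesis by (cases "ell2_norm X ?p = 0") (simp_all add: less_le)
qed

text \<open>If \<open>\<phi>\<close> did not vanish at some \<open>b = (1 - P) a\<close>, then \<open>\<phi> (P + t b)\<close> would grow linearly
  in \<open>t\<close>, but \<open>\<parallel>P + t b\<parallel>\<^sup>2 \<le> 1 + t\<^sup>2 \<parallel>b\<parallel>\<^sup>2\<close> because the ranges of \<open>P\<close> and \<open>b\<close> are orthogonal.\<close>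

lemma state_peaked:
  assumes B: "star_subalgebra A B" and f: "state (img B) f"
    and P: "P \<in> B" "star A P = P" "P \<cdot> P = P" "f (\<pi> P) = 1"
  shows "peaked_functional A B (\<lambda>a. f (\<pi> a)) P"
proof -
  interpret positive_functional A B "\<lambda>a. f (\<pi> a)" by (rule state_positive_functional[OF B f])
  show ?thesis
  proof unfold_locales
    fix a assume a: "a \<in> B"
    define b where "b = a \<oplus>\<^bsub>A\<^esub> (-1) \<odot>\<^bsub>A\<^esub> (P \<cdot> a)"
    have b: "b \<in> B" using a P by (simp add: b_def)
    have Pb: "P \<cdot> b = \<zero>\<^bsub>A\<^esub>"
    proof -
      have "P \<cdot> b = 1 \<odot>\<^bsub>A\<^esub> (P \<cdot> a) \<oplus>\<^bsub>A\<^esub> (-1) \<odot>\<^bsub>A\<^esub> (P \<cdot> a)"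
        using a P by (simp add: b_def mult_r_distr smult_mult_r flip: mult_assoc)
      then show ?thesis using scale_add_l[of "P \<cdot> a" 1 "-1"] a P by simp
    qed
    define c where "c = f (\<pi> b)"
    define m where "m = (cmod c)\<^sup>2"
    define K where "K = cnorm (cod) (\<pi> b)"
    \<comment> \<open>Small enough that s K^2 stays at most 1, also when K = 0.\<close>
    define s where "s = 1 / (K\<^sup>2 + 1)"
    have s: "0 < s" by (simp add: s_def add_nonneg_pos)
    \<comment> \<open>The conjugate aligns phases, making the value of the state at P + t b the real
      number 1 + s m.\<close>
    define t where "t = of_real s * cnj c"
    have t2: "(cmod t)\<^sup>2 = s\<^sup>2 * m" by (simp add: t_def m_def norm_mult power_mult_distrib)
    define W where "W = P \<oplus>\<^bsub>A\<^esub> t \<odot>\<^bsub>A\<^esub> b"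
    have W: "W \<in> B" using b P by (simp add: W_def)
    have "f (\<pi> W) = 1 + of_real (s * m)"
      using P b complex_norm_square[of c]
      by (simp add: W_def add scale t_def m_def flip: c_def)
    moreover have "0 \<le> s * m" using s by (simp add: m_def)
    ultimately have fW: "cmod (f (\<pi> W)) = 1 + s * m"
      by (metis abs_of_nonneg add_nonneg_nonneg norm_of_real of_real_1 of_real_add zero_le_one)
    have "cmod (f (\<pi> W)) \<le> sqrt (1 + s\<^sup>2 * m * K\<^sup>2)"
    proof (rule state_bound[OF B f W])
      show "0 < sqrt (1 + s\<^sup>2 * m * K\<^sup>2)" by (simp add: m_def add_pos_nonneg)
      fix z :: "complex ^ 'k" and g assume zg: "z \<in> torus" "g \<in> ell2 X" "ell2_norm X g \<le> 1"
      have PA: "P \<in> carrier A" and bA: "b \<in> carrier A" using P b by simp_all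
      let ?p = "\<pi> P z g" and ?q = "\<lambda>x. t * \<pi> b z g x"
      have p: "?p \<in> ell2 X" and q0: "\<pi> b z g \<in> ell2 X" using rep_ell2 zg PA bA by blast+
      have q: "?q \<in> ell2 X" using q0 by simp
      have "ell2_inner X ?p (\<pi> b z g) = ell2_inner X g (\<pi> P z (\<pi> b z g))"
        using rep_adjoint[OF zg(1) PA zg(2) q0] P(2) by simp
      also have "\<pi> P z (\<pi> b z g) = (\<lambda>_. 0)"
        using rep_mult[OF zg(1) PA bA zg(2)] rep_zero[OF zg(1,2)] Pb by simp
      finally have orth: "ell2_inner X ?p ?q = 0" by (simp add: ell2_inner_scale_right) (simp add: ell2_inner_def)
      have "\<pi> W z g = (\<lambda>x. ?p x + ?q x)"
        unfolding W_def using rep_add[OF zg(1) PA scale_closed[OF bA] zg(2)] rep_scale[OF zg(1) bA zg(2)] by simp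
      then have "(ell2_norm X (\<pi> W z g))\<^sup>2 = (ell2_norm X ?p)\<^sup>2 + (ell2_norm X ?q)\<^sup>2"
        using ell2_norm_add_sq[OF p q] orth by simp
      also have "\<dots> = (ell2_norm X ?p)\<^sup>2 + s\<^sup>2 * m * (ell2_norm X (\<pi> b z g))\<^sup>2"
        by (simp add: ell2_norm_scale power_mult_distrib t2)
      also have "\<dots> \<le> 1 + s\<^sup>2 * m * K\<^sup>2"
      proof (rule add_mono)
        have "ell2_norm X ?p \<le> 1" using rep_projection_norm[OF zg(1) PA P(2,3) zg(2)] zg(3) by simp
        then show "(ell2_norm X ?p)\<^sup>2 \<le> 1" by (simp add: power_le_one)
        have "ell2_norm X (\<pi> b z g) \<le> K"
          unfolding K_def using C_tensor_norm_upper[OF compact_torus rep_carrier[OF bA]] zg by blast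
        then show "s\<^sup>2 * m * (ell2_norm X (\<pi> b z g))\<^sup>2 \<le> s\<^sup>2 * m * K\<^sup>2"
          by (intro mult_left_mono power_mono) (auto simp: m_def)
      qed
      finally show "ell2_norm X (\<pi> W z g) \<le> sqrt (1 + s\<^sup>2 * m * K\<^sup>2)" by (rule real_le_rsqrt)
    qed
    then have "(1 + s * m)\<^sup>2 \<le> 1 + s\<^sup>2 * m * K\<^sup>2"
      unfolding fW using \<open>0 \<le> s * m\<close> by (metis add_nonneg_nonneg real_sqrt_ge_0_iff real_sqrt_le_iff real_sqrt_unique zero_le_one real_sqrt_abs abs_of_nonneg)
    \<comment> \<open>The left side is at least 2 s m and the right side at most s m, which leaves s
      m \<le> 0.\<close>
    then have "2 * (s * m) + (s * m)\<^sup>2 \<le> (s * m) * (s * K\<^sup>2)"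
      by (simp add: power2_sum power2_eq_square algebra_simps)
    moreover have "s * K\<^sup>2 \<le> 1" by (simp add: s_def divide_le_eq add_nonneg_pos)
    then have "(s * m) * (s * K\<^sup>2) \<le> s * m" using \<open>0 \<le> s * m\<close> by (rule mult_left_le)
    moreover have "0 \<le> (s * m)\<^sup>2" by simp
    ultimately have "s * m \<le> 0" by linarith
    then have "m \<le> 0" using s by (simp add: mult_le_0_iff)
    then have "c = 0" by (simp add: m_def)
    then show "f (\<pi> (P \<cdot> a)) = f (\<pi> a)" using a P by (simp add: c_def b_def add scale)
  qed (use P in auto)
qed

lemma vector_state_eq: "x \<in> X \<Longrightarrow> vector_state X x T = T (delta x) x"
  by (simp add: vector_state_def ell2_inner_delta)

text \<open>The supremum 1 is attained at \<open>proj (x 0 0)\<close>, which fixes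
  \<open>delta x\<close>; hence this projection has to lie in B. The cases of interest are all of
  \<open>A\<close> and the cycline subalgebra.\<close>

lemma vector_state_is_state:
  assumes B: "star_subalgebra A B" and PB: "proj (x 0 0) \<in> B" and z: "z \<in> torus" and x: "x \<in> X"
  shows "state (img B) (restrict (\<lambda>F. vector_state X x (F z)) (\<pi> ` B))" (is "state _ ?f")
proof -
  note BD = star_subalgebraD[OF B]
  note d = delta_ell2[OF x]
  let ?P = "proj (x 0 0)"
  have xi: "x \<in> inf_paths G" using x by (rule regular_in)
  have P: "?P \<in> carrier A" "star A ?P = ?P" "?P \<cdot> ?P = ?P" using ipath_0_in[OF xi, of 0] by simp_all
  have f: "?f (\<pi> a) = \<pi> a z (delta x) x" if "a \<in> B" for a
    using that x by (simp add: vector_state_eq)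
  have fP: "?f (\<pi> ?P) = 1"
    using f[OF PB] rep_proj_delta[OF z ipath_0_in[OF xi] x, of 0] in_own_cylinder[OF xi, of 0] by (simp add: delta_apply)
  have bound: "cmod (?f F) \<le> 1" if F: "F \<in> \<pi> ` B" "cnorm (cod) F \<le> 1" for F
  proof -
    obtain a where a: "a \<in> B" "F = \<pi> a" using F by blast
    have aA: "a \<in> carrier A" using a BD by blast
    have "cmod (?f F) = cmod (ell2_inner X (\<pi> a z (delta x)) (delta x))"
      using f[OF a(1)] a(2) x by (simp add: ell2_inner_delta)
    also have "\<dots> \<le> ell2_norm X (\<pi> a z (delta x))"
      using ell2_Cauchy_Schwarz[OF rep_ell2[OF z aA d] d] x by simp
    also have "\<dots> \<le> cnorm (cod) F"
      unfolding a(2) using x by (intro C_tensor_norm_upper[OF compact_torus rep_carrier[OF aA] z]) auto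
    finally show ?thesis using F by simp
  qed
  have normP: "cnorm (cod) (\<pi> ?P) \<le> 1"
    using rep_projection_norm[OF _ P] by (intro C_tensor_norm_least[OF torus_nonempty]) (meson order_trans)
  show ?thesis
    unfolding state_def carrier_image cnorm_image
  proof (intro conjI ballI allI)
    fix F H assume "F \<in> \<pi> ` B" "H \<in> \<pi> ` B"
    then obtain a b where ab: "a \<in> B" "b \<in> B" "F = \<pi> a" "H = \<pi> b" by blast
    have "F \<oplus>\<^bsub>img B\<^esub> H = \<pi> (a \<oplus>\<^bsub>A\<^esub> b)" using ab BD image_ops(1)[of a b] by simp
    then show "?f (F \<oplus>\<^bsub>img B\<^esub> H) = ?f F + ?f H"
      using f[OF ab(1)] f[OF ab(2)] f[OF BD(3)[OF ab(1,2)]] ab rep_add[OF z BD(1)[OF ab(1)] BD(1)[OF ab(2)] d] by simp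
  next
    fix k F assume "F \<in> \<pi> ` B"
    then obtain a where a: "a \<in> B" "F = \<pi> a" by blast
    have "k \<odot>\<^bsub>img B\<^esub> F = \<pi> (k \<odot>\<^bsub>A\<^esub> a)" unfolding a(2) by (rule image_ops(2)) (use a BD in auto)
    then show "?f (k \<odot>\<^bsub>img B\<^esub> F) = k * ?f F"
      using f[OF a(1)] f[OF BD(4)[OF a(1)]] a rep_scale[OF z BD(1)[OF a(1)] d] by simp
  next
    fix F assume "F \<in> \<pi> ` B"
    then obtain a where a: "a \<in> B" "F = \<pi> a" by blast
    have aA: "a \<in> carrier A" using a BD by blast
    let ?v = "\<pi> a z (delta x)"
    have v: "?v \<in> ell2 X" using rep_ell2[OF z aA d] .
    have "star (img B) F \<otimes>\<^bsub>img B\<^esub> F = \<pi> (star A a \<cdot> a)"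
      unfolding a(2) by (rule image_ops(3)[OF aA aA])
    then have "?f (star (img B) F \<otimes>\<^bsub>img B\<^esub> F) = \<pi> (star A a) z ?v x"
      using f[OF BD(5)[OF BD(6)[OF a(1)] a(1)]] rep_mult[OF z star_closed[OF aA] aA d] by simp
    also have "\<dots> = cnj (ell2_inner X (delta x) (\<pi> (star A a) z ?v))"
      using ell2_inner_commute[of X "\<pi> (star A a) z ?v" "delta x"] x by (simp add: ell2_inner_delta)
    also have "\<dots> = cnj (ell2_inner X ?v ?v)" using rep_adjoint[OF z aA d v] by simp
    also have "\<dots> \<in> \<real>\<^sub>\<ge>\<^sub>0" unfolding ell2_inner_self[OF v] by simp
    finally show "?f (star (img B) F \<otimes>\<^bsub>img B\<^esub> F) \<in> \<real>\<^sub>\<ge>\<^sub>0" .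
  next
    let ?U = "{F \<in> \<pi> ` B. cnorm (cod) F \<le> 1}"
    show bdd: "bdd_above ((\<lambda>F. cmod (?f F)) ` ?U)" using bound by (intro bdd_aboveI2[of _ _ 1]) auto
    have PU: "\<pi> ?P \<in> ?U" using PB normP by simp
    show "(SUP F\<in>?U. cmod (?f F)) = 1"
    proof (rule antisym)
      show "(SUP F\<in>?U. cmod (?f F)) \<le> 1" using PU bound by (intro cSUP_least) auto
      show "1 \<le> (SUP F\<in>?U. cmod (?f F))" using fP by (intro cSUP_upper2[OF bdd PU]) simp
    qed
  qed simp
qed

subsection \<open>Multiplicativity against the cycline subalgebra\<close>

text \<open>Range projections act on \<open>delta x\<close> as indicators of cylinders. Equality of
  those for \<alpha>\<gamma> and \<beta>\<gamma>, with \<gamma> running through the prefixes of the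
  tail y of x behind \<beta>, forces x = \<alpha>y.\<close>

lemma cycline_eigenvector:
  assumes z: "z \<in> torus" and x: "x \<in> X" and cyc: "(\<alpha>, \<beta>) \<in> cycline G A S"
  obtains c where "\<pi> (S \<alpha> \<cdot> star A (S \<beta>)) z (delta x) = (\<lambda>y. c * delta x y)"
proof -
  have p: "\<alpha> \<in> paths G" "\<beta> \<in> paths G" "src G \<alpha> = src G \<beta>"
    and proj: "\<And>\<gamma>. \<gamma> \<in> paths G \<Longrightarrow> rng G \<gamma> = src G \<alpha> \<Longrightarrow> proj (pcomp G \<alpha> \<gamma>) = proj (pcomp G \<beta> \<gamma>)"
    using cyc by (auto simp: cycline_def paths_from_def)
  have xi: "x \<in> inf_paths G" using x by (rule regular_in)
  show thesis
  proof (cases "x \<in> cylinder G \<beta>")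
    case False
    then show thesis using that[of 0] rep_monomial_delta[OF z p x] by simp
  next
    case True
    define y where "y = shift (deg G \<beta>) x"
    have y: "y \<in> inf_paths G" "y 0 0 = src G \<beta>"
      using shift_cylinder_from[OF p(2) True] by (auto simp: y_def inf_paths_from_def)
    have both: "x \<in> cylinder G \<alpha> \<and> x (deg G \<alpha>) (deg G \<alpha> + n) = y 0 n" for n
    proof -
      have g: "y 0 n \<in> paths G" "deg G (y 0 n) = n" "rng G (y 0 n) = src G \<beta>"
        using ipath_0_in[OF y(1)] deg_ipath_0[OF y(1)] rng_ipath[OF y(1) vec_le_add(3)] y(2) by auto
      have "x \<in> cylinder G (pcomp G \<beta> (y 0 n))"
        using cylinder_iff[of \<beta> "y 0 n" x] True p g by (simp add: y_def shift_def add.commute)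
      then have "\<pi> (proj (pcomp G \<beta> (y 0 n))) z (delta x) = delta x"
        using rep_proj_delta[OF z _ x] p g by (simp add: comp_in)
      \<comment> \<open>The coordinate at x separates the two possible outcomes,
        \<open>delta x\<close> and zero.\<close>
      then have "\<pi> (proj (pcomp G \<alpha> (y 0 n))) z (delta x) x = 1"
        using proj[of "y 0 n"] p g by (simp add: delta_apply)
      then have "x \<in> cylinder G (pcomp G \<alpha> (y 0 n))"
        using rep_proj_delta[OF z _ x, of "pcomp G \<alpha> (y 0 n)"] p g by (simp add: comp_in split: if_splits)
      then show ?thesis using cylinder_iff[of \<alpha> "y 0 n" x] p g by simp
    qed
    have "shift (deg G \<alpha>) x = shift 0 y"
      by (rule shift_eqI[OF xi y(1)]) (use both in auto)
    then have "shift (deg G \<alpha>) x = y" by (simp add: shift_def)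
    then have "prepend G \<alpha> y = x" using prepend_shift[OF p(1)] both by blast
    then show thesis using that rep_monomial_delta[OF z p x] True by (simp add: y_def)
  qed
qed

section \<open>The states attached to a fixed pair (z, x)\<close>

context
  fixes z :: "complex ^ 'k" and x :: "('p, 'k) ipath"
  assumes z: "z \<in> torus" and x: "x \<in> X"
begin

abbreviation e_zx where "e_zx \<equiv> e_state G A S \<pi> z x"
abbreviation psi_zx where "psi_zx \<equiv> psi_state G A \<pi> z x"

definition \<omega> :: "'a \<Rightarrow> complex" where "\<omega> a = \<pi> a z (delta x) x"

abbreviation P0 :: 'a where "P0 \<equiv> proj (x 0 0)"

lemma P0_props: "P0 \<in> carrier A" "star A P0 = P0" "P0 \<cdot> P0 = P0" "P0 \<in> cyclines"
  using ipath_0_in[OF regular_in[OF x], of 0] proj_cycline by simp_all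

lemma psi_at: "a \<in> carrier A \<Longrightarrow> psi_zx (\<pi> a) = \<omega> a"
  by (simp add: psi_state_def \<omega>_def vector_state_eq[OF x])

lemma e_at: "a \<in> cyclines \<Longrightarrow> e_zx (\<pi> a) = \<omega> a"
  using star_subalgebraD(1)[OF star_subalgebra_cyclines] by (simp add: e_state_def psi_at)

lemma functional_proj: "\<omega> (proj (x 0 n)) = 1"
  using rep_proj_delta[OF z ipath_0_in[OF regular_in[OF x]] x, of n] in_own_cylinder[OF regular_in[OF x], of n]
  by (simp add: \<omega>_def delta_apply)

lemma star_subalgebra_carrier: "star_subalgebra A (carrier A)"
  using cstar_subalgebra_carrier by (simp add: cstar_subalgebra_iff)

lemma psi_state: "state (img (carrier A)) (psi_zx)"
  unfolding psi_state_def by (rule vector_state_is_state[where x = x, OF star_subalgebra_carrier P0_props(1) z x])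

lemma e_state: "state (img cyclines) (e_zx)"
proof -
  have "e_zx = restrict (\<lambda>F. vector_state X x (F z)) (\<pi> ` cyclines)"
    unfolding e_state_def psi_state_def using star_subalgebraD(1)[OF star_subalgebra_cyclines]
    by (intro restrict_ext) auto
  then show ?thesis using vector_state_is_state[where x = x, OF star_subalgebra_cyclines P0_props(4) z x] by simp
qed

lemma functional_peaked: "peaked_functional A (carrier A) \<omega> P0"
proof -
  have "peaked_functional A (carrier A) (\<lambda>a. psi_zx (\<pi> a)) P0"
    by (rule state_peaked[OF star_subalgebra_carrier psi_state P0_props(1-3)])
      (use psi_at functional_proj P0_props in simp)
  then interpret p: peaked_functional A "carrier A" "\<lambda>a. psi_zx (\<pi> a)" P0 .
  show ?thesis
    by unfold_locales
      (use p.add p.scale p.pos p.P_left functional_proj P0_props star_subalgebra_carrier in \<open>simp_all add: psi_at\<close>)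
qed

interpretation \<phi>: peaked_functional A "carrier A" \<omega> P0 by (rule functional_peaked)

text \<open>On generators this is the eigenvector property. The elements against which \<omega> is
  multiplicative form a C*-subalgebra, closed because the peaked functional \<omega> is
  continuous.\<close>

lemma functional_mult:
  assumes a: "a \<in> cyclines" and b: "b \<in> carrier A"
  shows "\<omega> (b \<cdot> a) = \<omega> b * \<omega> a"
proof -
  \<comment> \<open>Both sides are required because the adjoint interchanges them.\<close>
  define D where "D = {a \<in> carrier A. \<forall>b\<in>carrier A.
    \<omega> (b \<cdot> a) = \<omega> b * \<omega> a \<and> \<omega> (a \<cdot> b) = \<omega> a * \<omega> b}"
  have flip: "\<omega> (star A a \<cdot> b) = cnj (\<omega> (star A b \<cdot> a))"
    "\<omega> (b \<cdot> star A a) = cnj (\<omega> (a \<cdot> star A b))"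
    if "a \<in> carrier A" "b \<in> carrier A" for a b
    using that \<phi>.functional_star[of "star A b \<cdot> a"] \<phi>.functional_star[of "a \<cdot> star A b"]
    by (simp_all add: star_mult)
  have "star_subalgebra A D"
    unfolding star_subalgebra_def
  proof (intro conjI ballI allI)
    show "a \<cdot> b \<in> D" if ab: "a \<in> D" "b \<in> D" for a b
      unfolding D_def
    proof (intro CollectI conjI ballI)
      have A: "a \<in> carrier A" "b \<in> carrier A" using ab by (auto simp: D_def)
      then show "a \<cdot> b \<in> carrier A" by simp
      fix d assume d: "d \<in> carrier A"
      have "\<omega> ((d \<cdot> a) \<cdot> b) = \<omega> d * \<omega> a * \<omega> b" "\<omega> (a \<cdot> b) = \<omega> a * \<omega> b"
        "\<omega> (a \<cdot> (b \<cdot> d)) = \<omega> a * (\<omega> b * \<omega> d)"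
        using ab A d by (simp_all add: D_def)
      then show "\<omega> (d \<cdot> (a \<cdot> b)) = \<omega> d * \<omega> (a \<cdot> b)"
        "\<omega> (a \<cdot> b \<cdot> d) = \<omega> (a \<cdot> b) * \<omega> d"
        using A d by (simp_all add: mult_assoc)
    qed
    show "star A a \<in> D" if a: "a \<in> D" for a
      unfolding D_def
    proof (intro CollectI conjI ballI)
      have aA: "a \<in> carrier A" using a by (simp add: D_def)
      then show "star A a \<in> carrier A" by simp
      fix b assume b: "b \<in> carrier A"
      have "\<omega> (star A b \<cdot> a) = \<omega> (star A b) * \<omega> a" "\<omega> (a \<cdot> star A b) = \<omega> a * \<omega> (star A b)"
        using a b by (simp_all add: D_def)
      then show "\<omega> (b \<cdot> star A a) = \<omega> b * \<omega> (star A a)"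
        "\<omega> (star A a \<cdot> b) = \<omega> (star A a) * \<omega> b"
        unfolding flip[OF aA b] using \<phi>.functional_star[OF aA] \<phi>.functional_star[OF b] by simp_all
    qed
  qed (auto simp: D_def \<phi>.zero \<phi>.add \<phi>.scale mult_l_distr mult_r_distr smult_mult_l smult_mult_r algebra_simps)
  moreover have "closedin (norm_topology A) D"
  proof (rule norm_closedI)
    fix a assume a: "a \<in> carrier A" and approx: "\<And>e. 0 < e \<Longrightarrow> \<exists>d\<in>D. cdist A a d < e"
    have "\<omega> (b \<cdot> a) = \<omega> b * \<omega> a \<and> \<omega> (a \<cdot> b) = \<omega> a * \<omega> b" if b: "b \<in> carrier A" for b
    proof -
      \<comment> \<open>Collects the error of the product and that of the product of values; the
        added 1 makes it positive.\<close>
      define L where "L = 2 * cnorm A b + 2 * cmod (\<omega> b) + 1"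
      have L: "0 < L" using norm_nonneg[OF b] by (simp add: L_def add_nonneg_pos)
      have close: "cmod (\<omega> (b \<cdot> a) - \<omega> b * \<omega> a) \<le> e \<and> cmod (\<omega> (a \<cdot> b) - \<omega> a * \<omega> b) \<le> e"
        if e: "0 < e" for e
      proof -
        obtain d where d: "d \<in> D" "cdist A a d < e / L" using approx[of "e / L"] e L by auto
        have dA: "d \<in> carrier A" using d by (simp add: D_def)
        have near: "cmod (u - w) \<le> e" if u: "cmod (u - v) \<le> 2 * (cnorm A b * cdist A a d)"
          and w: "v - w = \<omega> b * (\<omega> d - \<omega> a)" for u v w
        proof -
          have "cmod (u - w) \<le> cmod (u - v) + cmod (v - w)"
            using norm_triangle_ineq[of "u - v" "v - w"] by simp
          also have "\<dots> \<le> 2 * (cnorm A b * cdist A a d) + cmod (\<omega> b) * (2 * cdist A a d)"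
            unfolding w norm_mult using u \<phi>.bounded_diff[OF refl dA a] D.commute[of a d]
            by (intro add_mono mult_left_mono) auto
          also have "\<dots> \<le> L * cdist A a d" by (simp add: L_def algebra_simps)
          also have "\<dots> \<le> e" using d(2) L by (simp add: field_simps)
          finally show ?thesis .
        qed
        have "cmod (\<omega> (b \<cdot> a) - \<omega> (b \<cdot> d)) \<le> 2 * (cnorm A b * cdist A a d)"
          using \<phi>.bounded_diff[OF refl, of "b \<cdot> a" "b \<cdot> d"] dist_mult_l[OF a dA b] a b dA by simp
        moreover have "\<omega> (b \<cdot> d) - \<omega> b * \<omega> a = \<omega> b * (\<omega> d - \<omega> a)"
          using d(1) b by (simp add: D_def algebra_simps)
        moreover have "cmod (\<omega> (a \<cdot> b) - \<omega> (d \<cdot> b)) \<le> 2 * (cnorm A b * cdist A a d)"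
          using \<phi>.bounded_diff[OF refl, of "a \<cdot> b" "d \<cdot> b"] dist_mult_r[OF a dA b] a b dA
          by (simp add: mult.commute)
        moreover have "\<omega> (d \<cdot> b) - \<omega> a * \<omega> b = \<omega> b * (\<omega> d - \<omega> a)"
          using d(1) b by (simp add: D_def algebra_simps)
        ultimately show ?thesis using near by blast
      qed
      have "cmod (\<omega> (b \<cdot> a) - \<omega> b * \<omega> a) \<le> 0" by (rule field_le_epsilon) (simp add: close)
      moreover have "cmod (\<omega> (a \<cdot> b) - \<omega> a * \<omega> b) \<le> 0" by (rule field_le_epsilon) (simp add: close)
      ultimately show ?thesis by simp
    qed
    then show "a \<in> D" using a by (simp add: D_def)
  qed (auto simp: D_def)
  moreover have "S \<alpha> \<cdot> star A (S \<beta>) \<in> D" if cyc: "(\<alpha>, \<beta>) \<in> cycline G A S" for \<alpha> \<beta>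
  proof -
    have right: "\<omega> (b \<cdot> (S \<gamma> \<cdot> star A (S \<delta>))) = \<omega> b * \<omega> (S \<gamma> \<cdot> star A (S \<delta>))"
      if gd: "(\<gamma>, \<delta>) \<in> cycline G A S" and b: "b \<in> carrier A" for \<gamma> \<delta> b
    proof -
      have p: "\<gamma> \<in> paths G" "\<delta> \<in> paths G" using gd by (auto simp: cycline_def)
      obtain c where c: "\<pi> (S \<gamma> \<cdot> star A (S \<delta>)) z (delta x) = (\<lambda>y. c * delta x y)"
        using cycline_eigenvector[OF z x gd] by blast
      show ?thesis
        using rep_mult[OF z b, of "S \<gamma> \<cdot> star A (S \<delta>)" "delta x"] p x
          op_scale[OF rep_in[OF z b], of "delta x" c]
        by (simp add: \<omega>_def c delta_apply)
    qed
    have p: "\<alpha> \<in> paths G" "\<beta> \<in> paths G" using cyc by (auto simp: cycline_def)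
    have "\<omega> (S \<alpha> \<cdot> star A (S \<beta>) \<cdot> b) = \<omega> (S \<alpha> \<cdot> star A (S \<beta>)) * \<omega> b"
      if b: "b \<in> carrier A" for b
    proof -
      \<comment> \<open>The eigenvector property gives only multiplication from the right; the left
        version is its adjoint for the swapped pair, which is cycline too.\<close>
      let ?U = "S \<beta> \<cdot> star A (S \<alpha>)"
      have U: "?U \<in> carrier A" "star A ?U = S \<alpha> \<cdot> star A (S \<beta>)" using p by (simp_all add: star_mult)
      have "\<omega> (star A ?U \<cdot> b) = cnj (\<omega> (star A b \<cdot> ?U))" by (rule flip(1)[OF U(1) b])
      also have "\<dots> = cnj (\<omega> (star A b) * \<omega> ?U)"
        using right[OF cycline_sym[OF cyc] star_closed[OF b]] by (simp only:)
      also have "\<dots> = \<omega> (star A ?U) * \<omega> b"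
        using \<phi>.functional_star[OF U(1)] \<phi>.functional_star[OF b] by simp
      finally show ?thesis unfolding U(2) .
    qed
    then show ?thesis using right[OF cyc] p by (simp add: D_def)
  qed
  then have "{S \<alpha> \<cdot> star A (S \<beta>) |\<alpha> \<beta>. (\<alpha>, \<beta>) \<in> cycline G A S} \<subseteq> D" by blast
  ultimately have "cyclines \<subseteq> D"
    unfolding cycline_subalgebra_def cstar_generated_def cstar_subalgebra_iff by (intro Inter_lower) simp
  then show ?thesis using a b by (auto simp: D_def)
qed

text \<open>The pulled-back restriction \<omega> is multiplicative on the cycline subalgebra, so it
  annihilates \<open>star A b \<cdot> b\<close> for b = a - \<omega>(a) P0. Both components are
  nonnegative there, so g annihilates it as well, and g is peaked at P0.\<close>

lemma convex_component_eq:
  assumes g: "state (img cyclines) g" and h: "state (img cyclines) h"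
    and t: "0 < t" "t < 1"
    and conv: "\<And>F. F \<in> \<pi> ` cyclines \<Longrightarrow> e_zx F = of_real t * g F + of_real (1 - t) * h F"
  shows "g = e_zx"
proof -
  note MD = star_subalgebraD[OF star_subalgebra_cyclines]
  have conv': "\<omega> a = of_real t * g (\<pi> a) + of_real (1 - t) * h (\<pi> a)" if "a \<in> cyclines" for a
    using conv[OF imageI[OF that]] e_at[OF that] by simp
  have le1: "cmod (f (\<pi> P0)) \<le> 1" if "state (img cyclines) f" for f
  proof (rule state_bound[OF star_subalgebra_cyclines that P0_props(4)])
    show "ell2_norm X (\<pi> P0 z g) \<le> 1" if "z \<in> torus" "g \<in> ell2 X" "ell2_norm X g \<le> 1" for z g
      using rep_projection_norm[OF that(1) P0_props(1-3) that(2)] that(3) by simp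
  qed simp
  \<comment> \<open>Both components have modulus at most 1 at P0, so a convex combination equal to 1
    forces the value 1 for g.\<close>
  have "Re (of_real t * g (\<pi> P0) + of_real (1 - t) * h (\<pi> P0)) = 1"
    using conv'[OF P0_props(4)] functional_proj[of 0] by simp
  then have "t * Re (g (\<pi> P0)) + (1 - t) * Re (h (\<pi> P0)) = 1"
    by (simp only: plus_complex.sel times_complex.sel Re_complex_of_real Im_complex_of_real)
  moreover have "Re (h (\<pi> P0)) \<le> 1" "Re (g (\<pi> P0)) \<le> 1"
    using le1[OF g] le1[OF h] complex_Re_le_cmod order_trans by blast+
  then have "(1 - t) * Re (h (\<pi> P0)) \<le> (1 - t) * 1" using t by (intro mult_left_mono) auto
  ultimately have "t * 1 \<le> t * Re (g (\<pi> P0))" by simp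
  then have re: "1 \<le> Re (g (\<pi> P0))" using t by (simp add: mult_le_cancel_left)
  then have "Re (g (\<pi> P0)) = 1" using \<open>Re (g (\<pi> P0)) \<le> 1\<close> by simp
  moreover have "Im (g (\<pi> P0)) = 0"
  proof -
    have "(Re (g (\<pi> P0)))\<^sup>2 + (Im (g (\<pi> P0)))\<^sup>2 \<le> 1"
      using power_le_one[OF norm_ge_zero le1[OF g], of 2] by (simp add: cmod_power2)
    then show ?thesis using calculation by simp
  qed
  ultimately have gP: "g (\<pi> P0) = 1" by (simp add: complex_eq_iff)
  interpret g: peaked_functional A cyclines "\<lambda>a. g (\<pi> a)" P0
    by (rule state_peaked[OF star_subalgebra_cyclines g P0_props(4,2,3) gP])
  interpret h: positive_functional A cyclines "\<lambda>a. h (\<pi> a)"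
    by (rule state_positive_functional[OF star_subalgebra_cyclines h])
  have "g (\<pi> a) = \<omega> a" if a: "a \<in> cyclines" for a
  proof -
    \<comment> \<open>The part of a on which \<omega> vanishes; once g annihilates it, g at a is
      \<omega>(a) times g at P0, and the latter is 1.\<close>
    define b where "b = a \<oplus>\<^bsub>A\<^esub> (- \<omega> a) \<odot>\<^bsub>A\<^esub> P0"
    have b: "b \<in> cyclines" using a P0_props(4) MD by (simp add: b_def)
    have bA: "b \<in> carrier A" "a \<in> carrier A" using a b MD by simp_all
    have "\<omega> b = 0" using bA P0_props functional_proj[of 0] by (simp add: b_def \<phi>.add \<phi>.scale)
    then have "\<omega> (star A b \<cdot> b) = 0" using functional_mult[OF b, of "star A b"] bA by simp
    then have "of_real t * g (\<pi> (star A b \<cdot> b)) + of_real (1 - t) * h (\<pi> (star A b \<cdot> b)) = 0"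
      using conv'[of "star A b \<cdot> b"] b MD by simp
    then have "Re (of_real t * g (\<pi> (star A b \<cdot> b)) + of_real (1 - t) * h (\<pi> (star A b \<cdot> b))) = 0"
      by simp
    then have "t * Re (g (\<pi> (star A b \<cdot> b))) + (1 - t) * Re (h (\<pi> (star A b \<cdot> b))) = 0"
      by (simp only: plus_complex.sel times_complex.sel Re_complex_of_real Im_complex_of_real)
    moreover have "0 \<le> Re (g (\<pi> (star A b \<cdot> b)))" "Im (g (\<pi> (star A b \<cdot> b))) = 0"
      "0 \<le> Re (h (\<pi> (star A b \<cdot> b)))"
      using g.pos[OF b] h.pos[OF b] by (simp_all add: complex_nonneg_Reals_iff)
    moreover have "0 \<le> (1 - t) * Re (h (\<pi> (star A b \<cdot> b)))" using calculation t by simp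
    moreover have "0 \<le> t * Re (g (\<pi> (star A b \<cdot> b)))" using calculation t by simp
    ultimately have "t * Re (g (\<pi> (star A b \<cdot> b))) = 0" by linarith
    then have "g (\<pi> (star A b \<cdot> b)) = 0"
      using t \<open>Im (g (\<pi> (star A b \<cdot> b))) = 0\<close> by (simp add: complex_eq_iff)
    from g.null[OF b this] show ?thesis
      using a P0_props(4) gP MD by (simp add: b_def g.add g.scale)
  qed
  then have "g F = e_zx F" if "F \<in> \<pi> ` cyclines" for F
    using that e_at by auto
  moreover have "g \<in> extensional (\<pi> ` cyclines)" "e_zx \<in> extensional (\<pi> ` cyclines)"
    using g e_state unfolding state_def carrier_image by blast+
  ultimately show ?thesis by (intro extensionalityI)
qed

lemma e_state_pure: "pure_state (img cyclines) (e_zx)"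
  unfolding pure_state_def carrier_image
proof (intro conjI e_state allI impI)
  fix g h and t :: real
  assume a: "state (img cyclines) g \<and> state (img cyclines) h \<and> 0 < t \<and> t < 1 \<and>
    (\<forall>F\<in>\<pi> ` cyclines. e_zx F = of_real t * g F + of_real (1 - t) * h F)"
  show "g = e_zx" by (rule convex_component_eq[of g h t]) (use a in auto)
  show "h = e_zx" by (rule convex_component_eq[of h g "1 - t"]) (use a in auto)
qed

text \<open>An extension takes the value 1 at every \<open>proj (x 0 n)\<close>, since these lie in
  the cycline subalgebra; this makes it peaked and comparable with \<omega>. Extensionality then
  upgrades agreement on the image to equality of functions.\<close>

lemma extension_iff:
  "state_extension (img (carrier A)) (\<pi> ` cyclines) (e_zx) f \<longleftrightarrow>
    f = psi_zx"
proof
  assume "f = psi_zx"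
  then show "state_extension (img (carrier A)) (\<pi> ` cyclines) (e_zx) f"
    using psi_state by (simp add: state_extension_def e_state_def)
next
  assume "state_extension (img (carrier A)) (\<pi> ` cyclines) (e_zx) f"
  then have f: "state (img (carrier A)) f"
    and ext: "\<And>a. a \<in> cyclines \<Longrightarrow> f (\<pi> a) = \<omega> a"
    using e_at by (auto simp: state_extension_def)
  have fproj: "f (\<pi> (proj (x 0 n))) = 1" for n
    using ext[OF proj_cycline[OF ipath_0_in[OF regular_in[OF x]]]] functional_proj by simp
  have "peaked_functional A (carrier A) (\<lambda>a. f (\<pi> a)) P0"
    by (rule state_peaked[OF star_subalgebra_carrier f P0_props(1-3) fproj])
  from functionals_eq_of_cyclines[OF x this fproj functional_peaked functional_proj ext]
  have "f F = psi_zx F" if "F \<in> \<pi> ` carrier A" for F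
    using that psi_at by auto
  moreover have "f \<in> extensional (\<pi> ` carrier A)" "psi_zx \<in> extensional (\<pi> ` carrier A)"
    using f psi_state unfolding state_def carrier_image by blast+
  ultimately show "f = psi_zx" by (intro extensionalityI)
qed

end

end

theorem theorem7p9:
  fixes \<Lambda> :: "('p, 'k::finite) kgraph"
    and A :: "'a star_alg"
    and S :: "'p \<Rightarrow> 'a"
    and \<Upsilon> :: "'a \<Rightarrow> complex ^ 'k \<Rightarrow> ('p, 'k) ipath oper"
  assumes "k_graph \<Lambda>" and "row_finite \<Lambda>" and "no_sources \<Lambda>"
    and "universal_CK_family \<Lambda> A S"
    and "twisted_aperiodic_rep \<Lambda> A S \<Upsilon>"
  shows "(\<forall>\<rho>\<in>X_states \<Lambda> A S \<Upsilon>.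
            pure_state (twisted_image \<Lambda> \<Upsilon> (cycline_subalgebra \<Lambda> A S)) \<rho> \<and>
            (\<exists>!f. state_extension (twisted_image \<Lambda> \<Upsilon> (carrier A))
                    (\<Upsilon> ` cycline_subalgebra \<Lambda> A S) \<rho> f)) \<and>
         (\<forall>\<rho>\<in>X_states \<Lambda> A S \<Upsilon>. \<forall>z\<in>torus. \<forall>x\<in>regular_paths \<Lambda>.
            \<rho> = e_state \<Lambda> A S \<Upsilon> z x \<longrightarrow>
            (\<forall>f. state_extension (twisted_image \<Lambda> \<Upsilon> (carrier A))
                   (\<Upsilon> ` cycline_subalgebra \<Lambda> A S) \<rho> f \<longleftrightarrow> f = psi_state \<Lambda> A \<Upsilon> z x))"
proof -
  have "cstar_algebra A" and ck: "CK_family \<Lambda> A S" "cstar_generated A (S ` paths \<Lambda>) = carrier A"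
    using assms(4) by (auto simp: universal_CK_family_def)
  then interpret cstar_algebra A by simp
  interpret twisted_representation \<Lambda> A S \<Upsilon>
    by unfold_locales (use assms ck in auto)
  show ?thesis
    using e_state_pure extension_iff by (auto simp: X_states_def)
qed

end
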